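(* Let $\rho\in(0,1/2]$ be such that there is a constant $C>0$ with $Cn^{1/\rho}\le\lambda_n$ for all $n\ge1$ and $\sum_{i\ge1}\lambda_i^{-s}<\infty$ for all $s>\rho$, where $\{\lambda_i\}_{i\ge1}$ are the positive eigenvalues of $-\Delta_{W,V}$. If $s>\rho$, then $(I-\Delta_{W,V})^{-s}$ is a trace-class operator. Similarly, if $s>\rho$, then $(-\Delta_{W,V,\mathcal{D}})^{-s}$ is a trace-class operator, where $\Delta_{W,V,\mathcal{D}}$ is the Dirichlet $W$-$V$-Laplacian.
   Context: $W,V:\mathbb{R}\to\mathbb{R}$ are strictly increasing, $W$ càdlàg, $V$ càglàd, $W(x+1)-W(x)=W(1)-W(0)$ and $V(x+1)-V(x)=V(1)-V(0)$ for all $x$, both are continuous at $0$ and $W(0)=V(0)=0$. $\mathbb{T}=\mathbb{R}/\mathbb{Z}\cong[0,1)$; $dW((a,b])=W(b)-W(a)$, $dV([a,b))=V(b)-V(a)$; $L^2_V(\mathbb{T})$ is the $L^2$ space of $dV$; $L^2_{V,0}(\mathbb{T})$ is its subspace of functions with zero $dV$-integral. All operators act on $L^2_V(\mathbb{T})$. $\mathcal{D}_{W,V}(\mathbb{T})$ is the set of $f\in L^2_V(\mathbb{T})$ for which there are $a,b\in\mathbb{R}$, $\mathfrak{f}\in L^2_{V,0}(\mathbb{T})$ with $f(x)=a+bW(x)+\int_{(0,x]}\int_{[0,y)}\mathfrak{f}(s)\,dV(s)\,dW(y)$ and $bW(1)+\int_{(0,1]}\int_{[0,y)}\mathfrak{f}\,dV\,dW(y)=0$;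 then $\Delta_{W,V}f:=\mathfrak{f}$. $\Delta_{W,V}$ is self-adjoint with compact resolvent, and the eigenvalues of $-\Delta_{W,V}$ with multiplicity are $0=\lambda_0<\lambda_1\le\lambda_2\le\cdots\to\infty$. (A $\rho$ as in the claim exists.) $\Delta_{W,V,\mathcal{D}}$ has as domain the $f\in L^2_V(\mathbb{T})$ for which there are $b\in\mathbb{R}$, $\mathfrak{f}\in L^2_V(\mathbb{T})$ with $f(x)=bW(x)+\int_{(0,x]}\int_{[0,y)}\mathfrak{f}(s)\,dV(s)\,dW(y)$ and $bW(1)+\int_{(0,1]}\int_{[0,y)}\mathfrak{f}\,dV\,dW(y)=0$ (so $f(0)=f(1)=0$); $\Delta_{W,V,\mathcal{D}}f:=\mathfrak{f}$. It is self-adjoint and $-\Delta_{W,V,\mathcal{D}}$ is positive with compact inverse. Fractional powers are defined by the Borel functional calculus. *)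

theory Defs
  imports "HOL-Analysis.Analysis"
begin

section \<open>Real $L^2$ spaces and operators on them\<close>

text \<open>
  Elements of \<open>L\<^sup>2(M)\<close> are represented by functions, equality being equality almost everywhere.
  A (possibly unbounded) operator is represented by its graph, which is closed under changing
  representatives.  Hence equality of graphs is equality of operators, domains included, and
  \<open>T O S\<close> is the composition ``first \<open>T\<close>, then \<open>S\<close>'' with its maximal domain.
\<close>

definition L2 :: "'a measure \<Rightarrow> ('a \<Rightarrow> real) set" where
  "L2 M = {f \<in> borel_measurable M. integrable M (\<lambda>x. (f x)\<^sup>2)}"

definition l2_eq :: "'a measure \<Rightarrow> ('a \<Rightarrow> real) \<Rightarrow> ('a \<Rightarrow> real) \<Rightarrow> bool" where
  "l2_eq M f g \<longleftrightarrow> f \<in> L2 M \<and> g \<in> L2 M \<and> (AE x in M. f x = g x)"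

definition l2_inner :: "'a measure \<Rightarrow> ('a \<Rightarrow> real) \<Rightarrow> ('a \<Rightarrow> real) \<Rightarrow> real" where
  "l2_inner M f g = (\<integral>x. f x * g x \<partial>M)"

definition l2_norm :: "'a measure \<Rightarrow> ('a \<Rightarrow> real) \<Rightarrow> real" where
  "l2_norm M f = sqrt (l2_inner M f f)"

type_synonym 'a l2op = "(('a \<Rightarrow> real) \<times> ('a \<Rightarrow> real)) set"

definition l2_operator :: "'a measure \<Rightarrow> 'a l2op \<Rightarrow> bool" where
  "l2_operator M T \<longleftrightarrow>
     T \<subseteq> L2 M \<times> L2 M \<and>
     (\<forall>f g f' g'. (f, g) \<in> T \<and> l2_eq M f f' \<and> l2_eq M g g' \<longrightarrow> (f', g') \<in> T) \<and>
     (\<forall>f g f' g' a b. (f, g) \<in> T \<and> (f', g') \<in> T \<longrightarrow>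
        ((\<lambda>x. a * f x + b * f' x), (\<lambda>x. a * g x + b * g' x)) \<in> T) \<and>
     (\<forall>f g g'. (f, g) \<in> T \<and> (f, g') \<in> T \<longrightarrow> l2_eq M g g')"

definition l2_bounded_op :: "'a measure \<Rightarrow> 'a l2op \<Rightarrow> bool" where
  "l2_bounded_op M T \<longleftrightarrow>
     l2_operator M T \<and> Domain T = L2 M \<and> (\<exists>K. \<forall>(f, g) \<in> T. l2_norm M g \<le> K * l2_norm M f)"

text \<open>The chosen representative of \<open>T f\<close> is determined up to almost-everywhere equality.\<close>

definition l2_app :: "'a l2op \<Rightarrow> ('a \<Rightarrow> real) \<Rightarrow> ('a \<Rightarrow> real)" where
  "l2_app T f = (SOME g. (f, g) \<in> T)"

definition l2_id :: "'a measure \<Rightarrow> 'a l2op" where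
  "l2_id M = {(f, g). l2_eq M f g}"

definition l2_adjoint :: "'a measure \<Rightarrow> 'a l2op \<Rightarrow> 'a l2op" where
  "l2_adjoint M T = {(g, h). g \<in> L2 M \<and> h \<in> L2 M \<and>
     (\<forall>(f, f') \<in> T. l2_inner M f' g = l2_inner M f h)}"

text \<open>The operators \<open>-T\<close> and \<open>I - T\<close>, both with the domain of \<open>T\<close>.\<close>

definition l2_neg :: "'a l2op \<Rightarrow> 'a l2op" where
  "l2_neg T = {(f, g). (f, \<lambda>x. - g x) \<in> T}"

definition l2_id_minus :: "'a l2op \<Rightarrow> 'a l2op" where
  "l2_id_minus T = {(f, g). (f, \<lambda>x. f x - g x) \<in> T}"


subsection \<open>Eigenvalues with multiplicity\<close>

definition l2_eigenspace :: "'a measure \<Rightarrow> 'a l2op \<Rightarrow> real \<Rightarrow> ('a \<Rightarrow> real) set" where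
  "l2_eigenspace M T \<mu> = {f \<in> L2 M. (f, \<lambda>x. \<mu> * f x) \<in> T}"

text \<open>\<open>U\<close> has a basis of \<open>n\<close> elements (modulo almost-everywhere equality):
  coordinates exist and are unique.\<close>

definition l2_has_dim :: "'a measure \<Rightarrow> ('a \<Rightarrow> real) set \<Rightarrow> nat \<Rightarrow> bool" where
  "l2_has_dim M U n \<longleftrightarrow>
     (\<exists>b. (\<forall>i<n. b i \<in> U) \<and>
          (\<forall>f\<in>U. \<exists>!c. c \<in> {..<n} \<rightarrow>\<^sub>E (UNIV :: real set) \<and>
                      (AE x in M. f x = (\<Sum>i<n. c i * b i x))))"

text \<open>\<open>ev 0 \<le> ev 1 \<le> \<dots>\<close> lists all eigenvalues of \<open>T\<close>, each repeated according to its
  multiplicity.\<close>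

definition l2_eigenvalue_sequence :: "'a measure \<Rightarrow> 'a l2op \<Rightarrow> (nat \<Rightarrow> real) \<Rightarrow> bool" where
  "l2_eigenvalue_sequence M T ev \<longleftrightarrow>
     incseq ev \<and>
     (\<forall>\<mu>. finite {n. ev n = \<mu>} \<and> l2_has_dim M (l2_eigenspace M T \<mu>) (card {n. ev n = \<mu>}))"


subsection \<open>Borel functional calculus\<close>

definition l2_projection :: "'a measure \<Rightarrow> 'a l2op \<Rightarrow> bool" where
  "l2_projection M P \<longleftrightarrow> l2_bounded_op M P \<and> P O P = P \<and> l2_adjoint M P = P"

definition projection_valued_measure :: "'a measure \<Rightarrow> (real set \<Rightarrow> 'a l2op) \<Rightarrow> bool" where
  "projection_valued_measure M E \<longleftrightarrow>
     (\<forall>B\<in>sets borel. l2_projection M (E B)) \<and>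
     E UNIV = l2_id M \<and>
     (\<forall>A\<in>sets borel. \<forall>B\<in>sets borel. E (A \<inter> B) = E B O E A) \<and>
     (\<forall>B. range B \<subseteq> sets borel \<and> disjoint_family B \<longrightarrow>
        (\<forall>f\<in>L2 M. (\<lambda>n. l2_norm M (\<lambda>x. l2_app (E (\<Union>i. B i)) f x - (\<Sum>i<n. l2_app (E (B i)) f x)))
                    \<longlonglongrightarrow> 0))"

text \<open>The scalar spectral measure \<open>B \<mapsto> \<langle>E(B) f, f\<rangle>\<close>.\<close>

definition spectral_dist ::
    "'a measure \<Rightarrow> (real set \<Rightarrow> 'a l2op) \<Rightarrow> ('a \<Rightarrow> real) \<Rightarrow> real measure" where
  "spectral_dist M E f =
     measure_of UNIV (sets borel) (\<lambda>B. ennreal (l2_inner M (l2_app (E B) f) f))"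

text \<open>
  The operator \<open>\<integral> \<phi> dE\<close> for a Borel function \<open>\<phi>\<close>.  Its domain consists of the \<open>f\<close> with
  \<open>\<integral> \<phi>\<^sup>2 d\<langle>E f, f\<rangle> < \<infinity>\<close>, and it is determined by
  \<open>\<langle>(\<integral> \<phi> dE) f, h\<rangle> = \<integral> \<phi> d\<langle>E f, h\<rangle>\<close> for all \<open>h\<close> in that (dense) domain; the signed measure
  \<open>\<langle>E f, h\<rangle>\<close> is expressed by polarization.
\<close>

definition spectral_integral ::
    "'a measure \<Rightarrow> (real set \<Rightarrow> 'a l2op) \<Rightarrow> (real \<Rightarrow> real) \<Rightarrow> 'a l2op" where
  "spectral_integral M E \<phi> =
     (let D = {f \<in> L2 M. integrable (spectral_dist M E f) (\<lambda>t. (\<phi> t)\<^sup>2)} in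
      {(f, g). f \<in> D \<and> g \<in> L2 M \<and>
         (\<forall>h\<in>D. l2_inner M g h =
            ((\<integral>t. \<phi> t \<partial>spectral_dist M E (\<lambda>x. f x + h x)) -
             (\<integral>t. \<phi> t \<partial>spectral_dist M E (\<lambda>x. f x - h x))) / 4)})"

definition spectral_resolution :: "'a measure \<Rightarrow> 'a l2op \<Rightarrow> (real set \<Rightarrow> 'a l2op) \<Rightarrow> bool" where
  "spectral_resolution M A E \<longleftrightarrow>
     projection_valued_measure M E \<and> A = spectral_integral M E (\<lambda>t. t)"

text \<open>By the spectral theorem a self-adjoint \<open>A\<close> has a spectral resolution, unique on Borel sets.\<close>

definition borel_calculus :: "'a measure \<Rightarrow> 'a l2op \<Rightarrow> (real \<Rightarrow> real) \<Rightarrow> 'a l2op" where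
  "borel_calculus M A \<phi> = spectral_integral M (SOME E. spectral_resolution M A E) \<phi>"

text \<open>Meant for self-adjoint \<open>A\<close> with spectral measure concentrated on \<open>(0, \<infinity>)\<close>, so that the values
  of \<open>powr\<close> at nonpositive arguments are irrelevant.\<close>

definition l2_powr :: "'a measure \<Rightarrow> 'a l2op \<Rightarrow> real \<Rightarrow> 'a l2op" where
  "l2_powr M A r = borel_calculus M A (\<lambda>t. t powr r)"


subsection \<open>Trace-class operators\<close>

definition l2_orthonormal_basis :: "'a measure \<Rightarrow> ('a \<Rightarrow> real) set \<Rightarrow> bool" where
  "l2_orthonormal_basis M S \<longleftrightarrow>
     S \<subseteq> L2 M \<and>
     (\<forall>e\<in>S. l2_norm M e = 1) \<and>
     (\<forall>e\<in>S. \<forall>e'\<in>S. e \<noteq> e' \<longrightarrow> l2_inner M e e' = 0) \<and>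
     (\<forall>f\<in>L2 M. (\<forall>e\<in>S. l2_inner M f e = 0) \<longrightarrow> (AE x in M. f x = 0))"

definition l2_positive_op :: "'a measure \<Rightarrow> 'a l2op \<Rightarrow> bool" where
  "l2_positive_op M P \<longleftrightarrow>
     l2_bounded_op M P \<and> l2_adjoint M P = P \<and> (\<forall>(f, g) \<in> P. 0 \<le> l2_inner M g f)"

text \<open>\<open>P = |T|\<close>, the positive square root of \<open>T\<^sup>* T\<close>.\<close>

definition l2_absolute_value :: "'a measure \<Rightarrow> 'a l2op \<Rightarrow> 'a l2op \<Rightarrow> bool" where
  "l2_absolute_value M T P \<longleftrightarrow> l2_positive_op M P \<and> P O P = T O l2_adjoint M T"

text \<open>The trace of \<open>|T|\<close> does not depend on the orthonormal basis.\<close>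

definition trace_class :: "'a measure \<Rightarrow> 'a l2op \<Rightarrow> bool" where
  "trace_class M T \<longleftrightarrow>
     l2_bounded_op M T \<and>
     (\<exists>P S. l2_absolute_value M T P \<and> l2_orthonormal_basis M S \<and>
            (\<lambda>e. l2_inner M (l2_app P e) e) summable_on S)"


section \<open>The $W$-$V$-Laplacians on the torus\<close>

definition cadlag :: "(real \<Rightarrow> real) \<Rightarrow> bool" where
  "cadlag f \<longleftrightarrow> (\<forall>x. continuous (at_right x) f \<and> (\<exists>l. (f \<longlongrightarrow> l) (at_left x)))"

definition caglad :: "(real \<Rightarrow> real) \<Rightarrow> bool" where
  "caglad f \<longleftrightarrow> (\<forall>x. continuous (at_left x) f \<and> (\<exists>l. (f \<longlongrightarrow> l) (at_right x)))"

text \<open>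
  For right-continuous \<open>W\<close> the measure \<open>dW\<close> with \<open>dW((a,b]) = W b - W a\<close> is \<open>interval_measure W\<close>.
  For left-continuous \<open>V\<close> the measure \<open>dV\<close> with \<open>dV([a,b)) = V b - V a\<close> is obtained by reflection.
\<close>

definition interval_measure_left :: "(real \<Rightarrow> real) \<Rightarrow> real measure" where
  "interval_measure_left V = distr (interval_measure (\<lambda>x. - V (- x))) borel uminus"

lemma emeasure_interval_measure_left_Ico:
  assumes "a \<le> b" and mono: "\<And>x y. x \<le> y \<Longrightarrow> V x \<le> V y"
    and left_cont: "\<And>x. continuous (at_left x) V"
  shows "emeasure (interval_measure_left V) {a..<b} = V b - V a"
proof -
  have "continuous (at_right x) (\<lambda>x. - V (- x))" for x :: real
  proof -
    have "(V \<longlongrightarrow> V (- x)) (at_left (- x))"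
      using left_cont[of "- x"] by (simp add: continuous_within)
    then have "((\<lambda>y. V (- y)) \<longlongrightarrow> V (- x)) (at_right x)"
      by (simp add: at_left_minus filterlim_filtermap)
    then show ?thesis
      by (simp add: continuous_within tendsto_minus)
  qed
  moreover have "uminus -` {a..<b} = {- b<..- a}"
    by auto
  ultimately show ?thesis
    using assms(1) mono
    by (simp add: interval_measure_left_def emeasure_distr emeasure_interval_measure_Ioc)
qed

text \<open>The torus is identified with \<open>[0,1)\<close>, and \<open>L\<^sup>2\<^sub>V(\<T>)\<close> is \<open>L2 (torus_measure V)\<close>.\<close>

definition torus_measure :: "(real \<Rightarrow> real) \<Rightarrow> real measure" where
  "torus_measure V = restrict_space (interval_measure_left V) {0..<1}"

definition L2_zero_mean :: "(real \<Rightarrow> real) \<Rightarrow> (real \<Rightarrow> real) set" where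
  "L2_zero_mean V = {f \<in> L2 (torus_measure V). (\<integral>x. f x \<partial>torus_measure V) = 0}"

text \<open>\<open>WV_integral W V g x\<close> is \<open>\<integral>\<^bsub>(0,x]\<^esub> \<integral>\<^bsub>[0,y)\<^esub> g dV dW(y)\<close>.\<close>

definition WV_integral :: "(real \<Rightarrow> real) \<Rightarrow> (real \<Rightarrow> real) \<Rightarrow> (real \<Rightarrow> real) \<Rightarrow> real \<Rightarrow> real" where
  "WV_integral W V g x =
     (LINT y:{0<..x}|interval_measure W. (LINT s:{0..<y}|interval_measure_left V. g s))"

definition WV_laplacian :: "(real \<Rightarrow> real) \<Rightarrow> (real \<Rightarrow> real) \<Rightarrow> real l2op" where
  "WV_laplacian W V = {(f, g). f \<in> L2 (torus_measure V) \<and> g \<in> L2_zero_mean V \<and>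
     (\<exists>a b. (AE x in torus_measure V. f x = a + b * W x + WV_integral W V g x) \<and>
            b * W 1 + WV_integral W V g 1 = 0)}"

definition WV_laplacian_dirichlet :: "(real \<Rightarrow> real) \<Rightarrow> (real \<Rightarrow> real) \<Rightarrow> real l2op" where
  "WV_laplacian_dirichlet W V = {(f, g). f \<in> L2 (torus_measure V) \<and> g \<in> L2 (torus_measure V) \<and>
     (\<exists>b. (AE x in torus_measure V. f x = b * W x + WV_integral W V g x) \<and>
          b * W 1 + WV_integral W V g 1 = 0)}"

end

theory Submission
  imports Defs "HOL-Complex_Analysis.Great_Picard"
begin

text \<open>
  Let \<open>G\<close> be the Green operator of the Dirichlet problem and \<open>P\<close> the orthogonal projection onto the functions
  of mean zero.  Both are given by explicit integrals: \<open>-\<Delta>\<^sub>D\<close> is the inverse of \<open>G\<close>, and \<open>-\<Delta>\<close> is, up to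
  constants, the inverse of \<open>P G P\<close>.  Since \<open>\<langle>G f, h\<rangle>\<close> is the \<open>L\<^sup>2(dW)\<close> inner product of the centered tail
  integrals of \<open>f\<close> and \<open>h\<close>, the operator \<open>G\<close> is symmetric and strictly positive; it is compact by
  Arzela-Ascoli.  So both Laplacians are diagonal in orthonormal bases of eigenfunctions, where the Borel
  functional calculus acts on the diagonal, and it remains to sum eigenvalues.

  For the periodic operator the sum is a hypothesis.  For the Dirichlet operator let \<open>\<kappa>\<close> run through the
  eigenvalues of \<open>G\<close>, and \<open>e\<close> through the periodic eigenbasis.  For \<open>0 \<le> t \<le> 1\<close> Jensen's inequality gives
  \<open>\<Sum> \<kappa>\<^sup>t = \<Sum> \<langle>G\<^sup>t e, e\<rangle> \<le> \<Sum> \<langle>G e, e\<rangle>\<^sup>t\<close>, and \<open>\<langle>G e, e\<rangle> = \<langle>P G P e, e\<rangle>\<close> is the inverse of a periodic eigenvalue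
  for every nonconstant \<open>e\<close>; this replaces the comparison of eigenvalues by the min-max principle.
\<close>

section \<open>The space $L^2$\<close>

text \<open>The calculus is defined through an arbitrary choice of a spectral resolution, so
  diagonalizing is not enough: a diagonal operator has to be shown to admit only one resolution on
  Borel sets. Abstract projection-valued measures enter for this reason. Eigenbases come from Zorn's
  lemma as bare sets; sums over them are integrals over a counting measure, which brings dominated
  convergence and exchange of integrals without an enumeration. Jensen is available only for
  exponents up to 1. As \<rho> \<le> 1/2, such an exponent can be chosen above \<rho>, and larger
  powers follow because \<open>green\<close> is bounded. A constant basis vector has periodic
  eigenvalue 0, which says nothing about the form of G there; it costs a single term. The basis is
  linked to the listed eigenvalues by an injection into the indices, which is all that upper bounds
  of sums require. Inverting G needs strict positivity, which rests on \<open>W\<close> being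
  strictly increasing and on \<open>dV\<close> having no atom at 0.\<close>

lemma L2_measurable [measurable_dest]: "f \<in> L2 M \<Longrightarrow> f \<in> borel_measurable M"
  by (simp add: L2_def)

lemma L2_square_integrable: "f \<in> L2 M \<Longrightarrow> integrable M (\<lambda>x. (f x)\<^sup>2)"
  by (simp add: L2_def)

lemma L2_mult_integrable:
  assumes "f \<in> L2 M" "g \<in> L2 M"
  shows "integrable M (\<lambda>x. f x * g x)"
proof (rule Bochner_Integration.integrable_bound)
  show "integrable M (\<lambda>x. (f x)\<^sup>2 + (g x)\<^sup>2)"
    using assms by (simp add: L2_def)
  show "(\<lambda>x. f x * g x) \<in> borel_measurable M"
    using assms[THEN L2_measurable] by measurable
  have "\<bar>a * b\<bar> \<le> a\<^sup>2 + b\<^sup>2" for a b :: real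
  proof -
    have "0 \<le> \<bar>a\<bar> * \<bar>b\<bar>" by simp
    with sum_squares_bound[of "\<bar>a\<bar>" "\<bar>b\<bar>"] show ?thesis
      unfolding abs_mult mult.assoc power2_abs by linarith
  qed
  then show "AE x in M. norm (f x * g x) \<le> norm ((f x)\<^sup>2 + (g x)\<^sup>2)"
    by (auto intro!: AE_I2)
qed

lemma L2_lincomb:
  assumes "f \<in> L2 M" "g \<in> L2 M"
  shows "(\<lambda>x. a * f x + b * g x) \<in> L2 M"
proof -
  have "integrable M (\<lambda>x. a\<^sup>2 * (f x)\<^sup>2 + 2 * a * b * (f x * g x) + b\<^sup>2 * (g x)\<^sup>2)"
    using assms L2_mult_integrable[OF assms] by (intro Bochner_Integration.integrable_add integrable_mult_right)
      (auto simp: L2_def)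
  moreover have "(\<lambda>x. a\<^sup>2 * (f x)\<^sup>2 + 2 * a * b * (f x * g x) + b\<^sup>2 * (g x)\<^sup>2) = (\<lambda>x. (a * f x + b * g x)\<^sup>2)"
    by (auto simp: power2_eq_square algebra_simps)
  moreover have "(\<lambda>x. a * f x + b * g x) \<in> borel_measurable M"
    using assms[THEN L2_measurable] by measurable
  ultimately show ?thesis
    by (simp add: L2_def)
qed

lemma L2_add: "f \<in> L2 M \<Longrightarrow> g \<in> L2 M \<Longrightarrow> (\<lambda>x. f x + g x) \<in> L2 M"
  using L2_lincomb[of f M g 1 1] by simp

lemma L2_diff: "f \<in> L2 M \<Longrightarrow> g \<in> L2 M \<Longrightarrow> (\<lambda>x. f x - g x) \<in> L2 M"
  using L2_lincomb[of f M g 1 "-1"] by simp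

lemma L2_scale: "f \<in> L2 M \<Longrightarrow> (\<lambda>x. a * f x) \<in> L2 M"
  using L2_lincomb[of f M f a 0] by simp

lemma L2_uminus: "f \<in> L2 M \<Longrightarrow> (\<lambda>x. - f x) \<in> L2 M"
  using L2_scale[of f M "-1"] by simp

lemma L2_zero: "(\<lambda>x. 0) \<in> L2 M"
  by (simp add: L2_def)

lemma L2_sum: "(\<And>i. i \<in> I \<Longrightarrow> f i \<in> L2 M) \<Longrightarrow> (\<lambda>x. \<Sum>i\<in>I. f i x) \<in> L2 M"
  by (induction I rule: infinite_finite_induct) (auto intro: L2_add L2_zero)

lemmas L2_intros = L2_add L2_diff L2_scale L2_uminus L2_zero L2_sum

lemma l2_inner_commute: "l2_inner M f g = l2_inner M g f"
  by (simp add: l2_inner_def mult.commute)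

lemma l2_inner_add_left:
  "f \<in> L2 M \<Longrightarrow> g \<in> L2 M \<Longrightarrow> h \<in> L2 M \<Longrightarrow>
    l2_inner M (\<lambda>x. f x + g x) h = l2_inner M f h + l2_inner M g h"
  unfolding l2_inner_def
  by (subst Bochner_Integration.integral_add[symmetric]) (auto intro: L2_mult_integrable simp: algebra_simps)

lemma l2_inner_diff_left:
  "f \<in> L2 M \<Longrightarrow> g \<in> L2 M \<Longrightarrow> h \<in> L2 M \<Longrightarrow>
    l2_inner M (\<lambda>x. f x - g x) h = l2_inner M f h - l2_inner M g h"
  unfolding l2_inner_def
  by (subst Bochner_Integration.integral_diff[symmetric]) (auto intro: L2_mult_integrable simp: algebra_simps)

lemma l2_inner_scale_left: "l2_inner M (\<lambda>x. a * f x) h = a * l2_inner M f h"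
  unfolding l2_inner_def by (simp add: mult.assoc)

lemma l2_inner_uminus_left: "l2_inner M (\<lambda>x. - f x) h = - l2_inner M f h"
  unfolding l2_inner_def by simp

lemma l2_inner_zero_left: "l2_inner M (\<lambda>x. 0) h = 0"
  unfolding l2_inner_def by simp

lemma l2_inner_sum_left:
  "(\<And>i. i \<in> I \<Longrightarrow> f i \<in> L2 M) \<Longrightarrow> h \<in> L2 M \<Longrightarrow>
    l2_inner M (\<lambda>x. \<Sum>i\<in>I. f i x) h = (\<Sum>i\<in>I. l2_inner M (f i) h)"
  by (induction I rule: infinite_finite_induct)
    (auto simp: l2_inner_zero_left l2_inner_add_left L2_sum)

lemmas l2_inner_left = l2_inner_add_left l2_inner_diff_left l2_inner_scale_left
  l2_inner_uminus_left l2_inner_zero_left l2_inner_sum_left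

lemma l2_inner_add_right:
  "f \<in> L2 M \<Longrightarrow> g \<in> L2 M \<Longrightarrow> h \<in> L2 M \<Longrightarrow>
    l2_inner M h (\<lambda>x. f x + g x) = l2_inner M h f + l2_inner M h g"
  by (simp add: l2_inner_commute[of M h] l2_inner_left)

lemma l2_inner_diff_right:
  "f \<in> L2 M \<Longrightarrow> g \<in> L2 M \<Longrightarrow> h \<in> L2 M \<Longrightarrow>
    l2_inner M h (\<lambda>x. f x - g x) = l2_inner M h f - l2_inner M h g"
  by (simp add: l2_inner_commute[of M h] l2_inner_left)

lemma l2_inner_scale_right: "l2_inner M h (\<lambda>x. a * f x) = a * l2_inner M h f"
  by (simp add: l2_inner_commute[of M h] l2_inner_left)

lemma l2_inner_uminus_right: "l2_inner M h (\<lambda>x. - f x) = - l2_inner M h f"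
  by (simp add: l2_inner_commute[of M h] l2_inner_left)

lemma l2_inner_zero_right: "l2_inner M h (\<lambda>x. 0) = 0"
  by (simp add: l2_inner_commute[of M h] l2_inner_left)

lemma l2_inner_sum_right:
  "(\<And>i. i \<in> I \<Longrightarrow> f i \<in> L2 M) \<Longrightarrow> h \<in> L2 M \<Longrightarrow>
    l2_inner M h (\<lambda>x. \<Sum>i\<in>I. f i x) = (\<Sum>i\<in>I. l2_inner M h (f i))"
  by (simp add: l2_inner_commute[of M h] l2_inner_left)

lemmas l2_inner_right = l2_inner_add_right l2_inner_diff_right l2_inner_scale_right
  l2_inner_uminus_right l2_inner_zero_right l2_inner_sum_right

lemma l2_inner_self_nonneg: "0 \<le> l2_inner M f f"
  unfolding l2_inner_def by (intro integral_nonneg_AE) auto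

lemma l2_inner_self_eq_0: "f \<in> L2 M \<Longrightarrow> l2_inner M f f = 0 \<longleftrightarrow> (AE x in M. f x = 0)"
  unfolding l2_inner_def
  by (subst integral_nonneg_eq_0_iff_AE) (auto intro: L2_mult_integrable)

lemma l2_inner_cong_AE:
  assumes "f \<in> L2 M" "f' \<in> L2 M" "g \<in> L2 M" "g' \<in> L2 M"
    and "AE x in M. f x = f' x" "AE x in M. g x = g' x"
  shows "l2_inner M f g = l2_inner M f' g'"
  unfolding l2_inner_def
proof (rule integral_cong_AE)
  show "AE x in M. f x * g x = f' x * g' x"
    using assms(5,6) by eventually_elim simp
qed (use assms in \<open>auto simp: L2_def\<close>)

text \<open>Evaluate at the minimum \<open>t = - b / c\<close>. Bare numbers make it serve the inner
  product as well as the possibly degenerate form of a positive operator.\<close>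

lemma quadratic_nonneg_discriminant:
  fixes a b c :: real
  assumes nn: "\<And>t. 0 \<le> a + 2 * t * b + t\<^sup>2 * c" and c0: "0 \<le> c"
  shows "b\<^sup>2 \<le> a * c"
proof (cases "c = 0")
  case True
  have "b = 0"
  proof (rule ccontr)
    assume "b \<noteq> 0"
    \<comment> \<open>With \<open>c = 0\<close> the polynomial is linear in \<open>t\<close>, and
      this \<open>t\<close> gives it the value \<open>-1\<close>.\<close>
    then have "2 * (- (a + 1) / (2 * b)) * b = - (a + 1)" by simp
    then show False using nn[of "- (a + 1) / (2 * b)"] True by simp
  qed
  then show ?thesis using True by simp
next
  case False
  then have c: "0 < c" using c0 by simp
  have "0 \<le> a + 2 * (- b / c) * b + (- b / c)\<^sup>2 * c" by (rule nn)
  also have "\<dots> = (a * c - b\<^sup>2) / c" using c by (simp add: field_simps power2_eq_square)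
  finally show ?thesis using c by (simp add: zero_le_divide_iff)
qed

lemma l2_Cauchy_Schwarz:
  assumes "f \<in> L2 M" "g \<in> L2 M"
  shows "(l2_inner M f g)\<^sup>2 \<le> l2_inner M f f * l2_inner M g g"
proof (rule quadratic_nonneg_discriminant)
  fix t
  have "0 \<le> l2_inner M (\<lambda>x. f x + t * g x) (\<lambda>x. f x + t * g x)"
    by (rule l2_inner_self_nonneg)
  also have "\<dots> = l2_inner M f f + 2 * t * l2_inner M f g + t\<^sup>2 * l2_inner M g g"
    using assms by (simp add: l2_inner_left l2_inner_right L2_intros l2_inner_commute[of M g f]
        power2_eq_square algebra_simps)
  finally show "0 \<le> l2_inner M f f + 2 * t * l2_inner M f g + t\<^sup>2 * l2_inner M g g" .
qed (rule l2_inner_self_nonneg)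

lemma l2_norm_nonneg: "0 \<le> l2_norm M f"
  by (simp add: l2_norm_def l2_inner_self_nonneg)

lemma l2_norm_square: "(l2_norm M f)\<^sup>2 = l2_inner M f f"
  by (simp add: l2_norm_def l2_inner_self_nonneg)

lemma l2_inner_le_norm:
  assumes "f \<in> L2 M" "g \<in> L2 M"
  shows "\<bar>l2_inner M f g\<bar> \<le> l2_norm M f * l2_norm M g"
proof -
  have "sqrt ((l2_inner M f g)\<^sup>2) \<le> sqrt (l2_inner M f f * l2_inner M g g)"
    using l2_Cauchy_Schwarz[OF assms] by (simp only: real_sqrt_le_iff)
  then show ?thesis by (simp add: l2_norm_def real_sqrt_mult)
qed

lemma l2_norm_triangle:
  assumes "f \<in> L2 M" "g \<in> L2 M"
  shows "l2_norm M (\<lambda>x. f x + g x) \<le> l2_norm M f + l2_norm M g"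
proof (rule power2_le_imp_le)
  have "l2_inner M f g \<le> l2_norm M f * l2_norm M g"
    using l2_inner_le_norm[OF assms] by simp
  then show "(l2_norm M (\<lambda>x. f x + g x))\<^sup>2 \<le> (l2_norm M f + l2_norm M g)\<^sup>2"
    using assms by (simp add: l2_norm_square power2_sum l2_inner_left l2_inner_right L2_intros
        l2_inner_commute[of M g f])
qed (simp add: l2_norm_nonneg)

lemma l2_norm_triangle_diff:
  assumes "f \<in> L2 M" "g \<in> L2 M"
  shows "l2_norm M f \<le> l2_norm M (\<lambda>x. f x - g x) + l2_norm M g"
  using l2_norm_triangle[OF L2_diff[OF assms] assms(2)] by simp

lemma l2_norm_diff_commute: "l2_norm M (\<lambda>x. f x - g x) = l2_norm M (\<lambda>x. g x - f x)"
  unfolding l2_norm_def l2_inner_def by (simp add: algebra_simps)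

lemma l2_inner_tendsto:
  assumes "\<And>n. f n \<in> L2 M" "g \<in> L2 M" "h \<in> L2 M"
    and lim: "(\<lambda>n. l2_norm M (\<lambda>x. g x - f n x)) \<longlonglongrightarrow> 0"
  shows "(\<lambda>n. l2_inner M (f n) h) \<longlonglongrightarrow> l2_inner M g h"
proof -
  have "(\<lambda>n. l2_norm M (\<lambda>x. g x - f n x) * l2_norm M h) \<longlonglongrightarrow> 0"
    using tendsto_mult_left_zero[OF lim] .
  then have "(\<lambda>n. l2_inner M (\<lambda>x. g x - f n x) h) \<longlonglongrightarrow> 0"
  proof (rule Lim_null_comparison[rotated])
    show "\<forall>\<^sub>F n in sequentially. norm (l2_inner M (\<lambda>x. g x - f n x) h) \<le> l2_norm M (\<lambda>x. g x - f n x) * l2_norm M h"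
      using assms by (auto intro!: always_eventually l2_inner_le_norm L2_intros)
  qed
  then have "(\<lambda>n. l2_inner M g h - l2_inner M (f n) h) \<longlonglongrightarrow> 0"
    using assms by (simp add: l2_inner_left)
  then show ?thesis
    using tendsto_diff[OF tendsto_const[of "l2_inner M g h"]] by fastforce
qed

lemma l2_norm_tendsto:
  assumes "\<And>n. f n \<in> L2 M" "g \<in> L2 M"
    and lim: "(\<lambda>n. l2_norm M (\<lambda>x. g x - f n x)) \<longlonglongrightarrow> 0"
  shows "(\<lambda>n. l2_norm M (f n)) \<longlonglongrightarrow> l2_norm M g"
proof -
  have "(\<lambda>n. l2_norm M (f n) - l2_norm M g) \<longlonglongrightarrow> 0"
  proof (rule Lim_null_comparison[OF _ lim], intro always_eventually allI)
    fix n
    show "norm (l2_norm M (f n) - l2_norm M g) \<le> l2_norm M (\<lambda>x. g x - f n x)"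
      using l2_norm_triangle_diff[OF assms(1)[of n] assms(2)]
        l2_norm_triangle_diff[OF assms(2) assms(1)[of n]] l2_norm_diff_commute[of M g "f n"]
      by auto
  qed
  then show ?thesis by (simp add: LIM_zero_iff)
qed

section \<open>Finite measures: bounds and completeness\<close>

lemma (in finite_measure) L2_integrable: "f \<in> L2 M \<Longrightarrow> integrable M f"
  using L2_mult_integrable[of f M "\<lambda>_. 1"] by (simp add: L2_def)

lemma (in finite_measure) L2_const: "(\<lambda>_. c) \<in> L2 M"
  by (simp add: L2_def)

lemma (in finite_measure) L2_bounded:
  assumes "f \<in> borel_measurable M" "\<And>x. x \<in> space M \<Longrightarrow> \<bar>f x\<bar> \<le> B"
  shows "f \<in> L2 M"
proof -
  have "integrable M (\<lambda>x. (f x)\<^sup>2)"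
  proof (rule integrable_const_bound[where B = "B\<^sup>2"])
    show "AE x in M. norm ((f x)\<^sup>2) \<le> B\<^sup>2"
      using assms(2) by (intro AE_I2) (metis abs_ge_zero norm_power power2_abs power_mono real_norm_def)
  qed (use assms in measurable)
  then show ?thesis using assms by (simp add: L2_def)
qed

lemma (in finite_measure) L2_L1_bound:
  assumes "f \<in> L2 M"
  shows "(\<integral>x. \<bar>f x\<bar> \<partial>M) \<le> sqrt (measure M (space M)) * l2_norm M f"
proof -
  have af: "(\<lambda>x. \<bar>f x\<bar>) \<in> L2 M" using assms by (auto simp: L2_def)
  have "\<bar>l2_inner M (\<lambda>x. \<bar>f x\<bar>) (\<lambda>_. 1)\<bar> \<le> l2_norm M (\<lambda>x. \<bar>f x\<bar>) * l2_norm M (\<lambda>_. 1)"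
    by (rule l2_inner_le_norm[OF af L2_const])
  then show ?thesis by (simp add: l2_inner_def l2_norm_def mult.commute)
qed

lemma L2_nn_integral_square:
  "f \<in> L2 M \<Longrightarrow> (\<integral>\<^sup>+x. ennreal ((f x)\<^sup>2) \<partial>M) = ennreal (l2_inner M f f)"
  using L2_square_integrable[of f M]
  by (simp add: nn_integral_eq_integral l2_inner_def power2_eq_square)

text \<open>The increments are summable in \<open>L^1\<close>, because the measure is finite, so the
  sequence converges almost everywhere; Fatou's lemma then gives the norm estimate. The geometric
  rate spares the passage to a subsequence.\<close>

lemma (in finite_measure) L2_complete:
  assumes g: "\<And>n. g n \<in> L2 M"
    and close: "\<And>n. l2_norm M (\<lambda>x. g (Suc n) x - g n x) \<le> (1/2)^n"
  shows "\<exists>f\<in>L2 M. (\<lambda>n. l2_norm M (\<lambda>x. f x - g n x)) \<longlonglongrightarrow> 0"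
proof -
  note [measurable] = L2_measurable[OF g]
  define u where "u n x = g (Suc n) x - g n x" for n x
  have u: "u n \<in> L2 M" for n unfolding u_def by (intro L2_intros g)
  note [measurable] = L2_measurable[OF u]
  have "(\<integral>x. \<bar>u n x\<bar> \<partial>M) \<le> sqrt (measure M (space M)) * (1/2)^n" for n
    using order_trans[OF L2_L1_bound[OF u[of n]] mult_left_mono[OF close[of n, folded u_def]]] by simp
  then have sI: "summable (\<lambda>n. \<integral>x. \<bar>u n x\<bar> \<partial>M)"
    by (intro summable_comparison_test[OF _ summable_mult[OF summable_geometric[of "1/2::real"]]])
      (auto intro!: exI[of _ 0])
  have "AE x in M. summable (\<lambda>n. \<bar>u n x\<bar>)"
  proof -
    have "(\<integral>\<^sup>+x. (\<Sum>n. ennreal \<bar>u n x\<bar>) \<partial>M) = (\<Sum>n. \<integral>\<^sup>+x. ennreal \<bar>u n x\<bar> \<partial>M)"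
      by (rule nn_integral_suminf) measurable
    also have "\<dots> = (\<Sum>n. ennreal (\<integral>x. \<bar>u n x\<bar> \<partial>M))"
      using L2_integrable[OF u] by (simp add: nn_integral_eq_integral)
    also have "\<dots> = ennreal (\<Sum>n. \<integral>x. \<bar>u n x\<bar> \<partial>M)"
      by (rule suminf_ennreal2[OF _ sI]) simp
    also have "\<dots> \<noteq> \<infinity>" by simp
    finally have "AE x in M. (\<Sum>n. ennreal \<bar>u n x\<bar>) \<noteq> \<infinity>"
      by (intro nn_integral_PInf_AE) auto
    then show ?thesis
      by eventually_elim (auto intro!: summable_suminf_not_top)
  qed
  then have AEl: "AE x in M. convergent (\<lambda>n. g n x)"
  proof eventually_elim
    case (elim x)
    then have "summable (\<lambda>n. u n x)" by (rule summable_rabs_cancel)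
    then have "convergent (\<lambda>n. \<Sum>i<n. u i x)" by (simp add: summable_iff_convergent)
    moreover have "(\<Sum>i<n. u i x) = g n x - g 0 x" for n
      unfolding u_def by (rule sum_lessThan_telescope)
    ultimately have "convergent (\<lambda>n. g n x - g 0 x)" by simp
    from convergent_add[OF this convergent_const[of "g 0 x"]] show ?case by simp
  qed
  define f where "f x = lim (\<lambda>n. g n x)" for x
  have fm[measurable]: "f \<in> borel_measurable M" unfolding f_def by measurable
  \<comment> \<open>The exact geometric sum, not just its bound \<open>2 * (1/2)^n\<close>, is what
    the induction on \<open>k\<close> can carry.\<close>
  have far: "l2_norm M (\<lambda>x. g (n + k) x - g n x) \<le> 2 * (1/2)^n * (1 - (1/2)^k)" for n k
  proof (induction k)
    case 0
    then show ?case by (simp add: l2_norm_def l2_inner_def)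
  next
    case (Suc k)
    have "l2_norm M (\<lambda>x. u (n + k) x + (g (n + k) x - g n x)) \<le> (1/2)^(n+k) + 2 * (1/2)^n * (1 - (1/2)^k)"
      using Suc close[of "n+k"]
      by (intro order_trans[OF l2_norm_triangle] add_mono u L2_intros g) (auto simp: u_def)
    then show ?case by (simp add: u_def power_add algebra_simps)
  qed
  have bnd: "(\<integral>\<^sup>+x. ennreal ((f x - g n x)\<^sup>2) \<partial>M) \<le> ennreal (4 * (1/4)^n)" for n
  proof -
    have "(\<integral>\<^sup>+x. ennreal ((f x - g n x)\<^sup>2) \<partial>M) = (\<integral>\<^sup>+x. liminf (\<lambda>k. ennreal ((g (n + k) x - g n x)\<^sup>2)) \<partial>M)"
    proof (rule nn_integral_cong_AE)
      show "AE x in M. ennreal ((f x - g n x)\<^sup>2) = liminf (\<lambda>k. ennreal ((g (n + k) x - g n x)\<^sup>2))"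
        using AEl
      proof eventually_elim
        case (elim x)
        then have "(\<lambda>k. g k x) \<longlonglongrightarrow> f x" by (simp add: f_def convergent_LIMSEQ_iff)
        then have "(\<lambda>k. g (n + k) x) \<longlonglongrightarrow> f x" by (subst add.commute) (rule LIMSEQ_ignore_initial_segment)
        then have "(\<lambda>k. ennreal ((g (n + k) x - g n x)\<^sup>2)) \<longlonglongrightarrow> ennreal ((f x - g n x)\<^sup>2)"
          by (intro tendsto_intros)
        then show ?case by (rule lim_imp_Liminf[OF sequentially_bot, symmetric])
      qed
    qed
    also have "\<dots> \<le> liminf (\<lambda>k. \<integral>\<^sup>+x. ennreal ((g (n + k) x - g n x)\<^sup>2) \<partial>M)"
      by (rule nn_integral_liminf) measurable
    also have "\<dots> \<le> ennreal (4 * (1/4)^n)"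
    proof (rule Liminf_le)
      have "(\<integral>\<^sup>+x. ennreal ((g (n + k) x - g n x)\<^sup>2) \<partial>M) \<le> ennreal (4 * (1/4)^n)" for k
      proof -
        have "(\<integral>\<^sup>+x. ennreal ((g (n + k) x - g n x)\<^sup>2) \<partial>M) = ennreal ((l2_norm M (\<lambda>x. g (n + k) x - g n x))\<^sup>2)"
          by (simp add: L2_nn_integral_square L2_diff g l2_norm_square)
        also have "\<dots> \<le> ennreal ((2 * (1/2)^n)\<^sup>2)"
        proof (intro ennreal_leI power_mono l2_norm_nonneg)
          have "2 * (1/2)^n * (1 - (1/2)^k) \<le> 2 * (1/2)^n * (1::real)" by (intro mult_left_mono) auto
          then show "l2_norm M (\<lambda>x. g (n + k) x - g n x) \<le> 2 * (1 / 2) ^ n" using order_trans[OF far] by simp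
        qed
        also have "(2 * (1/2)^n)\<^sup>2 = 4 * (1/4::real)^n"
        proof -
          have "(2 * q)\<^sup>2 = 4 * (q * q)" for q :: real by (simp add: power2_eq_square)
          note this[of "(1/2) ^ n"]
          moreover have "(1/2) ^ n * (1/2) ^ n = (1/4::real) ^ n"
            by (subst power_mult_distrib[symmetric]) simp
          ultimately show ?thesis by (simp only:)
        qed
        finally show ?thesis .
      qed
      then show "\<forall>\<^sub>F k in sequentially. (\<integral>\<^sup>+x. ennreal ((g (n + k) x - g n x)\<^sup>2) \<partial>M) \<le> ennreal (4 * (1/4)^n)"
        by (simp add: always_eventually)
    qed simp
    finally show ?thesis .
  qed
  have dL: "(\<lambda>x. f x - g n x) \<in> L2 M" for n
  proof -
    have "integrable M (\<lambda>x. (f x - g n x)\<^sup>2)"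
    proof (rule integrableI_bounded)
      show "(\<integral>\<^sup>+x. ennreal (norm ((f x - g n x)\<^sup>2)) \<partial>M) < \<infinity>"
        using le_less_trans[OF bnd[of n] ennreal_less_top] by simp
    qed measurable
    then show ?thesis by (simp add: L2_def)
  qed
  have fL: "f \<in> L2 M" using L2_add[OF dL[of 0] g[of 0]] by simp
  have "l2_norm M (\<lambda>x. f x - g n x) \<le> sqrt (4 * (1/4)^n)" for n
  proof -
    have "ennreal (l2_inner M (\<lambda>x. f x - g n x) (\<lambda>x. f x - g n x)) \<le> ennreal (4 * (1/4)^n)"
      using bnd[of n] by (simp add: L2_nn_integral_square dL)
    then show ?thesis unfolding l2_norm_def by (subst (asm) ennreal_le_iff) auto
  qed
  moreover have "(\<lambda>n. sqrt (4 * (1/4)^n)) \<longlonglongrightarrow> 0"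
  proof -
    have "(\<lambda>n. 4 * (1/4::real)^n) \<longlonglongrightarrow> 4 * 0" by (intro tendsto_intros LIMSEQ_power_zero) auto
    from tendsto_real_sqrt[OF this] show ?thesis by simp
  qed
  ultimately have "(\<lambda>n. l2_norm M (\<lambda>x. f x - g n x)) \<longlonglongrightarrow> 0"
    by (elim Lim_null_comparison[rotated])
      (simp only: real_norm_def abs_of_nonneg[OF l2_norm_nonneg] eventually_sequentially, blast)
  then show ?thesis using fL by blast
qed

section \<open>Orthonormal bases\<close>

text \<open>Translates bounded partial sums into integrability over \<open>count_space\<close>,
  where dominated convergence and linearity of the integral are available for arbitrary index
  sets.\<close>

lemma nonneg_abs_summable_on_bounded:
  fixes f :: "'b \<Rightarrow> real"
  assumes "\<And>x. x \<in> A \<Longrightarrow> 0 \<le> f x" "\<And>F. finite F \<Longrightarrow> F \<subseteq> A \<Longrightarrow> sum f F \<le> B"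
  shows "integrable (count_space A) f"
proof -
  have "f summable_on A"
    by (rule nonneg_bounded_partial_sums_imp_summable_on[where C = B])
      (use assms in \<open>auto simp: eventually_finite_subsets_at_top_weakI\<close>)
  moreover have "f summable_on A \<longleftrightarrow> (\<lambda>x. norm (f x)) summable_on A"
    using assms(1) by (intro summable_on_cong) auto
  ultimately have "(\<lambda>x. norm (f x)) summable_on A" by simp
  then show ?thesis
    using abs_summable_equivalent[of f A] unfolding Infinite_Set_Sum.abs_summable_on_def by blast
qed

lemma count_space_integral_approx:
  fixes f :: "'b \<Rightarrow> real"
  assumes "integrable (count_space A) f" "\<And>x. x \<in> A \<Longrightarrow> 0 \<le> f x" "0 < \<epsilon>"
  shows "\<exists>F. finite F \<and> F \<subseteq> A \<and> (\<integral>x. f x \<partial>count_space A) - sum f F \<le> \<epsilon>"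
proof -
  have f: "Infinite_Set_Sum.abs_summable_on f A" using assms(1) by (simp add: Infinite_Set_Sum.abs_summable_on_def)
  have "f summable_on A"
    using f abs_summable_summable[of f A] by (simp only: abs_summable_equivalent)
  moreover have "infsum f A = (\<integral>x. f x \<partial>count_space A)"
    using infsetsum_infsum[OF f] by (simp add: infsetsum_def)
  ultimately have "(sum f \<longlongrightarrow> (\<integral>x. f x \<partial>count_space A)) (finite_subsets_at_top A)"
    by (metis has_sum_def has_sum_infsum)
  then have "eventually (\<lambda>F. dist (sum f F) (\<integral>x. f x \<partial>count_space A) < \<epsilon>) (finite_subsets_at_top A)"
    using assms(3) by (simp add: tendsto_iff)
  then show ?thesis
    unfolding eventually_finite_subsets_at_top by (force simp: dist_real_def)
qed

lemma sum_le_count_space_integral: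
  fixes f :: "'b \<Rightarrow> real"
  assumes "integrable (count_space A) f" "\<And>x. x \<in> A \<Longrightarrow> 0 \<le> f x" "finite F" "F \<subseteq> A"
  shows "sum f F \<le> (\<integral>x. f x \<partial>count_space A)"
proof -
  have "sum f F = (\<integral>x. f x \<partial>count_space F)"
    using assms(3) by (simp add: lebesgue_integral_count_space_finite)
  also have "\<dots> = infsetsum f F" by (simp add: infsetsum_def)
  also have "\<dots> \<le> infsetsum f A"
  proof (rule infsetsum_mono_neutral_left)
    show "Infinite_Set_Sum.abs_summable_on f F" using assms(3) by (rule abs_summable_on_finite)
    show "Infinite_Set_Sum.abs_summable_on f A"
      using assms(1) by (simp add: Infinite_Set_Sum.abs_summable_on_def)
  qed (use assms in auto)
  finally show ?thesis by (simp add: infsetsum_def)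
qed

lemma l2_eq_inner: "l2_eq M f g \<Longrightarrow> h \<in> L2 M \<Longrightarrow> l2_inner M f h = l2_inner M g h"
  by (rule l2_inner_cong_AE) (auto simp: l2_eq_def)

text \<open>\<open>S\<close> comes without an enumeration, since it will be produced by Zorn's
  lemma; sums over it are integrals over \<open>count_space S\<close>. Finiteness of the measure
  gives access to \<open>L2_complete\<close>.\<close>

locale l2_basis = finite_measure M for M :: "'a measure" +
  fixes S :: "('a \<Rightarrow> real) set"
  assumes orthonormal_basis: "l2_orthonormal_basis M S"
begin

lemma basis_L2: "e \<in> S \<Longrightarrow> e \<in> L2 M"
  using orthonormal_basis by (auto simp: l2_orthonormal_basis_def)

lemma basis_self: "e \<in> S \<Longrightarrow> l2_inner M e e = 1"
  using orthonormal_basis by (auto simp: l2_orthonormal_basis_def l2_norm_def)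

lemma basis_inner: "e \<in> S \<Longrightarrow> e' \<in> S \<Longrightarrow> l2_inner M e e' = (if e = e' then 1 else 0)"
  using orthonormal_basis basis_self by (auto simp: l2_orthonormal_basis_def)

lemma basis_complete: "f \<in> L2 M \<Longrightarrow> (\<And>e. e \<in> S \<Longrightarrow> l2_inner M f e = 0) \<Longrightarrow> AE x in M. f x = 0"
  using orthonormal_basis by (auto simp: l2_orthonormal_basis_def)

lemma coeff_eq_imp_AE_eq:
  assumes "f \<in> L2 M" "g \<in> L2 M" "\<And>e. e \<in> S \<Longrightarrow> l2_inner M f e = l2_inner M g e"
  shows "AE x in M. f x = g x"
  using basis_complete[of "\<lambda>x. f x - g x"] assms by (simp add: L2_intros l2_inner_left basis_L2)

definition lincomb :: "(('a \<Rightarrow> real) \<Rightarrow> real) \<Rightarrow> ('a \<Rightarrow> real) set \<Rightarrow> 'a \<Rightarrow> real" where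
  "lincomb c F x = (\<Sum>e\<in>F. c e * e x)"

lemma lincomb_L2: "F \<subseteq> S \<Longrightarrow> lincomb c F \<in> L2 M"
  unfolding lincomb_def[abs_def] by (intro L2_sum L2_scale basis_L2) auto

lemma inner_lincomb:
  "F \<subseteq> S \<Longrightarrow> f \<in> L2 M \<Longrightarrow> l2_inner M f (lincomb c F) = (\<Sum>e\<in>F. c e * l2_inner M f e)"
proof -
  assume F: "F \<subseteq> S" and f: "f \<in> L2 M"
  have "(\<lambda>x. c e * e x) \<in> L2 M" if "e \<in> F" for e
    using that F by (intro L2_scale basis_L2) blast
  then show ?thesis
    unfolding lincomb_def[abs_def] by (simp add: l2_inner_sum_right[OF _ f] l2_inner_scale_right)
qed

lemma lincomb_coeff:
  assumes "F \<subseteq> S" "finite F" "e \<in> S"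
  shows "l2_inner M (lincomb c F) e = (if e \<in> F then c e else 0)"
proof -
  have "l2_inner M (lincomb c F) e = (\<Sum>e'\<in>F. c e' * (if e = e' then 1 else 0))"
    using assms by (subst l2_inner_commute, subst inner_lincomb)
      (auto intro!: sum.cong basis_L2 simp: basis_inner subset_iff)
  also have "\<dots> = (\<Sum>e'\<in>F. if e' = e then c e' else 0)"
    by (intro sum.cong) auto
  finally show ?thesis using assms(2) by (simp add: sum.delta)
qed

lemma lincomb_self:
  assumes "F \<subseteq> S" "finite F"
  shows "l2_inner M (lincomb c F) (lincomb c F) = (\<Sum>e\<in>F. (c e)\<^sup>2)"
proof -
  have "l2_inner M (lincomb c F) (lincomb c F) = (\<Sum>e\<in>F. c e * l2_inner M (lincomb c F) e)"
    using assms by (intro inner_lincomb lincomb_L2)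
  also have "\<dots> = (\<Sum>e\<in>F. (c e)\<^sup>2)"
    using assms by (intro sum.cong refl) (simp add: lincomb_coeff subset_iff power2_eq_square)
  finally show ?thesis .
qed

lemma Bessel_finite:
  assumes "F \<subseteq> S" "finite F" "f \<in> L2 M"
  shows "(\<Sum>e\<in>F. (l2_inner M f e)\<^sup>2) \<le> l2_inner M f f"
proof -
  let ?p = "lincomb (l2_inner M f) F"
  have "0 \<le> l2_inner M (\<lambda>x. f x - ?p x) (\<lambda>x. f x - ?p x)" by (rule l2_inner_self_nonneg)
  also have "\<dots> = l2_inner M f f - (\<Sum>e\<in>F. (l2_inner M f e)\<^sup>2)"
    using assms
    by (simp add: l2_inner_left l2_inner_right L2_intros lincomb_L2 lincomb_self
        l2_inner_commute[of M ?p f])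
      (simp add: inner_lincomb power2_eq_square)
  finally show ?thesis by simp
qed

lemma coeff_square_integrable:
  "f \<in> L2 M \<Longrightarrow> integrable (count_space S) (\<lambda>e. (l2_inner M f e)\<^sup>2)"
  by (rule nonneg_abs_summable_on_bounded) (auto intro: Bessel_finite)

text \<open>Finite index sets that leave out at most \<open>(1/4)^n\<close> of the square sum give
  partial sums with increments of norm at most \<open>(1/2)^n\<close>, as \<open>L2_complete\<close>
  requires. Coefficients and norm pass to the limit.\<close>

proposition Riesz_Fischer:
  assumes c: "integrable (count_space S) (\<lambda>e. (c e)\<^sup>2)"
  obtains g where "g \<in> L2 M" "\<And>e. e \<in> S \<Longrightarrow> l2_inner M g e = c e"
    "l2_inner M g g = (\<integral>e. (c e)\<^sup>2 \<partial>count_space S)"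
proof -
  define tot where "tot = (\<integral>e. (c e)\<^sup>2 \<partial>count_space S)"
  have "\<exists>F. finite F \<and> F \<subseteq> S \<and> tot - (\<Sum>e\<in>F. (c e)\<^sup>2) \<le> (1/4)^n" for n :: nat
    unfolding tot_def by (rule count_space_integral_approx[OF c]) auto
  then obtain F where F: "\<And>n. finite (F n)" "\<And>n. F n \<subseteq> S" "\<And>n. tot - (\<Sum>e\<in>F n. (c e)\<^sup>2) \<le> (1/4)^n"
    by metis
  \<comment> \<open>Accumulating the sets makes them increasing, so that an increment is the
    combination over the set difference.\<close>
  define G where "G n = (\<Union>i\<le>n. F i)" for n
  have G: "finite (G n)" "G n \<subseteq> S" "F n \<subseteq> G n" "G n \<subseteq> G (Suc n)" for n
    using F by (auto simp: G_def atMost_Suc)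
  have Gtot: "tot - (\<Sum>e\<in>G n. (c e)\<^sup>2) \<le> (1/4)^n" for n
  proof -
    have "(\<Sum>e\<in>F n. (c e)\<^sup>2) \<le> (\<Sum>e\<in>G n. (c e)\<^sup>2)"
      by (rule sum_mono2) (use G in auto)
    then show ?thesis using F(3)[of n] by linarith
  qed
  have le_tot: "(\<Sum>e\<in>H. (c e)\<^sup>2) \<le> tot" if "finite H" "H \<subseteq> S" for H
    unfolding tot_def by (rule sum_le_count_space_integral[OF c]) (use that in auto)
  define g where "g n = lincomb c (G n)" for n
  have gL: "g n \<in> L2 M" for n using G by (simp add: g_def lincomb_L2)
  have "l2_norm M (\<lambda>x. g (Suc n) x - g n x) \<le> (1/2)^n" for n
  proof -
    have "(\<lambda>x. g (Suc n) x - g n x) = lincomb c (G (Suc n) - G n)"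
      unfolding g_def lincomb_def using G(1)[of "Suc n"] G(4)[of n] by (auto simp: sum_diff)
    moreover have "l2_inner M (lincomb c (G (Suc n) - G n)) (lincomb c (G (Suc n) - G n)) \<le> (1/4)^n"
    proof -
      have "(\<Sum>e\<in>G (Suc n) - G n. (c e)\<^sup>2) = (\<Sum>e\<in>G (Suc n). (c e)\<^sup>2) - (\<Sum>e\<in>G n. (c e)\<^sup>2)"
        by (intro sum_diff G)
      also have "\<dots> \<le> (1/4)^n"
        using le_tot[OF G(1,2), of "Suc n"] Gtot[of n] by linarith
      finally show ?thesis using G[of n] G[of "Suc n"] by (subst lincomb_self) auto
    qed
    moreover have "sqrt ((1/4)^n) = (1/2::real)^n"
      by (simp add: real_sqrt_power real_sqrt_divide)
    ultimately show ?thesis unfolding l2_norm_def by (metis real_sqrt_le_iff)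
  qed
  from L2_complete[of g, OF gL this] obtain f
    where f: "f \<in> L2 M" and lim: "(\<lambda>n. l2_norm M (\<lambda>x. f x - g n x)) \<longlonglongrightarrow> 0" by blast
  have "(\<lambda>n. (1/4::real)^n) \<longlonglongrightarrow> 0" by (intro LIMSEQ_power_zero) simp
  note quarter = this
  have "l2_inner M f e = c e" if e: "e \<in> S" for e
  proof -
    have "(c e - l2_inner M (g n) e)\<^sup>2 \<le> (1/4)^n" for n
    proof (cases "e \<in> G n")
      case True
      then show ?thesis using G e by (simp add: g_def lincomb_coeff)
    next
      case False
      \<comment> \<open>An index outside \<open>G n\<close> belongs to the remainder, so its own
        coefficient is already small.\<close>
      have "(\<Sum>e\<in>insert e (G n). (c e)\<^sup>2) \<le> tot" by (rule le_tot) (use G e in auto)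
      then have "(c e)\<^sup>2 \<le> (1/4)^n" using False G(1)[of n] Gtot[of n] by simp
      then show ?thesis using False G e by (simp add: g_def lincomb_coeff)
    qed
    then have "(\<lambda>n. (c e - l2_inner M (g n) e)\<^sup>2) \<longlonglongrightarrow> 0"
      by (intro Lim_null_comparison[OF _ quarter]) auto
    from tendsto_real_sqrt[OF this] have "(\<lambda>n. \<bar>c e - l2_inner M (g n) e\<bar>) \<longlonglongrightarrow> 0" by simp
    then have "(\<lambda>n. c e - (c e - l2_inner M (g n) e)) \<longlonglongrightarrow> c e - 0"
      by (intro tendsto_diff tendsto_const) (simp add: tendsto_rabs_zero_iff)
    moreover have "(\<lambda>n. l2_inner M (g n) e) \<longlonglongrightarrow> l2_inner M f e"
      by (rule l2_inner_tendsto[OF gL f basis_L2[OF e] lim])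
    ultimately show ?thesis by (simp add: LIMSEQ_unique)
  qed
  moreover have "l2_inner M f f = tot"
  proof -
    have "(\<lambda>n. (l2_norm M (g n))\<^sup>2) \<longlonglongrightarrow> (l2_norm M f)\<^sup>2"
      by (intro tendsto_intros l2_norm_tendsto[OF gL f lim])
    moreover have "(\<lambda>n. (l2_norm M (g n))\<^sup>2) \<longlonglongrightarrow> tot"
    proof -
      have "\<bar>tot - (l2_norm M (g n))\<^sup>2\<bar> \<le> (1/4)^n" for n
        using Gtot[of n] le_tot[OF G(1,2), of n] G[of n]
        by (simp add: l2_norm_square g_def lincomb_self)
      then have "(\<lambda>n. tot - (l2_norm M (g n))\<^sup>2) \<longlonglongrightarrow> 0"
        by (intro Lim_null_comparison[OF _ quarter]) auto
      from tendsto_diff[OF tendsto_const[of tot] this] show ?thesis by simp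
    qed
    ultimately show ?thesis by (simp add: l2_norm_square LIMSEQ_unique)
  qed
  ultimately show ?thesis using that f tot_def by metis
qed

text \<open>The element that Riesz-Fischer builds from the coefficients of \<open>f\<close> agrees
  with \<open>f\<close> by completeness of the basis, and its squared norm is the square
  sum.\<close>

lemma Parseval_self:
  assumes "f \<in> L2 M"
  shows "l2_inner M f f = (\<integral>e. (l2_inner M f e)\<^sup>2 \<partial>count_space S)"
proof -
  obtain g where g: "g \<in> L2 M" "\<And>e. e \<in> S \<Longrightarrow> l2_inner M g e = l2_inner M f e"
    "l2_inner M g g = (\<integral>e. (l2_inner M f e)\<^sup>2 \<partial>count_space S)"
    using Riesz_Fischer[OF coeff_square_integrable[OF assms]] by metis
  have "AE x in M. f x = g x" using g assms by (intro coeff_eq_imp_AE_eq) auto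
  then have "l2_inner M f f = l2_inner M g g" using g assms by (intro l2_inner_cong_AE)
  then show ?thesis using g by simp
qed

lemma coeff_L2: "f \<in> L2 M \<Longrightarrow> l2_inner M f \<in> L2 (count_space S)"
  using coeff_square_integrable[of f] unfolding L2_def[of "count_space S"] by simp

lemma coeff_mult_integrable:
  assumes "f \<in> L2 M" "h \<in> L2 M"
  shows "integrable (count_space S) (\<lambda>e. l2_inner M f e * l2_inner M h e)"
  by (intro L2_mult_integrable coeff_L2 assms)

lemma Parseval:
  assumes "f \<in> L2 M" "h \<in> L2 M"
  shows "l2_inner M f h = (\<integral>e. l2_inner M f e * l2_inner M h e \<partial>count_space S)"
proof -
  have "l2_inner M f f + l2_inner M h h + 2 * l2_inner M f h
      = l2_inner M (\<lambda>x. f x + h x) (\<lambda>x. f x + h x)"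
    using assms by (simp add: l2_inner_left l2_inner_right L2_intros l2_inner_commute[of M h f])
  also have "\<dots> = (\<integral>e. (l2_inner M (\<lambda>x. f x + h x) e)\<^sup>2 \<partial>count_space S)"
    using assms by (intro Parseval_self L2_intros)
  also have "\<dots> = (\<integral>e. (l2_inner M f e)\<^sup>2 + (l2_inner M h e)\<^sup>2 + 2 * (l2_inner M f e * l2_inner M h e) \<partial>count_space S)"
    using assms by (intro Bochner_Integration.integral_cong)
      (auto simp: l2_inner_left basis_L2 power2_sum)
  also have "\<dots> = l2_inner M f f + l2_inner M h h + 2 * (\<integral>e. l2_inner M f e * l2_inner M h e \<partial>count_space S)"
    using assms by (simp add: Parseval_self coeff_square_integrable coeff_mult_integrable)
  finally show ?thesis by simp
qed

section \<open>Diagonal operators and their functional calculus\<close>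

text \<open>The domain is maximal and implicit: a suitable \<open>g\<close> exists exactly when the
  multiplied coefficients are square summable. Unbounded \<open>m\<close> are allowed, so the
  Laplacians themselves can have this form.\<close>

definition diag_op :: "(('a \<Rightarrow> real) \<Rightarrow> real) \<Rightarrow> 'a l2op" where
  "diag_op m = {(f, g). f \<in> L2 M \<and> g \<in> L2 M \<and> (\<forall>e\<in>S. l2_inner M g e = m e * l2_inner M f e)}"

lemma diag_op_cong: "(\<And>e. e \<in> S \<Longrightarrow> m e = m' e) \<Longrightarrow> diag_op m = diag_op m'"
  by (auto simp: diag_op_def)

lemma diag_op_operator: "l2_operator M (diag_op m)"
  unfolding l2_operator_def
proof (intro conjI allI impI)
  show "diag_op m \<subseteq> L2 M \<times> L2 M" by (auto simp: diag_op_def)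
next
  fix f g f' g' assume "(f, g) \<in> diag_op m \<and> l2_eq M f f' \<and> l2_eq M g g'"
  then show "(f', g') \<in> diag_op m"
    using l2_eq_inner[of M f f'] l2_eq_inner[of M g g'] basis_L2 by (auto simp: diag_op_def l2_eq_def)
next
  fix f g f' g' a b assume "(f, g) \<in> diag_op m \<and> (f', g') \<in> diag_op m"
  then show "((\<lambda>x. a * f x + b * f' x), (\<lambda>x. a * g x + b * g' x)) \<in> diag_op m"
    by (auto simp: diag_op_def L2_intros l2_inner_left basis_L2 algebra_simps)
next
  fix f g g' assume "(f, g) \<in> diag_op m \<and> (f, g') \<in> diag_op m"
  then show "l2_eq M g g'"
    by (auto simp: diag_op_def l2_eq_def intro: coeff_eq_imp_AE_eq)
qed

lemma diag_op_L2: "(f, g) \<in> diag_op m \<Longrightarrow> f \<in> L2 M \<and> g \<in> L2 M"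
  by (simp add: diag_op_def)

lemma diag_op_coeff: "(f, g) \<in> diag_op m \<Longrightarrow> e \<in> S \<Longrightarrow> l2_inner M g e = m e * l2_inner M f e"
  by (simp add: diag_op_def)

lemma diag_op_exists:
  assumes "f \<in> L2 M" and m: "\<And>e. e \<in> S \<Longrightarrow> \<bar>m e\<bar> \<le> K"
  shows "\<exists>g. (f, g) \<in> diag_op m"
proof -
  have "integrable (count_space S) (\<lambda>e. (m e * l2_inner M f e)\<^sup>2)"
  proof (rule Bochner_Integration.integrable_bound)
    show "integrable (count_space S) (\<lambda>e. K\<^sup>2 * (l2_inner M f e)\<^sup>2)"
      using assms by (simp add: coeff_square_integrable)
    have "(m e)\<^sup>2 \<le> K\<^sup>2" if "e \<in> S" for e
      using m[OF that] by (metis abs_ge_zero power2_abs power_mono)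
    then show "AE e in count_space S. norm ((m e * l2_inner M f e)\<^sup>2) \<le> norm (K\<^sup>2 * (l2_inner M f e)\<^sup>2)"
      by (auto simp: AE_count_space power_mult_distrib intro!: mult_right_mono)
  qed simp
  then obtain g where "g \<in> L2 M" "\<And>e. e \<in> S \<Longrightarrow> l2_inner M g e = m e * l2_inner M f e"
    by (rule Riesz_Fischer) blast
  then show ?thesis using assms(1) unfolding diag_op_def by blast
qed

lemma diag_op_bounded:
  assumes m: "\<And>e. e \<in> S \<Longrightarrow> \<bar>m e\<bar> \<le> K"
  shows "l2_bounded_op M (diag_op m)"
  unfolding l2_bounded_op_def
proof (intro conjI diag_op_operator exI ballI)
  show "Domain (diag_op m) = L2 M"
    using diag_op_exists[OF _ m] by (auto simp: diag_op_def Domain_iff)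
  fix z assume "z \<in> diag_op m"
  obtain f g where z: "z = (f, g)" by (cases z)
  have fg: "f \<in> L2 M" "g \<in> L2 M" "\<And>e. e \<in> S \<Longrightarrow> l2_inner M g e = m e * l2_inner M f e"
    using \<open>z \<in> diag_op m\<close> by (auto simp: diag_op_def z)
  have "l2_inner M g g \<le> K\<^sup>2 * l2_inner M f f"
  proof -
    have m2: "(m e)\<^sup>2 \<le> K\<^sup>2" if "e \<in> S" for e
      using m[OF that] by (metis abs_ge_zero power2_abs power_mono)
    have "l2_inner M g g = (\<integral>e. (l2_inner M g e)\<^sup>2 \<partial>count_space S)" using fg by (intro Parseval_self)
    also have "\<dots> \<le> (\<integral>e. K\<^sup>2 * (l2_inner M f e)\<^sup>2 \<partial>count_space S)"
      using fg m2
      by (intro integral_mono coeff_square_integrable integrable_mult_right)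
        (auto simp: power_mult_distrib intro!: mult_right_mono)
    also have "\<dots> = K\<^sup>2 * l2_inner M f f" using fg by (simp add: Parseval_self)
    finally show ?thesis .
  qed
  then have "l2_norm M g \<le> sqrt (K\<^sup>2 * l2_inner M f f)"
    unfolding l2_norm_def by (simp only: real_sqrt_le_iff)
  also have "\<dots> = \<bar>K\<bar> * l2_norm M f" by (simp add: l2_norm_def real_sqrt_mult)
  finally show "case z of (f, g) \<Rightarrow> l2_norm M g \<le> \<bar>K\<bar> * l2_norm M f" by (simp add: z)
qed

lemma diag_op_inner_commute:
  assumes "(f, f') \<in> diag_op m" "(g, g') \<in> diag_op m"
  shows "l2_inner M f' g = l2_inner M f g'"
proof -
  note L = diag_op_L2[OF assms(1)] diag_op_L2[OF assms(2)]
  have "l2_inner M f' g = (\<integral>e. l2_inner M f' e * l2_inner M g e \<partial>count_space S)"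
    using L by (simp only: Parseval)
  also have "\<dots> = (\<integral>e. l2_inner M f e * l2_inner M g' e \<partial>count_space S)"
    by (intro Bochner_Integration.integral_cong refl)
      (simp add: diag_op_coeff[OF assms(1)] diag_op_coeff[OF assms(2)])
  also have "\<dots> = l2_inner M f g'"
    using L by (simp only: Parseval)
  finally show ?thesis .
qed

lemma diag_op_basis: "e \<in> S \<Longrightarrow> (e, \<lambda>x. m e * e x) \<in> diag_op m"
  using basis_inner[of e] by (auto simp: diag_op_def basis_L2 L2_intros l2_inner_left)

text \<open>Basis vectors lie in the domain for any \<open>m\<close>, and testing the adjoint
  relation against them returns the coefficient equation. The converse is Parseval.\<close>

lemma diag_op_adjoint: "l2_adjoint M (diag_op m) = diag_op m"
proof (intro set_eqI iffI; clarify)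
  fix g h assume gh: "(g, h) \<in> l2_adjoint M (diag_op m)"
  have "l2_inner M h e = m e * l2_inner M g e" if e: "e \<in> S" for e
  proof -
    have "l2_inner M (\<lambda>x. m e * e x) g = l2_inner M e h"
      using gh diag_op_basis[OF e, of m] unfolding l2_adjoint_def by blast
    then show ?thesis by (simp add: l2_inner_left l2_inner_commute[of M e g] l2_inner_commute[of M h e])
  qed
  then show "(g, h) \<in> diag_op m" using gh by (simp add: l2_adjoint_def diag_op_def)
next
  fix g h assume gh: "(g, h) \<in> diag_op m"
  then show "(g, h) \<in> l2_adjoint M (diag_op m)"
    using diag_op_inner_commute[OF _ gh] by (auto simp: l2_adjoint_def diag_op_def)
qed

text \<open>The multiplier applied first is bounded in order to provide the intermediate vector. The
  second may be unbounded: the given image \<open>h\<close> witnesses that it is applicable.\<close>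

lemma diag_op_comp:
  assumes m: "\<And>e. e \<in> S \<Longrightarrow> \<bar>m e\<bar> \<le> K"
  shows "diag_op m O diag_op m' = diag_op (\<lambda>e. m' e * m e)"
proof (intro set_eqI iffI; clarify)
  fix f g h assume "(f, g) \<in> diag_op m" "(g, h) \<in> diag_op m'"
  then show "(f, h) \<in> diag_op (\<lambda>e. m' e * m e)" by (auto simp: diag_op_def)
next
  fix f h assume fh: "(f, h) \<in> diag_op (\<lambda>e. m' e * m e)"
  then have "f \<in> L2 M" by (simp add: diag_op_def)
  from diag_op_exists[of f m K, OF this m] obtain g where g: "(f, g) \<in> diag_op m" by blast
  then have "(g, h) \<in> diag_op m'" using fh by (auto simp: diag_op_def)
  with g show "(f, h) \<in> diag_op m O diag_op m'" by blast
qed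

lemma diag_op_quadratic_nonneg:
  assumes "(f, g) \<in> diag_op m" "\<And>e. e \<in> S \<Longrightarrow> 0 \<le> m e"
  shows "0 \<le> l2_inner M g f"
proof -
  have "l2_inner M g f = (\<integral>e. l2_inner M g e * l2_inner M f e \<partial>count_space S)"
    using diag_op_L2[OF assms(1)] by (simp only: Parseval)
  also have "\<dots> \<ge> 0"
    using assms(2)
    by (intro integral_nonneg_AE) (auto simp: AE_count_space diag_op_coeff[OF assms(1)] mult.assoc)
  finally show ?thesis .
qed

lemma diag_op_app:
  assumes "f \<in> L2 M" "\<And>e. e \<in> S \<Longrightarrow> \<bar>m e\<bar> \<le> K"
  shows "(f, l2_app (diag_op m) f) \<in> diag_op m"
  unfolding l2_app_def by (rule someI_ex[OF diag_op_exists[OF assms]])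

lemma diag_op_app_coeff:
  assumes "f \<in> L2 M" "\<And>e. e \<in> S \<Longrightarrow> \<bar>m e\<bar> \<le> K" "e \<in> S"
  shows "l2_inner M (l2_app (diag_op m) f) e = m e * l2_inner M f e"
  using diag_op_app[OF assms(1,2)] assms(3) by (auto simp: diag_op_def)

text \<open>A nonnegative diagonal operator is its own absolute value, and its trace in the basis
  \<open>S\<close> is the sum of the multipliers.\<close>

lemma diag_op_trace_class:
  assumes nn: "\<And>e. e \<in> S \<Longrightarrow> 0 \<le> m e" and sm: "m summable_on S"
  shows "trace_class M (diag_op m)"
proof -
  \<comment> \<open>Each nonnegative term is at most the whole sum, which therefore bounds the
    operator.\<close>
  define K where "K = infsum m S"
  have K: "\<bar>m e\<bar> \<le> K" if "e \<in> S" for e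
  proof -
    have "sum m {e} \<le> infsum m S" using that nn sm by (intro finite_sum_le_infsum) auto
    then show ?thesis using nn[OF that] by (simp add: K_def)
  qed
  have b: "l2_bounded_op M (diag_op m)" using K by (rule diag_op_bounded)
  have "l2_absolute_value M (diag_op m) (diag_op m)"
    unfolding l2_absolute_value_def l2_positive_op_def
    using b nn diag_op_quadratic_nonneg[of _ _ m] by (auto simp: diag_op_adjoint)
  moreover have "(\<lambda>e. l2_inner M (l2_app (diag_op m) e) e) summable_on S"
    using sm by (rule summable_on_cong[THEN iffD1, rotated])
      (simp add: diag_op_app_coeff[OF basis_L2 K] basis_self)
  ultimately show ?thesis
    unfolding trace_class_def using b orthonormal_basis by blast
qed

end

section \<open>Projection-valued measures and their scalar spectral measures\<close>

lemma l2_operator_L2: "l2_operator M T \<Longrightarrow> (f, g) \<in> T \<Longrightarrow> f \<in> L2 M \<and> g \<in> L2 M"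
  using l2_operator_def[THEN iffD1, THEN conjunct1, of M T] by blast

lemma l2_operator_cong:
  "l2_operator M T \<Longrightarrow> (f, g) \<in> T \<Longrightarrow> l2_eq M f f' \<Longrightarrow> l2_eq M g g' \<Longrightarrow> (f', g') \<in> T"
  using l2_operator_def[THEN iffD1, THEN conjunct2, THEN conjunct1, rule_format, of M T f g f' g'] by simp

lemma l2_operator_lincomb:
  "l2_operator M T \<Longrightarrow> (f, g) \<in> T \<Longrightarrow> (f', g') \<in> T \<Longrightarrow>
    (\<lambda>x. a * f x + b * f' x, \<lambda>x. a * g x + b * g' x) \<in> T"
  using l2_operator_def[THEN iffD1, THEN conjunct2, THEN conjunct2, THEN conjunct1, rule_format, of M T f g f' g' a b]
  by simp

lemma l2_operator_unique: "l2_operator M T \<Longrightarrow> (f, g) \<in> T \<Longrightarrow> (f, g') \<in> T \<Longrightarrow> l2_eq M g g'"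
  using l2_operator_def[THEN iffD1, THEN conjunct2, THEN conjunct2, THEN conjunct2, rule_format, of M T f g g'] by simp

lemma l2_bounded_op_operator: "l2_bounded_op M T \<Longrightarrow> l2_operator M T"
  by (simp add: l2_bounded_op_def)

context
  fixes M :: "'a measure" and E :: "real set \<Rightarrow> 'a l2op"
  assumes pvm: "projection_valued_measure M E"
begin

lemma pvm_bounded: "B \<in> sets borel \<Longrightarrow> l2_bounded_op M (E B)"
  using pvm by (auto simp: projection_valued_measure_def l2_projection_def)

lemmas pvm_operator = l2_bounded_op_operator[OF pvm_bounded]

lemmas pvm_L2 = l2_operator_L2[OF pvm_operator]
  and pvm_unique = l2_operator_unique[OF pvm_operator]
  and pvm_cong = l2_operator_cong[OF pvm_operator]
  and pvm_lincomb = l2_operator_lincomb[OF pvm_operator]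

lemma pvm_app:
  assumes "B \<in> sets borel" "f \<in> L2 M"
  shows "(f, l2_app (E B) f) \<in> E B"
proof -
  have "Domain (E B) = L2 M" using pvm_bounded[OF assms(1)] by (simp add: l2_bounded_op_def)
  then have "\<exists>g. (f, g) \<in> E B" using assms(2) by blast
  then show ?thesis unfolding l2_app_def by (rule someI_ex)
qed

lemma pvm_symmetric:
  "B \<in> sets borel \<Longrightarrow> (f, f') \<in> E B \<Longrightarrow> (g, g') \<in> E B \<Longrightarrow> l2_inner M f' g = l2_inner M f g'"
proof -
  assume B: "B \<in> sets borel" and f: "(f, f') \<in> E B" and g: "(g, g') \<in> E B"
  have "l2_adjoint M (E B) = E B"
    using pvm B by (simp add: projection_valued_measure_def l2_projection_def)
  with g have "(g, g') \<in> l2_adjoint M (E B)" by simp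
  with f show ?thesis unfolding l2_adjoint_def by blast
qed

lemma pvm_Int: "A \<in> sets borel \<Longrightarrow> B \<in> sets borel \<Longrightarrow> E A O E B = E (B \<inter> A)"
  using pvm by (auto simp: projection_valued_measure_def)

lemma pvm_inner_eq:
  assumes "B \<in> sets borel" "(f, g) \<in> E B" "h \<in> L2 M"
  shows "l2_inner M (l2_app (E B) f) h = l2_inner M g h"
proof (rule l2_inner_cong_AE)
  have f: "f \<in> L2 M" using assms pvm_L2 by blast
  show "AE x in M. l2_app (E B) f x = g x"
    using pvm_unique[OF assms(1) pvm_app[OF assms(1) f] assms(2)] by (simp add: l2_eq_def)
  show "l2_app (E B) f \<in> L2 M" using pvm_L2[OF assms(1) pvm_app[OF assms(1) f]] by simp
qed (use assms pvm_L2[OF assms(1,2)] in auto)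

text \<open>Self-adjointness moves one projection to the other side, where multiplicativity merges
  the two.\<close>

lemma pvm_inner_Int:
  assumes "A \<in> sets borel" "B \<in> sets borel" "(f, a) \<in> E A" "(f, b) \<in> E B"
  shows "l2_inner M a b = l2_inner M (l2_app (E (A \<inter> B)) f) f"
proof -
  have L: "f \<in> L2 M" "a \<in> L2 M" using pvm_L2 assms by blast+
  define c where "c = l2_app (E B) a"
  have c: "(a, c) \<in> E B" unfolding c_def by (rule pvm_app[OF assms(2) L(2)])
  then have "(f, c) \<in> E (B \<inter> A)" using assms pvm_Int[OF assms(1,2)] by blast
  then have "l2_inner M (l2_app (E (A \<inter> B)) f) f = l2_inner M c f"
    using assms L by (intro pvm_inner_eq) (auto simp: Int_commute)
  also have "\<dots> = l2_inner M a b" by (rule pvm_symmetric[OF assms(2) c assms(4)])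
  finally show ?thesis ..
qed

lemma pvm_self_nonneg: "B \<in> sets borel \<Longrightarrow> f \<in> L2 M \<Longrightarrow> 0 \<le> l2_inner M (l2_app (E B) f) f"
  using pvm_inner_Int[of B B f "l2_app (E B) f" "l2_app (E B) f"] pvm_app[of B f]
    l2_inner_self_nonneg[of M "l2_app (E B) f"] by simp

lemma pvm_sums:
  assumes "range B \<subseteq> sets borel" "disjoint_family B" "f \<in> L2 M"
  shows "(\<lambda>i. l2_inner M (l2_app (E (B i)) f) f) sums l2_inner M (l2_app (E (\<Union>i. B i)) f) f"
proof -
  have B: "B i \<in> sets borel" for i using assms by auto
  have L: "l2_app (E (B i)) f \<in> L2 M" for i
    using pvm_app[OF B assms(3)] pvm_L2[OF B] by blast
  have U: "l2_app (E (\<Union>i. B i)) f \<in> L2 M"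
    using pvm_app[of "\<Union>i. B i", OF _ assms(3)] pvm_L2[of "\<Union>i. B i"] B by blast
  have "(\<lambda>n. l2_inner M (\<lambda>x. \<Sum>i<n. l2_app (E (B i)) f x) f) \<longlonglongrightarrow> l2_inner M (l2_app (E (\<Union>i. B i)) f) f"
    using pvm assms by (intro l2_inner_tendsto L2_sum L U) (auto simp: projection_valued_measure_def)
  then show ?thesis by (simp add: sums_def l2_inner_sum_left L assms(3))
qed

text \<open>Countable additivity on the constant sequence of empty sets: a summable constant series
  is zero.\<close>

lemma pvm_empty:
  assumes "f \<in> L2 M" shows "l2_inner M (l2_app (E {}) f) f = 0"
proof -
  have "(\<lambda>i::nat. l2_inner M (l2_app (E {}) f) f) sums l2_inner M (l2_app (E {}) f) f"
    using pvm_sums[of "\<lambda>_. {}", OF _ _ assms] by (simp add: disjoint_family_on_def)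
  then show ?thesis by (auto dest: sums_summable simp: summable_const_iff)
qed

lemma sets_spectral_dist [simp]: "sets (spectral_dist M E f) = sets borel"
  unfolding spectral_dist_def by (rule sets.sets_measure_of_eq[of "borel :: real measure", unfolded space_borel])

lemma space_spectral_dist [simp]: "space (spectral_dist M E f) = UNIV"
  unfolding spectral_dist_def by (simp add: space_measure_of_conv)

text \<open>The values prescribed in \<open>measure_of\<close> are really taken once they are known
  to be countably additive; this comes from \<open>pvm_sums\<close>.\<close>

lemma emeasure_spectral_dist:
  assumes f: "f \<in> L2 M" and B: "B \<in> sets borel"
  shows "emeasure (spectral_dist M E f) B = ennreal (l2_inner M (l2_app (E B) f) f)"
  unfolding spectral_dist_def
proof (rule emeasure_measure_of_sigma)
  show "sigma_algebra (UNIV :: real set) (sets borel)"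
    using sets.sigma_algebra_axioms[of "borel :: real measure"] by simp
  show "positive (sets borel) (\<lambda>B. ennreal (l2_inner M (l2_app (E B) f) f))"
    by (simp add: positive_def pvm_empty[OF f])
  show "countably_additive (sets borel) (\<lambda>B. ennreal (l2_inner M (l2_app (E B) f) f))"
    unfolding countably_additive_def
  proof (intro allI impI)
    fix A :: "nat \<Rightarrow> real set"
    assume A: "range A \<subseteq> sets borel" "disjoint_family A"
    have "A i \<in> sets borel" for i using A(1) by blast
    then show "(\<Sum>i. ennreal (l2_inner M (l2_app (E (A i)) f) f))
        = ennreal (l2_inner M (l2_app (E (\<Union>i. A i)) f) f)"
      by (intro suminf_ennreal_eq pvm_sums[OF A f] pvm_self_nonneg[OF _ f])
  qed
qed (rule B)

lemma finite_measure_spectral_dist: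
  assumes f: "f \<in> L2 M" shows "finite_measure (spectral_dist M E f)"
  by (rule finite_measureI) (simp add: emeasure_spectral_dist[OF f])

text \<open>Expanding \<open><E(C) (f + h), f + h>\<close> produces the mass of \<open>C\<close> and
  three further terms, each equal to the mass of \<open>C \<inter> B\<close>; with
  \<open>f - h\<close> the signs leave minus one of them. Hence the densities
  \<open>1 + 3 * indicator B\<close> and \<open>1 - indicator B\<close>, which turn the polarized
  integrals of the calculus into integrals over \<open>B\<close>.\<close>

lemma spectral_dist_pvm_app:
  assumes f: "f \<in> L2 M" and B: "B \<in> sets borel"
  defines "h \<equiv> l2_app (E B) f" and "\<nu> \<equiv> spectral_dist M E f"
  shows "spectral_dist M E h = density \<nu> (\<lambda>t. ennreal (indicator B t))"
    and "spectral_dist M E (\<lambda>x. f x + h x) = density \<nu> (\<lambda>t. ennreal (1 + 3 * indicator B t))"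
    and "spectral_dist M E (\<lambda>x. f x - h x) = density \<nu> (\<lambda>t. ennreal (1 - indicator B t))"
proof -
  interpret \<nu>: finite_measure \<nu> unfolding \<nu>_def by (rule finite_measure_spectral_dist[OF f])
  have sets_\<nu> [simp, measurable_cong]: "sets \<nu> = sets borel" by (simp add: \<nu>_def)
  note [measurable] = B
  have hB: "(f, h) \<in> E B" unfolding h_def by (rule pvm_app[OF B f])
  then have h: "h \<in> L2 M" using pvm_L2[OF B] by blast
  have meas: "measure \<nu> C = l2_inner M (l2_app (E C) f) f" if "C \<in> sets borel" for C
    using emeasure_spectral_dist[OF f that] pvm_self_nonneg[OF that f]
    by (simp add: measure_def \<nu>_def)
  have ind: "ennreal (measure \<nu> (C \<inter> B)) = (\<integral>\<^sup>+t. indicator B t * indicator C t \<partial>\<nu>)"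
    if "C \<in> sets borel" for C
  proof -
    have "(\<integral>\<^sup>+t. indicator B t * indicator C t \<partial>\<nu>) = (\<integral>\<^sup>+t. indicator (C \<inter> B) t \<partial>\<nu>)"
      by (intro nn_integral_cong) (auto simp: indicator_def)
    then show ?thesis using that by (simp add: \<nu>.emeasure_eq_measure)
  qed
  have parts: "l2_inner M (l2_app (E C) h) h = measure \<nu> (C \<inter> B)"
    "l2_inner M (l2_app (E C) (\<lambda>x. f x + h x)) (\<lambda>x. f x + h x) = measure \<nu> C + 3 * measure \<nu> (C \<inter> B)"
    "l2_inner M (l2_app (E C) (\<lambda>x. f x - h x)) (\<lambda>x. f x - h x) = measure \<nu> C - measure \<nu> (C \<inter> B)"
    if C: "C \<in> sets borel" for C
  proof -
    define a where "a = l2_app (E C) f"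
    define b where "b = l2_app (E C) h"
    have a: "(f, a) \<in> E C" unfolding a_def by (rule pvm_app[OF C f])
    have b: "(h, b) \<in> E C" unfolding b_def by (rule pvm_app[OF C h])
    have aL: "a \<in> L2 M" and bL: "b \<in> L2 M" using pvm_L2[OF C] a b by blast+
    have CB: "C \<inter> B \<in> sets borel" using B C by auto
    have fb: "(f, b) \<in> E (C \<inter> B)" using hB b pvm_Int[OF B C] by blast
    have af: "l2_inner M a f = measure \<nu> C" using meas[OF C] by (simp add: a_def)
    have ah: "l2_inner M a h = measure \<nu> (C \<inter> B)"
      using pvm_inner_Int[OF C B a hB] meas[OF CB] by simp
    have bf: "l2_inner M b f = measure \<nu> (C \<inter> B)"
      using pvm_inner_eq[OF CB fb f] meas[OF CB] by simp
    have bh: "l2_inner M b h = measure \<nu> (C \<inter> B)"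
      using pvm_inner_Int[OF CB B fb hB] meas[OF CB] by (simp add: Int_assoc)
    show "l2_inner M (l2_app (E C) h) h = measure \<nu> (C \<inter> B)"
      using bh by (simp add: b_def)
    have "(\<lambda>x. f x + h x, \<lambda>x. a x + b x) \<in> E C"
      using pvm_lincomb[OF C a b, of 1 1] by simp
    from pvm_inner_eq[OF C this L2_add[OF f h]]
    show "l2_inner M (l2_app (E C) (\<lambda>x. f x + h x)) (\<lambda>x. f x + h x) = measure \<nu> C + 3 * measure \<nu> (C \<inter> B)"
      using f h aL bL by (simp add: l2_inner_left l2_inner_right L2_intros af ah bf bh)
    have "(\<lambda>x. f x - h x, \<lambda>x. a x - b x) \<in> E C"
      using pvm_lincomb[OF C a b, of 1 "-1"] by simp
    from pvm_inner_eq[OF C this L2_diff[OF f h]]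
    show "l2_inner M (l2_app (E C) (\<lambda>x. f x - h x)) (\<lambda>x. f x - h x) = measure \<nu> C - measure \<nu> (C \<inter> B)"
      using f h aL bL by (simp add: l2_inner_left l2_inner_right L2_intros af ah bf bh)
  qed
  show "spectral_dist M E h = density \<nu> (\<lambda>t. ennreal (indicator B t))"
  proof (rule measure_eqI)
    fix C assume "C \<in> sets (spectral_dist M E h)"
    then have C: "C \<in> sets borel" by simp
    have "emeasure (density \<nu> (\<lambda>t. ennreal (indicator B t))) C = (\<integral>\<^sup>+t. indicator B t * indicator C t \<partial>\<nu>)"
      using C by (subst emeasure_density) (auto simp: ennreal_indicator)
    then show "emeasure (spectral_dist M E h) C = emeasure (density \<nu> (\<lambda>t. ennreal (indicator B t))) C"
      by (simp add: emeasure_spectral_dist[OF h C] parts[OF C] ind[OF C])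
  qed (simp add: \<nu>_def)
  show "spectral_dist M E (\<lambda>x. f x + h x) = density \<nu> (\<lambda>t. ennreal (1 + 3 * indicator B t))"
  proof (rule measure_eqI)
    fix C assume "C \<in> sets (spectral_dist M E (\<lambda>x. f x + h x))"
    then have C: "C \<in> sets borel" by simp
    note [measurable] = C
    have "emeasure (density \<nu> (\<lambda>t. ennreal (1 + 3 * indicator B t))) C
        = (\<integral>\<^sup>+t. indicator C t + 3 * (indicator B t * indicator C t) \<partial>\<nu>)"
      using C by (subst emeasure_density)
        (auto intro!: nn_integral_cong split: split_indicator)
    also have "\<dots> = emeasure \<nu> C + 3 * ennreal (measure \<nu> (C \<inter> B))"
      using C by (subst nn_integral_add) (auto simp: nn_integral_cmult ind)
    also have "\<dots> = ennreal (measure \<nu> C + 3 * measure \<nu> (C \<inter> B))"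
      by (simp add: \<nu>.emeasure_eq_measure ennreal_plus ennreal_mult)
    finally show "emeasure (spectral_dist M E (\<lambda>x. f x + h x)) C
        = emeasure (density \<nu> (\<lambda>t. ennreal (1 + 3 * indicator B t))) C"
      by (simp add: emeasure_spectral_dist[OF L2_add[OF f h] C] parts[OF C])
  qed (simp add: \<nu>_def)
  show "spectral_dist M E (\<lambda>x. f x - h x) = density \<nu> (\<lambda>t. ennreal (1 - indicator B t))"
  proof (rule measure_eqI)
    fix C assume "C \<in> sets (spectral_dist M E (\<lambda>x. f x - h x))"
    then have C: "C \<in> sets borel" by simp
    note [measurable] = C
    have "emeasure (density \<nu> (\<lambda>t. ennreal (1 - indicator B t))) C
        = (\<integral>\<^sup>+t. ennreal (1 - indicator B t) * indicator C t \<partial>\<nu>)"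
      using C by (subst emeasure_density) auto
    also have "\<dots> = (\<integral>\<^sup>+t. indicator (C - B) t \<partial>\<nu>)"
      by (intro nn_integral_cong) (auto split: split_indicator)
    also have "\<dots> = ennreal (measure \<nu> C - measure \<nu> (C \<inter> B))"
      using C B by (simp add: \<nu>.emeasure_eq_measure \<nu>.finite_measure_Diff')
    finally show "emeasure (spectral_dist M E (\<lambda>x. f x - h x)) C
        = emeasure (density \<nu> (\<lambda>t. ennreal (1 - indicator B t))) C"
      by (simp add: emeasure_spectral_dist[OF L2_diff[OF f h] C] parts[OF C])
  qed (simp add: \<nu>_def)
qed

text \<open>Testing the eigenvalue equation against \<open>h = E(B) e\<close> gives \<open>\<integral>\<^bsub>B\<^esub> (t - c) d\<langle>E e, e\<rangle> = 0\<close> for every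
  Borel set \<open>B\<close>, so the spectral measure of \<open>e\<close> is concentrated at \<open>c\<close>.\<close>

lemma spectral_integral_eigenvector:
  assumes e: "e \<in> L2 M" "l2_inner M e e = 1"
    and eig: "(e, \<lambda>x. c * e x) \<in> spectral_integral M E (\<lambda>t. t)"
  shows "(e, e) \<in> E {c}"
proof -
  define \<nu> where "\<nu> = spectral_dist M E e"
  interpret \<nu>: finite_measure \<nu> unfolding \<nu>_def by (rule finite_measure_spectral_dist[OF e(1)])
  have sets_\<nu> [simp, measurable_cong]: "sets \<nu> = sets borel" by (simp add: \<nu>_def)
  define D where "D = {f \<in> L2 M. integrable (spectral_dist M E f) (\<lambda>t. t\<^sup>2)}"
  have eD: "e \<in> D" and
    form: "l2_inner M (\<lambda>x. c * e x) h = ((\<integral>t. t \<partial>spectral_dist M E (\<lambda>x. e x + h x)) -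
             (\<integral>t. t \<partial>spectral_dist M E (\<lambda>x. e x - h x))) / 4" if "h \<in> D" for h
    using eig that by (auto simp: spectral_integral_def D_def)
  have t2: "integrable \<nu> (\<lambda>t. t\<^sup>2)"
    using eig by (auto simp: spectral_integral_def \<nu>_def)
  then have t1: "integrable \<nu> (\<lambda>t. t)"
    by (intro \<nu>.L2_integrable) (simp add: L2_def)
  have zero: "(\<integral>t. indicator B t * (t - c) \<partial>\<nu>) = 0" if B[measurable]: "B \<in> sets borel" for B
  proof -
    define h where "h = l2_app (E B) e"
    have hB: "(e, h) \<in> E B" unfolding h_def by (rule pvm_app[OF B e(1)])
    then have hL: "h \<in> L2 M" using pvm_L2[OF B] by blast
    note dist = spectral_dist_pvm_app[OF e(1) B, folded h_def \<nu>_def]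
    have iB: "integrable \<nu> (\<lambda>t. indicator B t * t)"
      using integrable_mult_indicator[OF _ t1, of B] B by simp
    \<comment> \<open>The spectral measure of \<open>h\<close> is that of \<open>e\<close>
      restricted to \<open>B\<close>, so its second moment stays finite and \<open>h\<close> is an
      admissible test vector.\<close>
    have "integrable \<nu> (\<lambda>t. indicator B t * t\<^sup>2)"
      using integrable_mult_indicator[OF _ t2, of B] B by simp
    then have "h \<in> D"
      using hL by (simp add: D_def dist integrable_density)
    moreover have "(\<integral>t. t \<partial>spectral_dist M E (\<lambda>x. e x + h x)) = (\<integral>t. (1 + 3 * indicator B t) * t \<partial>\<nu>)"
      unfolding dist by (subst integral_density) auto
    moreover have "(\<integral>t. t \<partial>spectral_dist M E (\<lambda>x. e x - h x)) = (\<integral>t. (1 - indicator B t) * t \<partial>\<nu>)"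
      unfolding dist by (subst integral_density) (auto simp: indicator_le_1)
    ultimately have "c * l2_inner M h e
        = ((\<integral>t. (1 + 3 * indicator B t) * t \<partial>\<nu>) - (\<integral>t. (1 - indicator B t) * t \<partial>\<nu>)) / 4"
      using form[of h] by (simp add: l2_inner_scale_left l2_inner_commute[of M e h])
    also have "(\<integral>t. (1 + 3 * indicator B t) * t \<partial>\<nu>) = (\<integral>t. t \<partial>\<nu>) + 3 * (\<integral>t. indicator B t * t \<partial>\<nu>)"
      using iB t1 by (simp add: ring_distribs mult.assoc)
    also have "(\<integral>t. (1 - indicator B t) * t \<partial>\<nu>) = (\<integral>t. t \<partial>\<nu>) - (\<integral>t. indicator B t * t \<partial>\<nu>)"
      using iB t1 by (simp add: left_diff_distrib)
    also have "l2_inner M h e = measure \<nu> B"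
      using emeasure_spectral_dist[OF e(1) B] pvm_self_nonneg[OF B e(1)]
      by (simp add: measure_def \<nu>_def h_def)
    finally have *: "c * measure \<nu> B = (\<integral>t. indicator B t * t \<partial>\<nu>)" by simp
    have "(\<integral>t. indicator B t * (t - c) \<partial>\<nu>) = (\<integral>t. indicator B t * t - c * indicator B t \<partial>\<nu>)"
      by (simp add: algebra_simps)
    also have "\<dots> = (\<integral>t. indicator B t * t \<partial>\<nu>) - c * measure \<nu> B"
    proof -
      have "integrable \<nu> (indicat_real B)"
        by (intro integrable_real_indicator) (auto simp: \<nu>.emeasure_eq_measure)
      with iB show ?thesis by (simp add: integral_indicator)
    qed
    finally show ?thesis using * by simp
  qed
  have int: "integrable \<nu> (\<lambda>t. indicator B t * (t - c))" if "B \<in> sets borel" for B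
    using integrable_mult_indicator[of B \<nu> "\<lambda>t. t - c"] t1 that by simp
  \<comment> \<open>On either side of \<open>c\<close> the integrand has constant sign, so a zero
    integral makes it vanish almost everywhere.\<close>
  have "AE t in \<nu>. indicator {c<..} t * (t - c) = 0"
  proof (rule integral_nonneg_eq_0_iff_AE[THEN iffD1])
    show "AE t in \<nu>. 0 \<le> indicator {c<..} t * (t - c)"
      by (intro AE_I2) (simp add: indicator_def)
  qed (simp_all add: int zero)
  moreover have "AE t in \<nu>. - (indicator {..<c} t * (t - c)) = 0"
  proof (rule integral_nonneg_eq_0_iff_AE[THEN iffD1])
    show "integrable \<nu> (\<lambda>t. - (indicator {..<c} t * (t - c)))"
      by (rule Bochner_Integration.integrable_minus[OF int]) simp
    show "AE t in \<nu>. 0 \<le> - (indicator {..<c} t * (t - c))"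
      by (intro AE_I2) (simp add: indicator_def)
    show "(\<integral>t. - (indicator {..<c} t * (t - c)) \<partial>\<nu>) = 0" using zero[of "{..<c}"] by simp
  qed
  ultimately have "AE t in \<nu>. t \<in> {c}"
    by eventually_elim (auto simp: indicator_def split: if_splits)
  then have "measure \<nu> {c} = measure \<nu> (space \<nu>)"
    by (intro \<nu>.finite_measure_eq_AE) (auto simp: \<nu>_def)
  moreover have "measure \<nu> B = l2_inner M (l2_app (E B) e) e" if B: "B \<in> sets borel" for B
    using emeasure_spectral_dist[OF e(1) B] pvm_self_nonneg[OF B e(1)] by (simp add: measure_def \<nu>_def)
  ultimately have eq: "l2_inner M (l2_app (E {c}) e) e = l2_inner M (l2_app (E UNIV) e) e"
    by (simp add: \<nu>_def)
  have eU: "(e, e) \<in> E UNIV"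
    using pvm e(1) by (simp add: projection_valued_measure_def l2_id_def l2_eq_def)
  define g where "g = l2_app (E {c}) e"
  have gc: "(e, g) \<in> E {c}" unfolding g_def by (rule pvm_app[OF _ e(1)]) simp
  have gL: "g \<in> L2 M" using pvm_L2[OF _ gc] by simp
  have ge: "l2_inner M g e = 1"
    using eq pvm_inner_eq[OF _ eU e(1)] e(2) by (simp add: g_def)
  have gg: "l2_inner M g g = 1"
    using pvm_inner_Int[OF _ _ gc gc] ge by (simp add: g_def)
  \<comment> \<open>A projection that preserves the quadratic form of a unit vector fixes it: the
    square expands to \<open>1 - 2 + 1\<close>.\<close>
  have "l2_inner M (\<lambda>x. g x - e x) (\<lambda>x. g x - e x) = 0"
    using gL e ge gg by (simp add: l2_inner_left l2_inner_right L2_intros l2_inner_commute[of M e g])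
  then have "l2_eq M g e"
    using gL e(1) by (simp add: l2_inner_self_eq_0 L2_intros l2_eq_def)
  then show ?thesis
    using pvm_cong[OF _ gc] e(1) by (auto simp: l2_eq_def)
qed

end

section \<open>The spectral resolution of a diagonal operator\<close>

context l2_basis
begin

text \<open>This is the spectral measure of \<open>f\<close> for eigenvalues \<open>\<mu> e\<close>:
  the weights \<open><f, e>^2\<close> pushed forward along \<open>\<mu>\<close>. The form as
  \<open>distr\<close> of a \<open>density\<close> lets integrals transfer to sums over
  \<open>S\<close>.\<close>

definition coeff_measure :: "(('a \<Rightarrow> real) \<Rightarrow> real) \<Rightarrow> ('a \<Rightarrow> real) \<Rightarrow> real measure" where
  "coeff_measure \<mu> f = distr (density (count_space S) (\<lambda>e. ennreal ((l2_inner M f e)\<^sup>2))) borel \<mu>"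

lemma emeasure_coeff_measure:
  assumes f: "f \<in> L2 M" and B: "B \<in> sets borel"
  shows "emeasure (coeff_measure \<mu> f) B
    = ennreal (\<integral>e. indicator B (\<mu> e) * (l2_inner M f e)\<^sup>2 \<partial>count_space S)"
proof -
  have int: "integrable (count_space S) (\<lambda>e. indicator B (\<mu> e) * (l2_inner M f e)\<^sup>2)"
    by (rule Bochner_Integration.integrable_bound[OF coeff_square_integrable[OF f]])
      (auto simp: AE_count_space indicator_def)
  have "emeasure (coeff_measure \<mu> f) B
    = (\<integral>\<^sup>+e. ennreal ((l2_inner M f e)\<^sup>2) * indicator (\<mu> -` B \<inter> S) e \<partial>count_space S)"
    unfolding coeff_measure_def using B
    by (subst emeasure_distr) (auto simp: emeasure_density)
  also have "\<dots> = (\<integral>\<^sup>+e. ennreal (indicator B (\<mu> e) * (l2_inner M f e)\<^sup>2) \<partial>count_space S)"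
    by (intro nn_integral_cong) (auto simp: indicator_def)
  also have "\<dots> = ennreal (\<integral>e. indicator B (\<mu> e) * (l2_inner M f e)\<^sup>2 \<partial>count_space S)"
    using int by (intro nn_integral_eq_integral) auto
  finally show ?thesis .
qed

lemma integrable_coeff_measure:
  assumes [measurable]: "\<phi> \<in> borel_measurable borel"
  shows "integrable (coeff_measure \<mu> f) \<phi> \<longleftrightarrow>
    integrable (count_space S) (\<lambda>e. \<phi> (\<mu> e) * (l2_inner M f e)\<^sup>2)"
  unfolding coeff_measure_def
  by (subst integrable_distr_eq) (auto simp: integrable_density mult.commute)

lemma integral_coeff_measure:
  assumes [measurable]: "\<phi> \<in> borel_measurable borel"
  shows "(\<integral>t. \<phi> t \<partial>coeff_measure \<mu> f) = (\<integral>e. \<phi> (\<mu> e) * (l2_inner M f e)\<^sup>2 \<partial>count_space S)"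
  unfolding coeff_measure_def
  by (subst integral_distr) (auto simp: integral_density mult.commute)

abbreviation spectral_diag :: "(('a \<Rightarrow> real) \<Rightarrow> real) \<Rightarrow> real set \<Rightarrow> 'a l2op" where
  "spectral_diag \<mu> B \<equiv> diag_op (\<lambda>e. indicator B (\<mu> e))"

lemma spectral_diag_app_L2: "f \<in> L2 M \<Longrightarrow> l2_app (spectral_diag \<mu> B) f \<in> L2 M"
  using diag_op_app[of f "\<lambda>e. indicator B (\<mu> e)" 1] by (auto simp: diag_op_def)

lemma spectral_diag_app_coeff:
  "f \<in> L2 M \<Longrightarrow> e \<in> S \<Longrightarrow> l2_inner M (l2_app (spectral_diag \<mu> B) f) e = indicator B (\<mu> e) * l2_inner M f e"
  by (rule diag_op_app_coeff[of _ _ 1]) auto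

text \<open>\<open>E\<close> is compared with the diagonal family on Borel sets only, because a
  chosen resolution is unspecified elsewhere.\<close>

lemma spectral_dist_diag:
  assumes E: "\<And>B. B \<in> sets borel \<Longrightarrow> E B = spectral_diag \<mu> B" and f: "f \<in> L2 M"
  shows "spectral_dist M E f = coeff_measure \<mu> f"
proof -
  have "spectral_dist M E f = measure_of UNIV (sets borel) (emeasure (coeff_measure \<mu> f))"
    unfolding spectral_dist_def
  proof (rule measure_of_eq)
    fix B :: "real set" assume "B \<in> sigma_sets UNIV (sets borel)"
    then have B: "B \<in> sets borel" by (metis sets.sigma_sets_eq space_borel)
    have "l2_inner M (l2_app (E B) f) f = (\<integral>e. l2_inner M (l2_app (E B) f) e * l2_inner M f e \<partial>count_space S)"
      using f by (intro Parseval) (auto simp: E[OF B] spectral_diag_app_L2)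
    also have "\<dots> = (\<integral>e. indicator B (\<mu> e) * (l2_inner M f e)\<^sup>2 \<partial>count_space S)"
      using f by (intro Bochner_Integration.integral_cong)
        (auto simp: E[OF B] spectral_diag_app_coeff power2_eq_square)
    finally show "ennreal (l2_inner M (l2_app (E B) f) f) = emeasure (coeff_measure \<mu> f) B"
      by (simp add: emeasure_coeff_measure[OF f B])
  qed auto
  also have "\<dots> = coeff_measure \<mu> f"
    using measure_of_of_measure[of "coeff_measure \<mu> f"] by (simp add: coeff_measure_def)
  finally show ?thesis .
qed

text \<open>By polarization the defining identity says that \<open>g\<close> and the multiplied
  coefficients of \<open>f\<close> pair equally with every \<open>h\<close> in the domain. Basis
  vectors lie in that domain and isolate single coefficients; Parseval gives the converse.\<close>

lemma spectral_integral_diag: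
  assumes E: "\<And>B. B \<in> sets borel \<Longrightarrow> E B = spectral_diag \<mu> B"
    and \<phi>[measurable]: "\<phi> \<in> borel_measurable borel"
  shows "spectral_integral M E \<phi> = diag_op (\<lambda>e. \<phi> (\<mu> e))"
proof -
  define c where "c f e = l2_inner M f e" for f e
  define D where "D = {f \<in> L2 M. integrable (spectral_dist M E f) (\<lambda>t. (\<phi> t)\<^sup>2)}"
  have D: "f \<in> D \<longleftrightarrow> f \<in> L2 M \<and> integrable (count_space S) (\<lambda>e. (\<phi> (\<mu> e) * c f e)\<^sup>2)" for f
    by (auto simp: D_def spectral_dist_diag[OF E] integrable_coeff_measure power_mult_distrib c_def)
  have D_L2: "f \<in> L2 M" if "f \<in> D" for f using that by (simp add: D)
  have mixed: "integrable (count_space S) (\<lambda>e. \<phi> (\<mu> e) * c f e * c h e)" if "f \<in> D" "h \<in> L2 M" for f h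
    using that L2_mult_integrable[of "\<lambda>e. \<phi> (\<mu> e) * c f e" "count_space S" "c h"]
    by (simp add: D L2_def c_def coeff_square_integrable)
  have dist: "(\<integral>t. \<phi> t \<partial>spectral_dist M E (\<lambda>x. f x + h x)) - (\<integral>t. \<phi> t \<partial>spectral_dist M E (\<lambda>x. f x - h x))
      = 4 * (\<integral>e. \<phi> (\<mu> e) * c f e * c h e \<partial>count_space S)" if "f \<in> D" "h \<in> D" for f h
  proof -
    note L = D_L2[OF that(1)] D_L2[OF that(2)]
    have "(\<integral>t. \<phi> t \<partial>spectral_dist M E (\<lambda>x. f x + h x))
       = (\<integral>e. \<phi> (\<mu> e) * c f e * c f e + 2 * (\<phi> (\<mu> e) * c f e * c h e) + \<phi> (\<mu> e) * c h e * c h e \<partial>count_space S)"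
      using L
      by (simp add: spectral_dist_diag[OF E] L2_intros integral_coeff_measure)
        (auto intro!: Bochner_Integration.integral_cong simp: l2_inner_left basis_L2 c_def power2_eq_square algebra_simps)
    also have "\<dots> = (\<integral>e. \<phi> (\<mu> e) * c f e * c f e \<partial>count_space S) + 2 * (\<integral>e. \<phi> (\<mu> e) * c f e * c h e \<partial>count_space S)
        + (\<integral>e. \<phi> (\<mu> e) * c h e * c h e \<partial>count_space S)"
      using that L by (simp add: mixed)
    finally have 1: "(\<integral>t. \<phi> t \<partial>spectral_dist M E (\<lambda>x. f x + h x)) = \<dots>" .
    have "(\<integral>t. \<phi> t \<partial>spectral_dist M E (\<lambda>x. f x - h x))
       = (\<integral>e. \<phi> (\<mu> e) * c f e * c f e - 2 * (\<phi> (\<mu> e) * c f e * c h e) + \<phi> (\<mu> e) * c h e * c h e \<partial>count_space S)"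
      using L
      by (simp add: spectral_dist_diag[OF E] L2_intros integral_coeff_measure)
        (auto intro!: Bochner_Integration.integral_cong simp: l2_inner_left basis_L2 c_def power2_eq_square algebra_simps)
    also have "\<dots> = (\<integral>e. \<phi> (\<mu> e) * c f e * c f e \<partial>count_space S) - 2 * (\<integral>e. \<phi> (\<mu> e) * c f e * c h e \<partial>count_space S)
        + (\<integral>e. \<phi> (\<mu> e) * c h e * c h e \<partial>count_space S)"
      using that L by (simp add: mixed)
    finally show ?thesis using 1 by simp
  qed
  \<comment> \<open>Only one coefficient of a basis vector is nonzero, so no growth of
    \<open>\<phi>\<close> can exclude it.\<close>
  have S_D: "e \<in> D" if e: "e \<in> S" for e
  proof -
    have "integrable (count_space S) (\<lambda>e'. (\<phi> (\<mu> e))\<^sup>2 * (c e e')\<^sup>2)"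
      using basis_L2[OF e] by (simp add: c_def coeff_square_integrable)
    moreover have "(\<phi> (\<mu> e') * c e e')\<^sup>2 = (\<phi> (\<mu> e))\<^sup>2 * (c e e')\<^sup>2" if "e' \<in> S" for e'
      using basis_inner[OF e that] by (auto simp: c_def power_mult_distrib)
    then have "integrable (count_space S) (\<lambda>e'. (\<phi> (\<mu> e') * c e e')\<^sup>2)
        \<longleftrightarrow> integrable (count_space S) (\<lambda>e'. (\<phi> (\<mu> e))\<^sup>2 * (c e e')\<^sup>2)"
      by (intro Bochner_Integration.integrable_cong) auto
    ultimately have "integrable (count_space S) (\<lambda>e'. (\<phi> (\<mu> e') * c e e')\<^sup>2)" by simp
    then show ?thesis using basis_L2[OF e] by (simp add: D)
  qed
  have delta: "(\<integral>e'. F e' * c e e' \<partial>count_space S) = F e" if e: "e \<in> S" for e F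
  proof -
    have "(\<integral>e'. F e' * c e e' \<partial>count_space S) = (\<integral>e'. F e * indicator {e} e' \<partial>count_space S)"
      using basis_inner[OF e] by (intro Bochner_Integration.integral_cong) (auto simp: c_def indicator_def)
    also have "\<dots> = F e" using e by simp
    finally show ?thesis .
  qed
  have "(f, g) \<in> spectral_integral M E \<phi> \<longleftrightarrow> (f, g) \<in> diag_op (\<lambda>e. \<phi> (\<mu> e))" for f g
  proof -
    have "(f, g) \<in> spectral_integral M E \<phi> \<longleftrightarrow> f \<in> D \<and> g \<in> L2 M \<and>
       (\<forall>h\<in>D. l2_inner M g h = (\<integral>e. \<phi> (\<mu> e) * c f e * c h e \<partial>count_space S))"
      using dist[of f] by (auto simp: spectral_integral_def Let_def D_def[symmetric])
    also have "\<dots> \<longleftrightarrow> f \<in> L2 M \<and> g \<in> L2 M \<and> (\<forall>e\<in>S. l2_inner M g e = \<phi> (\<mu> e) * c f e)"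
    proof safe
      fix e assume "\<forall>h\<in>D. l2_inner M g h = (\<integral>e. \<phi> (\<mu> e) * c f e * c h e \<partial>count_space S)" "e \<in> S"
      then show "l2_inner M g e = \<phi> (\<mu> e) * c f e"
        using S_D[of e] delta[of e "\<lambda>e. \<phi> (\<mu> e) * c f e"] by simp
    next
      assume L: "f \<in> L2 M" "g \<in> L2 M" and g: "\<forall>e\<in>S. l2_inner M g e = \<phi> (\<mu> e) * c f e"
      have "integrable (count_space S) (\<lambda>e. (\<phi> (\<mu> e) * c f e)\<^sup>2)"
        using coeff_square_integrable[OF L(2)] g
        by (subst Bochner_Integration.integrable_cong[where g = "\<lambda>e. (l2_inner M g e)\<^sup>2"]) auto
      then show "f \<in> D" using L by (simp add: D)
    next
      fix h assume L: "f \<in> L2 M" "g \<in> L2 M" and g: "\<forall>e\<in>S. l2_inner M g e = \<phi> (\<mu> e) * c f e" and h: "h \<in> D"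
      show "l2_inner M g h = (\<integral>e. \<phi> (\<mu> e) * c f e * c h e \<partial>count_space S)"
        using g by (subst Parseval[OF L(2) D_L2[OF h]])
          (auto intro!: Bochner_Integration.integral_cong simp: c_def)
    qed (auto simp: D)
    finally show ?thesis by (simp add: diag_op_def c_def)
  qed
  then show ?thesis by auto
qed

lemma projection_valued_measure_diag: "projection_valued_measure M (spectral_diag \<mu>)"
  unfolding projection_valued_measure_def
proof (intro conjI ballI allI impI)
  fix B :: "real set" assume "B \<in> sets borel"
  have "spectral_diag \<mu> B O spectral_diag \<mu> B = spectral_diag \<mu> B"
    by (subst diag_op_comp[of _ 1]) (auto intro!: diag_op_cong simp: indicator_def)
  then show "l2_projection M (spectral_diag \<mu> B)"
    unfolding l2_projection_def
    by (auto simp: diag_op_adjoint intro!: diag_op_bounded[of _ 1])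
next
  show "spectral_diag \<mu> UNIV = l2_id M"
    by (auto simp: diag_op_def l2_id_def l2_eq_def intro: coeff_eq_imp_AE_eq)
      (auto intro!: l2_inner_cong_AE[symmetric] basis_L2)
next
  fix A B :: "real set"
  show "spectral_diag \<mu> (A \<inter> B) = spectral_diag \<mu> B O spectral_diag \<mu> A"
    by (subst diag_op_comp[of _ 1]) (auto intro!: diag_op_cong simp: indicator_def)
next
  fix B :: "nat \<Rightarrow> real set" and f
  assume B: "range B \<subseteq> sets borel \<and> disjoint_family B" and f: "f \<in> L2 M"
  define p where "p C = l2_app (spectral_diag \<mu> C) f" for C
  have p: "p C \<in> L2 M" for C unfolding p_def by (rule spectral_diag_app_L2[OF f])
  define d where "d n x = p (\<Union>i. B i) x - (\<Sum>i<n. p (B i) x)" for n x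
  have d: "d n \<in> L2 M" for n unfolding d_def[abs_def] by (intro L2_intros p)
  have dc: "l2_inner M (d n) e = (indicator (\<Union>i. B i) (\<mu> e) - indicator (\<Union>i<n. B i) (\<mu> e)) * l2_inner M f e"
    if e: "e \<in> S" for n e
  proof -
    have "l2_inner M (d n) e = indicator (\<Union>i. B i) (\<mu> e) * l2_inner M f e - (\<Sum>i<n. indicator (B i) (\<mu> e) * l2_inner M f e)"
      unfolding d_def[abs_def] using e f
      by (simp add: l2_inner_left L2_intros p basis_L2) (simp add: p_def spectral_diag_app_coeff)
    also have "(\<Sum>i<n. indicator (B i) (\<mu> e) * l2_inner M f e) = indicator (\<Union>i<n. B i) (\<mu> e) * l2_inner M f e"
      using B by (subst indicator_UN_disjoint) (auto simp: sum_distrib_right disjoint_family_on_def)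
    finally show ?thesis by (simp add: algebra_simps)
  qed
  \<comment> \<open>Norm convergence, seen through Parseval: for each \<open>e\<close> the
    indicators of the partial unions become stationary, and the squared coefficients of
    \<open>f\<close> dominate.\<close>
  have "(\<lambda>n. \<integral>e. ((indicator (\<Union>i. B i) (\<mu> e) - indicator (\<Union>i<n. B i) (\<mu> e)) * l2_inner M f e)\<^sup>2 \<partial>count_space S)
      \<longlonglongrightarrow> (\<integral>e. 0 \<partial>count_space S)"
  proof (rule integral_dominated_convergence[where w = "\<lambda>e. (l2_inner M f e)\<^sup>2"])
    show "integrable (count_space S) (\<lambda>e. (l2_inner M f e)\<^sup>2)" by (rule coeff_square_integrable[OF f])
    show "AE e in count_space S. (\<lambda>n. ((indicator (\<Union>i. B i) (\<mu> e) - indicator (\<Union>i<n. B i) (\<mu> e)) * l2_inner M f e)\<^sup>2) \<longlonglongrightarrow> 0"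
    proof (rule AE_I2)
      fix e
      have "(\<lambda>n. ((indicator (\<Union>i. B i) (\<mu> e) - indicator (\<Union>i<n. B i) (\<mu> e)) * l2_inner M f e)\<^sup>2)
         \<longlonglongrightarrow> ((indicator (\<Union>i. B i) (\<mu> e) - indicator (\<Union>i. B i) (\<mu> e)) * l2_inner M f e)\<^sup>2"
        by (intro tendsto_intros LIMSEQ_indicator_UN)
      then show "(\<lambda>n. ((indicator (\<Union>i. B i) (\<mu> e) - indicator (\<Union>i<n. B i) (\<mu> e)) * l2_inner M f e)\<^sup>2) \<longlonglongrightarrow> 0"
        by simp
    qed
  qed (auto simp: AE_count_space indicator_def)
  moreover have "(\<integral>e. ((indicator (\<Union>i. B i) (\<mu> e) - indicator (\<Union>i<n. B i) (\<mu> e)) * l2_inner M f e)\<^sup>2 \<partial>count_space S)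
     = l2_inner M (d n) (d n)" for n
    by (subst Parseval_self[OF d]) (auto intro!: Bochner_Integration.integral_cong simp: dc)
  ultimately have "(\<lambda>n. l2_inner M (d n) (d n)) \<longlonglongrightarrow> 0" by simp
  from tendsto_real_sqrt[OF this] show "(\<lambda>n. l2_norm M (\<lambda>x. l2_app (spectral_diag \<mu> (\<Union>i. B i)) f x
      - (\<Sum>i<n. l2_app (spectral_diag \<mu> (B i)) f x))) \<longlonglongrightarrow> 0"
    by (simp add: l2_norm_def d_def[abs_def] p_def)
qed

lemma spectral_resolution_diag: "spectral_resolution M (diag_op \<mu>) (spectral_diag \<mu>)"
  unfolding spectral_resolution_def
  using projection_valued_measure_diag spectral_integral_diag[of "spectral_diag \<mu>" \<mu> "\<lambda>t. t"] by simp

text \<open>\<open>borel_calculus\<close> picks a resolution by \<open>SOME\<close>, so every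
  resolution must be computed. Its projection at the point \<open>\<mu> e\<close> fixes
  \<open>e\<close>, hence by multiplicativity \<open>E B\<close> sends \<open>e\<close> to
  \<open>e\<close> or to zero according to whether \<open>\<mu> e\<close> lies in \<open>B\<close>.
  Self-adjointness carries this over to the coefficients of an arbitrary vector.\<close>

lemma spectral_resolution_unique:
  assumes E: "spectral_resolution M (diag_op \<mu>) E" and B: "B \<in> sets borel"
  shows "E B = spectral_diag \<mu> B"
proof -
  have pvm: "projection_valued_measure M E" and A: "diag_op \<mu> = spectral_integral M E (\<lambda>t. t)"
    using E by (auto simp: spectral_resolution_def)
  have app: "l2_eq M g (\<lambda>x. indicator B (\<mu> e) * e x)" if e: "e \<in> S" and g: "(e, g) \<in> E B" for e g
  proof -
    have ee: "(e, e) \<in> E {\<mu> e}"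
      using diag_op_basis[OF e, of \<mu>] basis_L2[OF e] basis_self[OF e]
      by (intro spectral_integral_eigenvector[OF pvm]) (auto simp: A)
    have gL: "g \<in> L2 M" using pvm_L2[OF pvm B g] by simp
    have gB: "(e, g) \<in> E (B \<inter> {\<mu> e})" using ee g pvm_Int[OF pvm _ B, of "{\<mu> e}"] by auto
    show ?thesis
    proof (cases "\<mu> e \<in> B")
      case True
      then have "B \<inter> {\<mu> e} = {\<mu> e}" by auto
      then have "l2_eq M g e" using gB ee pvm_unique[OF pvm, of "{\<mu> e}" e g e] by simp
      then show ?thesis using True by simp
    next
      case False
      then have "(e, g) \<in> E {}" using gB by simp
      then have "l2_inner M g g = 0"
        using pvm_inner_Int[OF pvm, of "{}" "{}" e g g] pvm_empty[OF pvm basis_L2[OF e]] by simp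
      then show ?thesis using False gL by (simp add: l2_inner_self_eq_0 l2_eq_def L2_zero)
    qed
  qed
  have coeff: "l2_inner M g e = indicator B (\<mu> e) * l2_inner M f e" if fg: "(f, g) \<in> E B" and e: "e \<in> S" for f g e
  proof -
    have L: "f \<in> L2 M" using pvm_L2[OF pvm B fg] by simp
    have "l2_inner M g e = l2_inner M f (l2_app (E B) e)"
      using pvm_symmetric[OF pvm B fg pvm_app[OF pvm B basis_L2[OF e]]] .
    also have "\<dots> = l2_inner M (\<lambda>x. indicator B (\<mu> e) * e x) f"
      using l2_eq_inner[OF app[OF e pvm_app[OF pvm B basis_L2[OF e]]] L] by (simp add: l2_inner_commute)
    finally show ?thesis by (simp add: l2_inner_left l2_inner_commute)
  qed
  show ?thesis
  proof (intro set_eqI iffI; clarify)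
    fix f g assume fg: "(f, g) \<in> E B"
    then show "(f, g) \<in> spectral_diag \<mu> B"
      using coeff[OF fg] pvm_L2[OF pvm B fg] by (simp add: diag_op_def)
  next
    fix f g assume fg: "(f, g) \<in> spectral_diag \<mu> B"
    then have f: "f \<in> L2 M" and g: "g \<in> L2 M" by (auto simp: diag_op_def)
    define g' where "g' = l2_app (E B) f"
    have fg': "(f, g') \<in> E B" unfolding g'_def by (rule pvm_app[OF pvm B f])
    then have g': "g' \<in> L2 M" using pvm_L2[OF pvm B] by blast
    have "AE x in M. g' x = g x"
      using g g' fg coeff[OF fg'] by (intro coeff_eq_imp_AE_eq) (auto simp: diag_op_def)
    then show "(f, g) \<in> E B"
      using pvm_cong[OF pvm B fg', of f g] f g g' by (simp add: l2_eq_def)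
  qed
qed

lemma borel_calculus_diag:
  assumes "\<phi> \<in> borel_measurable borel"
  shows "borel_calculus M (diag_op \<mu>) \<phi> = diag_op (\<lambda>e. \<phi> (\<mu> e))"
  unfolding borel_calculus_def
  using spectral_resolution_unique[OF someI[of "spectral_resolution M (diag_op \<mu>)", OF spectral_resolution_diag]]
  by (intro spectral_integral_diag assms)

lemma l2_powr_diag: "l2_powr M (diag_op \<mu>) r = diag_op (\<lambda>e. \<mu> e powr r)"
  unfolding l2_powr_def by (rule borel_calculus_diag) measurable

end

section \<open>Eigenbases of compact operators\<close>

lemma nonneg_tendsto_0:
  fixes a b :: "nat \<Rightarrow> real"
  assumes "\<And>n. 0 \<le> a n" "\<And>n. a n \<le> b n" "b \<longlonglongrightarrow> 0"
  shows "a \<longlonglongrightarrow> 0"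
  by (rule tendsto_sandwich[OF always_eventually always_eventually tendsto_const assms(3)])
    (simp_all add: assms(1,2))

text \<open>\<open>T\<close> acts on representatives. Its linearity is available in weak form
  through \<open>T_symmetric\<close>, by moving \<open>T\<close> onto the test vector.
  \<open>T_compact\<close> is sequential compactness on the unit ball.\<close>

locale l2_compact_operator = finite_measure M for M :: "'a measure" +
  fixes T :: "('a \<Rightarrow> real) \<Rightarrow> ('a \<Rightarrow> real)" and K :: real
  assumes T_L2: "f \<in> L2 M \<Longrightarrow> T f \<in> L2 M"
    and T_symmetric: "f \<in> L2 M \<Longrightarrow> g \<in> L2 M \<Longrightarrow> l2_inner M (T f) g = l2_inner M f (T g)"
    and T_nonneg: "f \<in> L2 M \<Longrightarrow> 0 \<le> l2_inner M (T f) f"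
    and T_norm_le: "f \<in> L2 M \<Longrightarrow> l2_norm M (T f) \<le> K * l2_norm M f"
    and T_compact: "(\<And>n. F n \<in> L2 M) \<Longrightarrow> (\<And>n. l2_norm M (F n) \<le> 1) \<Longrightarrow>
      \<exists>(r::nat \<Rightarrow> nat) g. strict_mono r \<and> g \<in> L2 M \<and> (\<lambda>n. l2_norm M (\<lambda>x. g x - T (F (r n)) x)) \<longlonglongrightarrow> 0"
begin

definition eigen :: "('a \<Rightarrow> real) \<Rightarrow> real \<Rightarrow> bool" where
  "eigen e \<kappa> \<longleftrightarrow> l2_inner M e e = 1 \<and> l2_eq M (T e) (\<lambda>x. \<kappa> * e x)"

lemma eq_if_inner_eq:
  assumes "f \<in> L2 M" "g \<in> L2 M" "\<And>h. h \<in> L2 M \<Longrightarrow> l2_inner M f h = l2_inner M g h"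
  shows "l2_eq M f g"
proof -
  have "l2_inner M (\<lambda>x. f x - g x) (\<lambda>x. f x - g x) = 0"
    using assms by (simp add: l2_inner_diff_left L2_diff)
  then show ?thesis using assms by (simp add: l2_inner_self_eq_0 L2_diff l2_eq_def)
qed

text \<open>\<open><T f, g>\<close> is a semi-inner product. Taken at \<open>g = T f\<close>, the
  inequality will bound the norm of \<open>T f\<close> by the quadratic form.\<close>

lemma T_form_Cauchy_Schwarz:
  assumes "f \<in> L2 M" "g \<in> L2 M"
  shows "(l2_inner M (T f) g)\<^sup>2 \<le> l2_inner M (T f) f * l2_inner M (T g) g"
proof (rule quadratic_nonneg_discriminant)
  fix t
  let ?h = "\<lambda>x. f x + t * g x"
  have h: "?h \<in> L2 M" using assms by (intro L2_add L2_scale)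
  have "0 \<le> l2_inner M (T ?h) ?h" by (rule T_nonneg[OF h])
  also have "\<dots> = l2_inner M (T ?h) f + t * l2_inner M (T ?h) g"
    using assms h by (simp add: l2_inner_add_right l2_inner_scale_right L2_scale T_L2)
  also have "\<dots> = l2_inner M ?h (T f) + t * l2_inner M ?h (T g)"
    using assms h by (simp add: T_symmetric)
  also have "\<dots> = l2_inner M f (T f) + t * l2_inner M g (T f) + t * (l2_inner M f (T g) + t * l2_inner M g (T g))"
    using assms by (simp add: l2_inner_add_left l2_inner_scale_left L2_scale T_L2)
  also have "l2_inner M f (T g) = l2_inner M (T f) g" using assms by (simp add: T_symmetric)
  also have "l2_inner M g (T f) = l2_inner M (T f) g" by (rule l2_inner_commute)
  also have "l2_inner M f (T f) = l2_inner M (T f) f" by (rule l2_inner_commute)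
  also have "l2_inner M g (T g) = l2_inner M (T g) g" by (rule l2_inner_commute)
  finally show "0 \<le> l2_inner M (T f) f + 2 * t * l2_inner M (T f) g + t\<^sup>2 * l2_inner M (T g) g"
    by (simp add: algebra_simps power2_eq_square)
qed (rule T_nonneg[OF assms(2)])

lemma T_form_scale:
  assumes "f \<in> L2 M" shows "l2_inner M (T (\<lambda>x. c * f x)) (\<lambda>x. c * f x) = c\<^sup>2 * l2_inner M (T f) f"
  using assms
  by (simp add: l2_inner_scale_right T_symmetric L2_scale l2_inner_scale_left power2_eq_square)

lemma T_form_le: "f \<in> L2 M \<Longrightarrow> l2_inner M (T f) f \<le> K * l2_inner M f f"
  using order_trans[OF abs_ge_self l2_inner_le_norm[OF T_L2, of f f]]
    mult_right_mono[OF T_norm_le l2_norm_nonneg, of f M f]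
  by (simp add: l2_norm_square[symmetric] power2_eq_square)

lemma eigen_normalize:
  assumes g: "g \<in> L2 M" "l2_inner M g g \<noteq> 0" "l2_eq M (T g) (\<lambda>x. \<kappa> * g x)"
  shows "eigen (\<lambda>x. (1 / l2_norm M g) * g x) \<kappa>"
proof -
  let ?c = "1 / l2_norm M g" and ?e = "\<lambda>x. (1 / l2_norm M g) * g x"
  have "?c * (?c * l2_inner M g g) = 1"
    using g(2) by (simp add: l2_norm_square[symmetric] power2_eq_square)
  then have "l2_inner M ?e ?e = 1"
    by (simp only: l2_inner_scale_left l2_inner_scale_right)
  moreover have "l2_eq M (T ?e) (\<lambda>x. \<kappa> * ?e x)"
  proof (rule eq_if_inner_eq)
    fix h assume h: "h \<in> L2 M"
    have "l2_inner M (T ?e) h = ?c * l2_inner M (T g) h"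
      using g h by (simp only: T_symmetric L2_scale l2_inner_scale_left)
    also have "l2_inner M (T g) h = \<kappa> * l2_inner M g h"
      using l2_inner_cong_AE[of "T g" M "\<lambda>x. \<kappa> * g x" h h] g h
      by (simp add: l2_eq_def l2_inner_scale_left)
    finally show "l2_inner M (T ?e) h = l2_inner M (\<lambda>x. \<kappa> * ?e x) h"
      by (simp only: l2_inner_scale_left mult.left_commute)
  qed (use g in \<open>(intro T_L2 L2_scale, simp)+\<close>)
  ultimately show ?thesis by (simp add: eigen_def)
qed

text \<open>On the \<open>T\<close>-invariant orthogonal complement of \<open>S\<close> the supremum
  \<sigma> of the quadratic form over the unit ball is an eigenvalue: along a maximizing sequence
  \<open>T f - \<sigma> * f\<close> tends to zero in norm, and compactness makes \<open>T f\<close>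
  converge along a subsequence. The vector \<open>f0\<close> certifies that the complement is
  nontrivial.\<close>

lemma eigen_orthogonal_exists:
  assumes S: "S \<subseteq> L2 M" "\<And>e. e \<in> S \<Longrightarrow> eigen e (\<nu> e)"
    and f0: "f0 \<in> L2 M" "\<And>e. e \<in> S \<Longrightarrow> l2_inner M f0 e = 0" "l2_inner M f0 f0 \<noteq> 0"
  shows "\<exists>e\<in>L2 M. (\<forall>e'\<in>S. l2_inner M e e' = 0) \<and> (\<exists>\<kappa>. eigen e \<kappa>)"
proof -
  define U where "U = {f \<in> L2 M. \<forall>e\<in>S. l2_inner M f e = 0}"
  have UL: "f \<in> L2 M" if "f \<in> U" for f using that by (simp add: U_def)
  have U_scale: "(\<lambda>x. c * f x) \<in> U" if "f \<in> U" for f c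
    using that by (simp add: U_def L2_scale l2_inner_scale_left)
  have TU: "T f \<in> U" if f: "f \<in> U" for f
  proof -
    have "l2_inner M (T f) e = 0" if e: "e \<in> S" for e
    proof -
      have eL: "e \<in> L2 M" using e S by blast
      have "l2_inner M (T f) e = l2_inner M f (T e)" by (rule T_symmetric[OF UL[OF f] eL])
      also have "\<dots> = l2_inner M f (\<lambda>x. \<nu> e * e x)"
        using S(2)[OF e] UL[OF f] by (intro l2_inner_cong_AE) (auto simp: eigen_def l2_eq_def)
      also have "\<dots> = 0" using f e by (simp add: l2_inner_scale_right U_def)
      finally show ?thesis .
    qed
    then show ?thesis using f by (simp add: U_def T_L2)
  qed
  \<comment> \<open>The ball instead of the sphere puts 0 into \<open>Q\<close>, so \<sigma> is
    nonnegative from the start.\<close>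
  define Q where "Q = (\<lambda>f. l2_inner M (T f) f) ` {f \<in> U. l2_inner M f f \<le> 1}"
  define \<sigma> where "\<sigma> = Sup Q"
  have Qb: "bdd_above Q"
  proof (rule bdd_aboveI[of _ "\<bar>K\<bar>"])
    fix q assume "q \<in> Q"
    then obtain f where f: "f \<in> U" "l2_inner M f f \<le> 1" "q = l2_inner M (T f) f" by (auto simp: Q_def)
    have "q \<le> K * l2_inner M f f" using f UL T_form_le by simp
    also have "\<dots> \<le> \<bar>K\<bar> * l2_inner M f f" by (intro mult_right_mono l2_inner_self_nonneg) simp
    also have "\<dots> \<le> \<bar>K\<bar> * 1" using f by (intro mult_left_mono) auto
    finally show "q \<le> \<bar>K\<bar>" by simp
  qed
  have zero_U: "(\<lambda>x. 0) \<in> U" by (simp add: U_def L2_zero l2_inner_zero_left)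
  have "l2_inner M (T (\<lambda>x. 0)) (\<lambda>x. 0) \<in> Q"
    unfolding Q_def using zero_U by (intro imageI) (simp add: l2_inner_zero_left)
  then have Q0: "0 \<in> Q" by (simp add: l2_inner_zero_right)
  have \<sigma>0: "0 \<le> \<sigma>" unfolding \<sigma>_def by (rule cSup_upper[OF Q0 Qb])
  have form_le: "l2_inner M (T f) f \<le> \<sigma> * l2_inner M f f" if f: "f \<in> U" for f
  proof (cases "l2_inner M f f = 0")
    case True
    then show ?thesis using T_form_le[OF UL[OF f]] by simp
  next
    case False
    then have pos: "0 < l2_inner M f f" using l2_inner_self_nonneg[of M f] by simp
    define c where "c = 1 / l2_norm M f"
    have c: "c\<^sup>2 * l2_inner M f f = 1"
      using False by (simp add: c_def power_divide l2_norm_square)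
    have "l2_inner M (T (\<lambda>x. c * f x)) (\<lambda>x. c * f x) \<in> Q"
      unfolding Q_def using U_scale[OF f, of c] c
      by (intro imageI) (simp add: l2_inner_scale_left l2_inner_scale_right power2_eq_square mult.assoc)
    then have "c\<^sup>2 * l2_inner M (T f) f \<le> \<sigma>"
      unfolding \<sigma>_def T_form_scale[OF UL[OF f]] by (rule cSup_upper[OF _ Qb])
    then have "l2_inner M f f * (c\<^sup>2 * l2_inner M (T f) f) \<le> l2_inner M f f * \<sigma>"
      using pos by (intro mult_left_mono) auto
    moreover have "l2_inner M f f * (c\<^sup>2 * l2_inner M (T f) f) = l2_inner M (T f) f"
      using c by (metis mult.assoc mult.commute mult.left_neutral)
    ultimately show ?thesis by (simp only: mult.commute[of \<sigma>])
  qed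
  \<comment> \<open>Cauchy-Schwarz for the form at \<open>g = T f\<close>, followed by the bound of
    the form at \<open>T f\<close>; one factor cancels.\<close>
  have T_square_le: "l2_inner M (T f) (T f) \<le> \<sigma> * l2_inner M (T f) f" if f: "f \<in> U" for f
  proof (cases "l2_inner M (T f) (T f) = 0")
    case True
    then show ?thesis using \<sigma>0 T_nonneg[OF UL[OF f]] by simp
  next
    case False
    then have pos: "0 < l2_inner M (T f) (T f)" using l2_inner_self_nonneg[of M "T f"] by simp
    have "(l2_inner M (T f) (T f))\<^sup>2 \<le> l2_inner M (T f) f * l2_inner M (T (T f)) (T f)"
      by (intro T_form_Cauchy_Schwarz UL f TU)
    also have "\<dots> \<le> l2_inner M (T f) f * (\<sigma> * l2_inner M (T f) (T f))"
      by (intro mult_left_mono form_le TU f T_nonneg UL)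
    finally have "l2_inner M (T f) (T f) * l2_inner M (T f) (T f)
        \<le> l2_inner M (T f) (T f) * (\<sigma> * l2_inner M (T f) f)"
      by (simp add: power2_eq_square mult_ac)
    then show ?thesis using pos by simp
  qed
  have "\<exists>g\<in>U. l2_inner M g g \<noteq> 0 \<and> l2_eq M (T g) (\<lambda>x. \<sigma> * g x)"
  proof (cases "\<sigma> = 0")
    case True
    \<comment> \<open>For \<sigma> = 0 the last estimate makes \<open>T\<close> vanish on the
      complement, so \<open>f0\<close> itself is an eigenvector.\<close>
    have f0U: "f0 \<in> U" using f0 by (simp add: U_def)
    have "l2_inner M (T f0) (T f0) = 0"
      using T_square_le[OF f0U] True l2_inner_self_nonneg[of M "T f0"] by simp
    then have "l2_eq M (T f0) (\<lambda>x. \<sigma> * f0 x)"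
      using f0 True by (simp add: l2_inner_self_eq_0 T_L2 l2_eq_def L2_zero)
    then show ?thesis using f0U f0 by blast
  next
    case False
    then have \<sigma>: "0 < \<sigma>" using \<sigma>0 by simp
    have "\<exists>f\<in>U. l2_inner M f f \<le> 1 \<and> \<sigma> - 1 / real (Suc n) < l2_inner M (T f) f" for n
    proof -
      have "\<exists>q\<in>Q. \<sigma> - 1 / real (Suc n) < q"
        unfolding \<sigma>_def by (rule less_cSupD) (use Q0 in auto)
      then show ?thesis by (auto simp: Q_def)
    qed
    then obtain F where F: "\<And>n. F n \<in> U" "\<And>n. l2_inner M (F n) (F n) \<le> 1"
      "\<And>n. \<sigma> - 1 / real (Suc n) < l2_inner M (T (F n)) (F n)" by metis
    have nF: "l2_norm M (F n) \<le> 1" for n using F(2)[of n] by (simp add: l2_norm_def)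
    obtain r :: "nat \<Rightarrow> nat" and g where r: "strict_mono r" and g: "g \<in> L2 M"
      and lim: "(\<lambda>n. l2_norm M (\<lambda>x. g x - T (F (r n)) x)) \<longlonglongrightarrow> 0"
      using T_compact[of F, OF UL[OF F(1)] nF] by blast
    define f where "f n = F (r n)" for n
    have fU: "f n \<in> U" and fL: "f n \<in> L2 M" and f1: "l2_inner M (f n) (f n) \<le> 1" for n
      using F UL by (auto simp: f_def)
    have Tf: "\<sigma> - 1 / real (Suc n) < l2_inner M (T (f n)) (f n)" for n
    proof -
      have "1 / real (Suc (r n)) \<le> 1 / real (Suc n)"
        using seq_suble[OF r, of n] by (intro divide_left_mono) auto
      then show ?thesis using F(3)[of "r n"] by (simp add: f_def)
    qed
    have dL: "(\<lambda>x. T (f n) x - \<sigma> * f n x) \<in> L2 M" for n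
      by (intro L2_diff L2_scale T_L2 fL)
    have "l2_norm M (\<lambda>x. T (f n) x - \<sigma> * f n x) \<le> sqrt (\<sigma> * (1 / real (Suc n)))" for n
    proof -
      \<comment> \<open>Expanding the square and applying \<open>T_square_le\<close> leaves \<sigma>
        times the defect of the maximizing sequence.\<close>
      have "l2_inner M (\<lambda>x. T (f n) x - \<sigma> * f n x) (\<lambda>x. T (f n) x - \<sigma> * f n x)
        = l2_inner M (T (f n)) (T (f n)) - 2 * \<sigma> * l2_inner M (T (f n)) (f n) + \<sigma>\<^sup>2 * l2_inner M (f n) (f n)"
        by (simp add: l2_inner_diff_left l2_inner_diff_right l2_inner_scale_left l2_inner_scale_right
            L2_diff L2_scale T_L2 fL l2_inner_commute[of M "f n" "T (f n)"] power2_eq_square algebra_simps)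
      also have "\<dots> \<le> \<sigma> * l2_inner M (T (f n)) (f n) - 2 * \<sigma> * l2_inner M (T (f n)) (f n) + \<sigma>\<^sup>2 * 1"
        using T_square_le[OF fU] f1 \<sigma>0 by (intro add_mono diff_mono mult_left_mono) auto
      also have "\<dots> = \<sigma> * (\<sigma> - l2_inner M (T (f n)) (f n))"
        by (simp add: power2_eq_square algebra_simps)
      also have "\<dots> \<le> \<sigma> * (1 / real (Suc n))"
        using Tf[of n] \<sigma> by (intro mult_left_mono) linarith+
      finally show ?thesis unfolding l2_norm_def by (rule real_sqrt_le_mono)
    qed
    moreover have "(\<lambda>n. sqrt (\<sigma> * (1 / real (Suc n)))) \<longlonglongrightarrow> 0"
      using tendsto_real_sqrt[OF tendsto_mult[OF tendsto_const[of \<sigma>]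
            LIMSEQ_inverse_real_of_nat[unfolded inverse_eq_divide]]]
      by (simp only: mult_zero_right real_sqrt_zero)
    ultimately have lim2: "(\<lambda>n. l2_norm M (\<lambda>x. T (f n) x - \<sigma> * f n x)) \<longlonglongrightarrow> 0"
      by (rule nonneg_tendsto_0[OF l2_norm_nonneg])
    have lim3: "(\<lambda>n. l2_norm M (\<lambda>x. g x - \<sigma> * f n x)) \<longlonglongrightarrow> 0"
    proof (rule nonneg_tendsto_0[OF l2_norm_nonneg])
      show "(\<lambda>n. l2_norm M (\<lambda>x. g x - T (f n) x) + l2_norm M (\<lambda>x. T (f n) x - \<sigma> * f n x)) \<longlonglongrightarrow> 0"
        using tendsto_add[OF lim lim2] by (simp add: f_def)
      show "l2_norm M (\<lambda>x. g x - \<sigma> * f n x)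
          \<le> l2_norm M (\<lambda>x. g x - T (f n) x) + l2_norm M (\<lambda>x. T (f n) x - \<sigma> * f n x)" for n
        using l2_norm_triangle[OF L2_diff[OF g T_L2[OF fL[of n]]] dL[of n]] by simp
    qed
    have sfL: "(\<lambda>x. \<sigma> * f n x) \<in> L2 M" for n by (intro L2_scale fL)
    have "l2_inner M g e = 0" if e: "e \<in> S" for e
    proof -
      have "e \<in> L2 M" using e S by blast
      from l2_inner_tendsto[OF sfL g this lim3] show ?thesis
        using fU e by (simp add: l2_inner_scale_left U_def LIMSEQ_const_iff)
    qed
    then have "g \<in> U" using g by (simp add: U_def)
    \<comment> \<open>Both \<open>T (f n)\<close> and \<open>\<sigma> * f n\<close> converge to
      \<open>g\<close>. Pairing one limit with \<open>h\<close> and the other with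
      \<open>T h\<close> gives the eigenvalue equation weakly.\<close>
    moreover have "l2_eq M (T g) (\<lambda>x. \<sigma> * g x)"
    proof (rule eq_if_inner_eq)
      fix h assume h: "h \<in> L2 M"
      have "(\<lambda>n. l2_inner M (\<lambda>x. \<sigma> * f n x) (T h)) \<longlonglongrightarrow> l2_inner M g (T h)"
        by (rule l2_inner_tendsto[OF sfL g T_L2[OF h] lim3])
      then have "(\<lambda>n. \<sigma> * l2_inner M (T (f n)) h) \<longlonglongrightarrow> l2_inner M g (T h)"
        by (simp add: l2_inner_scale_left T_symmetric fL h)
      moreover have "(\<lambda>n. \<sigma> * l2_inner M (T (f n)) h) \<longlonglongrightarrow> \<sigma> * l2_inner M g h"
        using lim by (intro tendsto_mult tendsto_const l2_inner_tendsto T_L2 fL g h) (simp add: f_def)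
      ultimately have "l2_inner M g (T h) = \<sigma> * l2_inner M g h"
        by (rule LIMSEQ_unique)
      then show "l2_inner M (T g) h = l2_inner M (\<lambda>x. \<sigma> * g x) h"
        by (simp add: T_symmetric g h l2_inner_scale_left)
    qed (auto intro!: T_L2 L2_scale g)
    \<comment> \<open>On the unit ball \<open><T f, f>\<close> is at most the norm of
      \<open>T f\<close>, so the limit has norm at least \<sigma> > 0.\<close>
    moreover have "l2_inner M g g \<noteq> 0"
    proof -
      have low: "\<sigma> - 1 / real (Suc n) \<le> l2_norm M (T (f n))" for n
      proof -
        have "l2_norm M (f n) \<le> 1" using nF by (simp add: f_def)
        then have "l2_norm M (T (f n)) * l2_norm M (f n) \<le> l2_norm M (T (f n)) * 1"
          by (intro mult_left_mono l2_norm_nonneg)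
        then show ?thesis
          using Tf[of n] l2_inner_le_norm[OF T_L2[OF fL] fL, of n n] by simp
      qed
      have "(\<lambda>n. l2_norm M (T (f n))) \<longlonglongrightarrow> l2_norm M g"
        using lim by (intro l2_norm_tendsto T_L2 fL g) (simp add: f_def)
      moreover have "(\<lambda>n. \<sigma> - 1 / real (Suc n)) \<longlonglongrightarrow> \<sigma> - 0"
        by (intro tendsto_diff tendsto_const LIMSEQ_inverse_real_of_nat[unfolded inverse_eq_divide])
      ultimately have "\<sigma> - 0 \<le> l2_norm M g"
        using low by (intro LIMSEQ_le[of _ _ _ "l2_norm M g"]) auto
      then have "l2_norm M g \<noteq> 0" using \<sigma> by simp
      then show ?thesis by (simp add: l2_norm_def)
    qed
    ultimately show ?thesis by blast
  qed
  then obtain g where g: "g \<in> U" "l2_inner M g g \<noteq> 0" "l2_eq M (T g) (\<lambda>x. \<sigma> * g x)" by blast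
  let ?e = "\<lambda>x. (1 / l2_norm M g) * g x"
  have e: "eigen ?e \<sigma>" by (rule eigen_normalize[OF UL[OF g(1)] g(2,3)])
  have eU: "?e \<in> L2 M \<and> (\<forall>e'\<in>S. l2_inner M ?e e' = 0)"
    using U_scale[OF g(1), of "1 / l2_norm M g"] unfolding U_def mem_Collect_eq .
  show ?thesis
    by (rule bexI[where x = ?e], rule conjI[OF eU[THEN conjunct2] exI[of "eigen ?e", OF e]],
        rule eU[THEN conjunct1])
qed

text \<open>A maximal orthonormal set of eigenvectors is complete: otherwise its complement would
  contain a further one. Writing the eigenvalue as \<open><T e, e>\<close> avoids carrying a chosen
  function along.\<close>

theorem eigenbasis_exists:
  "\<exists>S. l2_orthonormal_basis M S \<and> (\<forall>e\<in>S. l2_eq M (T e) (\<lambda>x. l2_inner M (T e) e * e x))"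
proof -
  define \<A> where "\<A> = {S. S \<subseteq> L2 M \<and> (\<forall>e\<in>S. \<exists>\<kappa>. eigen e \<kappa>) \<and>
    (\<forall>e\<in>S. \<forall>e'\<in>S. e \<noteq> e' \<longrightarrow> l2_inner M e e' = 0)}"
  have "\<exists>S\<in>\<A>. \<forall>X\<in>\<A>. S \<subseteq> X \<longrightarrow> X = S"
  proof (rule subset_Zorn_nonempty)
    have "{} \<in> \<A>" by (simp add: \<A>_def)
    then show "\<A> \<noteq> {}" by blast
  next
    fix C assume C: "C \<noteq> {}" "subset.chain \<A> C"
    then have CA: "C \<subseteq> \<A>" and ch: "\<And>X Y. X \<in> C \<Longrightarrow> Y \<in> C \<Longrightarrow> X \<subseteq> Y \<or> Y \<subseteq> X"
      by (auto simp: subset_chain_def)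
    have orthC: "l2_inner M e e' = 0" if asm: "X \<in> C" "e \<in> X" "Y \<in> C" "e' \<in> Y" "e \<noteq> e'" for e e' X Y
    proof -
      obtain Z where "Z \<in> C" "e \<in> Z" "e' \<in> Z" using ch[OF asm(1,3)] asm by blast
      then show ?thesis using subsetD[OF CA, of Z] asm(5) by (simp add: \<A>_def)
    qed
    have "\<forall>e\<in>\<Union>C. \<forall>e'\<in>\<Union>C. e \<noteq> e' \<longrightarrow> l2_inner M e e' = 0"
    proof (intro ballI impI)
      fix e e' assume "e \<in> \<Union>C" "e' \<in> \<Union>C" and ne: "e \<noteq> e'"
      then obtain X Y where "e \<in> X" "X \<in> C" "e' \<in> Y" "Y \<in> C" by (elim UnionE)
      then show "l2_inner M e e' = 0" using orthC[of X e Y e'] ne by simp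
    qed
    moreover have CA': "X \<subseteq> L2 M" "\<forall>e\<in>X. \<exists>\<kappa>. eigen e \<kappa>" if "X \<in> C" for X
      using subsetD[OF CA that] by (simp_all add: \<A>_def)
    then have "\<Union>C \<subseteq> L2 M" by (intro Union_least)
    moreover have "\<forall>e\<in>\<Union>C. \<exists>\<kappa>. eigen e \<kappa>"
    proof
      fix e assume "e \<in> \<Union>C"
      then obtain X where "e \<in> X" "X \<in> C" by (elim UnionE)
      then show "\<exists>\<kappa>. eigen e \<kappa>" using CA'(2)[of X] by simp
    qed
    ultimately show "\<Union>C \<in> \<A>" unfolding \<A>_def mem_Collect_eq by (intro conjI)
  qed
  then obtain S where S: "S \<in> \<A>" and max: "\<And>X. X \<in> \<A> \<Longrightarrow> S \<subseteq> X \<Longrightarrow> X = S" by blast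
  have SL: "S \<subseteq> L2 M" and orth: "\<And>e e'. e \<in> S \<Longrightarrow> e' \<in> S \<Longrightarrow> e \<noteq> e' \<Longrightarrow> l2_inner M e e' = 0"
    using S by (simp_all add: \<A>_def)
  have "\<forall>e\<in>S. \<exists>\<kappa>. eigen e \<kappa>" using S by (simp add: \<A>_def)
  then obtain \<nu> where \<nu>: "\<And>e. e \<in> S \<Longrightarrow> eigen e (\<nu> e)" by metis
  have complete: "AE x in M. f x = 0" if f: "f \<in> L2 M" "\<forall>e\<in>S. l2_inner M f e = 0" for f
  proof (rule ccontr)
    assume "\<not> (AE x in M. f x = 0)"
    then have "l2_inner M f f \<noteq> 0" using f by (simp add: l2_inner_self_eq_0)
    then obtain e \<kappa> where e: "e \<in> L2 M" "\<forall>e'\<in>S. l2_inner M e e' = 0" "eigen e \<kappa>"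
      using eigen_orthogonal_exists[OF SL \<nu> f(1)] f(2) by blast
    have "\<forall>a\<in>insert e S. \<forall>b\<in>insert e S. a \<noteq> b \<longrightarrow> l2_inner M a b = 0"
    proof (intro ballI impI)
      fix a b assume "a \<in> insert e S" "b \<in> insert e S" "a \<noteq> b"
      then show "l2_inner M a b = 0"
        using e(2) orth[of a b] l2_inner_commute[of M a b] by (elim insertE) simp_all
    qed
    moreover have "insert e S \<subseteq> L2 M" using e(1) SL by blast
    moreover have "\<forall>a\<in>insert e S. \<exists>\<kappa>. eigen a \<kappa>" using e(3) \<nu> by blast
    ultimately have "insert e S \<in> \<A>"
      unfolding \<A>_def mem_Collect_eq by (intro conjI)
    then have "e \<in> S" using max[of "insert e S"] by blast
    then show False using e by (auto simp: eigen_def)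
  qed
  have ev: "l2_inner M (T e) e = \<nu> e" if e: "e \<in> S" for e
  proof -
    have eL: "e \<in> L2 M" using e SL by blast
    have "l2_inner M (T e) e = l2_inner M (\<lambda>x. \<nu> e * e x) e"
      using \<nu>[OF e] eL by (intro l2_inner_cong_AE) (auto simp: eigen_def l2_eq_def)
    also have "\<dots> = \<nu> e" using \<nu>[OF e] by (simp add: l2_inner_scale_left eigen_def)
    finally show ?thesis .
  qed
  have "l2_orthonormal_basis M S"
    unfolding l2_orthonormal_basis_def
    using SL orth complete \<nu> by (auto simp: eigen_def l2_norm_def)
  moreover have "l2_eq M (T e) (\<lambda>x. l2_inner M (T e) e * e x)" if "e \<in> S" for e
    using \<nu>[OF that] ev[OF that] by (simp add: eigen_def)
  ultimately show ?thesis by blast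
qed

end

section \<open>The Green operator\<close>

lemma (in finite_measure) l2_norm_le_bound:
  assumes "f \<in> borel_measurable M" "\<And>x. x \<in> space M \<Longrightarrow> \<bar>f x\<bar> \<le> B" "0 \<le> B"
  shows "l2_norm M f \<le> B * sqrt (measure M (space M))"
proof -
  have "l2_inner M f f \<le> (\<integral>x. B\<^sup>2 \<partial>M)"
    unfolding l2_inner_def
  proof (rule integral_mono)
    show "integrable M (\<lambda>x. f x * f x)"
      using L2_bounded[OF assms(1,2)] by (intro L2_mult_integrable)
    show "f x * f x \<le> B\<^sup>2" if "x \<in> space M" for x
      using power_mono[OF assms(2)[OF that], of 2] by (simp add: power2_eq_square)
  qed simp
  then have "l2_norm M f \<le> sqrt (B\<^sup>2 * measure M (space M))"
    unfolding l2_norm_def by (intro real_sqrt_le_mono) (simp add: mult.commute)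
  then show ?thesis using assms(3) by (simp add: real_sqrt_mult)
qed

locale WV_functions =
  fixes W V :: "real \<Rightarrow> real"
  assumes W_mono: "strict_mono W" and V_mono: "strict_mono V"
    and W_right: "continuous (at_right x) W" and V_left: "continuous (at_left x) V"
    and V_cont: "isCont V 0" and W0: "W 0 = 0" and V0: "V 0 = 0"
begin

abbreviation "M \<equiv> torus_measure V"
abbreviation "N \<equiv> restrict_space (interval_measure W) {0<..1}"

lemma W_le: "x \<le> y \<Longrightarrow> W x \<le> W y"
  using W_mono by (simp add: strict_mono_less_eq)

lemma W1: "0 < W 1"
  using strict_monoD[OF W_mono, of 0 1] W0 by simp

lemma V_le: "x \<le> y \<Longrightarrow> V x \<le> V y"
  using V_mono by (simp add: strict_mono_less_eq)

lemma emeasure_W: "a \<le> b \<Longrightarrow> emeasure (interval_measure W) {a<..b} = W b - W a"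
  by (rule emeasure_interval_measure_Ioc[OF _ W_le W_right])

lemma emeasure_V: "a \<le> b \<Longrightarrow> emeasure (interval_measure_left V) {a..<b} = V b - V a"
  by (rule emeasure_interval_measure_left_Ico[OF _ V_le V_left])

lemma sets_left [simp, measurable_cong]: "sets (interval_measure_left V) = sets borel"
  by (simp add: interval_measure_left_def)

lemma space_left [simp]: "space (interval_measure_left V) = UNIV"
  by (simp add: interval_measure_left_def)

lemma space_M [simp]: "space M = {0..<1}"
  by (simp add: torus_measure_def space_restrict_space)

lemma space_N [simp]: "space N = {0<..1}"
  by (simp add: space_restrict_space)

lemma emeasure_M: "A \<in> sets borel \<Longrightarrow> A \<subseteq> {0..<1} \<Longrightarrow> emeasure M A = emeasure (interval_measure_left V) A"
  unfolding torus_measure_def by (rule emeasure_restrict_space) auto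

lemma emeasure_N: "0 \<le> a \<Longrightarrow> a \<le> b \<Longrightarrow> b \<le> 1 \<Longrightarrow> emeasure N {a<..b} = W b - W a"
  by (subst emeasure_restrict_space) (auto simp: emeasure_W)

lemma id_M [measurable]: "(\<lambda>x. x) \<in> borel_measurable M"
  unfolding torus_measure_def by (rule measurable_restrict_space1) simp

lemma id_N [measurable]: "(\<lambda>x. x) \<in> borel_measurable N"
  by (rule measurable_restrict_space1) (simp add: measurable_cong_sets[of "interval_measure W" borel])

sublocale M: finite_measure M
  by (rule finite_measureI) (simp add: emeasure_M emeasure_V)

sublocale N: finite_measure N
  by (rule finite_measureI) (simp add: emeasure_N)

sublocale NM: pair_sigma_finite N M ..

lemma measure_N: "measure N {0<..1} = W 1"
  using emeasure_N[of 0 1] W1 by (simp add: measure_def W0)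

text \<open>Continuity of \<open>V\<close> at 0 excludes an atom there. Tail integrals at positive
  points do not see 0, and this closes the gap in \<open>green_strict\<close>.\<close>

lemma AE_M_nonzero: "AE x in M. x \<noteq> 0"
proof -
  have "emeasure M {0} \<le> ennreal (V (1 / real (Suc (Suc n))))" for n
  proof -
    have "emeasure M {0} \<le> emeasure M {0..<1 / real (Suc (Suc n))}"
      unfolding torus_measure_def by (rule emeasure_mono) (auto simp: sets_restrict_space_iff)
    also have "\<dots> = ennreal (V (1 / real (Suc (Suc n))))"
      by (subst emeasure_M) (auto simp: emeasure_V V0)
    finally show ?thesis .
  qed
  moreover have "(\<lambda>n. ennreal (V (1 / real (Suc (Suc n))))) \<longlonglongrightarrow> ennreal (V 0)"
  proof -
    have "(\<lambda>n. 1 / real (Suc (Suc n))) \<longlonglongrightarrow> 0"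
      using LIMSEQ_Suc[OF LIMSEQ_inverse_real_of_nat[unfolded inverse_eq_divide]] .
    then show ?thesis
      by (intro tendsto_ennrealI isCont_tendsto_compose[OF V_cont])
  qed
  ultimately have "emeasure M {0} \<le> ennreal (V 0)"
    by (intro LIMSEQ_le_const) auto
  then have "emeasure M {0} = 0" by (simp add: V0)
  then show ?thesis
    by (intro AE_I[of _ _ "{0}"]) (auto simp: torus_measure_def sets_restrict_space_iff)
qed

text \<open>\<open>tail g y\<close> is \<open>\<integral>\<^bsub>[y,1)\<^esub> g dV\<close>; after subtracting its \<open>dW\<close>-mean it is the \<open>W\<close>-derivative
  of \<open>green g\<close>, the solution of the Dirichlet problem with right-hand side \<open>g\<close>.\<close>

definition tail :: "(real \<Rightarrow> real) \<Rightarrow> real \<Rightarrow> real" where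
  "tail g y = (\<integral>s. (if y \<le> s then g s else 0) \<partial>M)"

definition tail_mean :: "(real \<Rightarrow> real) \<Rightarrow> real" where
  "tail_mean g = (\<integral>y. tail g y \<partial>N) / W 1"

definition green :: "(real \<Rightarrow> real) \<Rightarrow> real \<Rightarrow> real" where
  "green g x = (\<integral>y. (if y \<le> x then tail g y - tail_mean g else 0) \<partial>N)"

lemma tail_integrable:
  assumes g: "g \<in> L2 M" shows "integrable M (\<lambda>s. if y \<le> s then g s else 0)"
proof (rule Bochner_Integration.integrable_bound[OF M.L2_integrable[OF g]])
  note [measurable] = L2_measurable[OF g]
  show "(\<lambda>s. if y \<le> s then g s else 0) \<in> borel_measurable M" by measurable
qed auto

lemma tail_bound:
  assumes g: "g \<in> L2 M" shows "\<bar>tail g y\<bar> \<le> (\<integral>s. \<bar>g s\<bar> \<partial>M)"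
  unfolding tail_def
  by (rule order_trans[OF integral_abs_bound integral_mono])
    (use tail_integrable[OF g] M.L2_integrable[OF g] in auto)

lemma tail_measurable:
  assumes g: "g \<in> L2 M" shows "tail g \<in> borel_measurable N"
proof -
  note [measurable] = L2_measurable[OF g]
  show ?thesis unfolding tail_def[abs_def] by measurable
qed

lemma integrable_N_bounded:
  fixes u :: "real \<Rightarrow> real"
  assumes "u \<in> borel_measurable N" "\<And>y. \<bar>u y\<bar> \<le> B"
  shows "integrable N u"
  by (rule N.integrable_const_bound[of _ B]) (use assms in auto)

lemma tail_mean_bound:
  assumes g: "g \<in> L2 M" shows "\<bar>tail_mean g\<bar> \<le> (\<integral>s. \<bar>g s\<bar> \<partial>M)"
proof -
  have "\<bar>\<integral>y. tail g y \<partial>N\<bar> \<le> (\<integral>y. \<bar>tail g y\<bar> \<partial>N)" by (rule integral_abs_bound)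
  also have "\<dots> \<le> (\<integral>y. (\<integral>s. \<bar>g s\<bar> \<partial>M) \<partial>N)"
  proof (rule integral_mono)
    show "integrable N (\<lambda>y. \<bar>tail g y\<bar>)"
      using integrable_N_bounded[OF tail_measurable[OF g] tail_bound[OF g]] by simp
  qed (auto simp: tail_bound[OF g])
  also have "\<dots> = W 1 * (\<integral>s. \<bar>g s\<bar> \<partial>M)" by (simp add: measure_N)
  finally show ?thesis using W1 by (simp add: tail_mean_def divide_le_eq mult.commute abs_divide)
qed

lemma tail_centered:
  assumes g: "g \<in> L2 M"
  shows "integrable N (\<lambda>y. tail g y - tail_mean g)" and "(\<integral>y. tail g y - tail_mean g \<partial>N) = 0"
proof -
  have "integrable N (tail g)" by (rule integrable_N_bounded[OF tail_measurable[OF g] tail_bound[OF g]])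
  then show "integrable N (\<lambda>y. tail g y - tail_mean g)" and "(\<integral>y. tail g y - tail_mean g \<partial>N) = 0"
    using W1 by (simp_all add: measure_N tail_mean_def)
qed

text \<open>Both sides are the double integral of \<open>u y * g x\<close> over
  \<open>y \<le> x\<close>: integration up to \<open>x\<close> against \<open>dW\<close> is adjoint
  to the tail integral against \<open>dV\<close>.\<close>

lemma Fubini_tail:
  assumes u[measurable]: "u \<in> borel_measurable N" and B: "\<And>y. \<bar>u y\<bar> \<le> B" and g: "g \<in> L2 M"
  shows "(\<integral>x. g x * (\<integral>y. (if y \<le> x then u y else 0) \<partial>N) \<partial>M) = (\<integral>y. u y * tail g y \<partial>N)"
proof -
  note [measurable] = L2_measurable[OF g]
  define f where "f y x = (if y \<le> x then u y * g x else 0)" for y x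
  have fm[measurable]: "(\<lambda>(y, x). f y x) \<in> borel_measurable (N \<Otimes>\<^sub>M M)"
    unfolding f_def by measurable
  have B0: "0 \<le> B" using B[of 0] by linarith
  have f_eq: "f y x = u y * (if y \<le> x then g x else 0)" for y x by (simp add: f_def)
  have int: "integrable M (f y)" for y
    unfolding f_eq using tail_integrable[OF g] by simp
  have "integrable (N \<Otimes>\<^sub>M M) (\<lambda>(y, x). f y x)"
  proof (rule NM.Fubini_integrable)
    show "integrable N (\<lambda>y. \<integral>x. norm (case (y, x) of (y, x) \<Rightarrow> f y x) \<partial>M)"
    proof (rule integrable_N_bounded[where B = "B * (\<integral>x. \<bar>g x\<bar> \<partial>M)"])
      fix y
      have "\<bar>\<integral>x. \<bar>f y x\<bar> \<partial>M\<bar> = (\<integral>x. \<bar>f y x\<bar> \<partial>M)" by simp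
      also have "\<dots> \<le> (\<integral>x. B * \<bar>g x\<bar> \<partial>M)"
      proof (rule integral_mono)
        show "\<bar>f y x\<bar> \<le> B * \<bar>g x\<bar>" for x
          using B[of y] B0 by (auto simp: f_def abs_mult intro: mult_right_mono)
      qed (use int[of y] M.L2_integrable[OF g] in auto)
      finally show "\<bar>\<integral>x. norm (case (y, x) of (y, x) \<Rightarrow> f y x) \<partial>M\<bar> \<le> B * (\<integral>x. \<bar>g x\<bar> \<partial>M)" by simp
    qed (simp, measurable)
  qed (auto simp: int)
  from NM.Fubini_integral[OF this]
  have "(\<integral>x. (\<integral>y. f y x \<partial>N) \<partial>M) = (\<integral>y. (\<integral>x. f y x \<partial>M) \<partial>N)" by simp
  moreover have "(\<integral>y. f y x \<partial>N) = g x * (\<integral>y. (if y \<le> x then u y else 0) \<partial>N)" for x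
    by (subst integral_mult_right_zero[symmetric], intro Bochner_Integration.integral_cong)
      (auto simp: f_def)
  moreover have "(\<integral>x. f y x \<partial>M) = u y * tail g y" for y
    unfolding f_eq tail_def by simp
  ultimately show ?thesis by simp
qed

lemma green_bound:
  assumes g: "g \<in> L2 M" shows "\<bar>green g x\<bar> \<le> W 1 * (2 * (\<integral>s. \<bar>g s\<bar> \<partial>M))"
proof -
  let ?B = "2 * (\<integral>s. \<bar>g s\<bar> \<partial>M)"
  have b: "\<bar>tail g y - tail_mean g\<bar> \<le> ?B" for y
    using tail_bound[OF g, of y] tail_mean_bound[OF g] by linarith
  have B0: "0 \<le> ?B" by simp
  note [measurable] = tail_measurable[OF g]
  have b': "\<bar>if y \<le> x then tail g y - tail_mean g else 0\<bar> \<le> ?B" for y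
    using b[of y] B0 by auto
  have "integrable N (\<lambda>y. if y \<le> x then tail g y - tail_mean g else 0)"
    by (rule integrable_N_bounded[OF _ b']) measurable
  then have "\<bar>green g x\<bar> \<le> (\<integral>y. ?B \<partial>N)"
    unfolding green_def using b'
    by (intro order_trans[OF integral_abs_bound integral_mono]) auto
  then show ?thesis by (simp add: measure_N)
qed

lemma green_measurable:
  assumes g: "g \<in> L2 M" shows "green g \<in> borel_measurable M"
proof -
  note [measurable] = tail_measurable[OF g]
  show ?thesis unfolding green_def[abs_def] by measurable
qed

lemma green_L2: "g \<in> L2 M \<Longrightarrow> green g \<in> L2 M"
  by (rule M.L2_bounded[OF green_measurable green_bound])

lemma green_uminus: "green (\<lambda>x. - g x) x = - green g x"
proof -
  have "tail (\<lambda>x. - g x) y = - tail g y" for y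
    unfolding tail_def
    by (subst Bochner_Integration.integral_minus[symmetric], intro Bochner_Integration.integral_cong) auto
  then have t: "tail (\<lambda>x. - g x) = (\<lambda>y. - tail g y)" by auto
  have m: "tail_mean (\<lambda>x. - g x) = - tail_mean g" by (simp add: tail_mean_def t)
  show ?thesis
    unfolding green_def t m
    by (subst Bochner_Integration.integral_minus[symmetric], intro Bochner_Integration.integral_cong) auto
qed

lemma green_inner:
  assumes f: "f \<in> L2 M" and h: "h \<in> L2 M"
  shows "l2_inner M (green f) h = (\<integral>y. (tail f y - tail_mean f) * (tail h y - tail_mean h) \<partial>N)"
proof -
  let ?u = "\<lambda>y. tail f y - tail_mean f"
  note [measurable] = tail_measurable[OF f] tail_measurable[OF h]
  have b: "\<bar>?u y\<bar> \<le> 2 * (\<integral>s. \<bar>f s\<bar> \<partial>M)" for y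
    using tail_bound[OF f, of y] tail_mean_bound[OF f] by linarith
  have "l2_inner M (green f) h = (\<integral>y. ?u y * tail h y \<partial>N)"
    unfolding l2_inner_def green_def
    by (subst Fubini_tail[symmetric, OF _ b h]) (auto simp: mult.commute)
  \<comment> \<open>The centered tail of \<open>f\<close> has \<open>dW\<close>-mean zero, so the
    mean of the other tail can be subtracted at no cost; this makes the expression
    symmetric.\<close>
  also have "\<dots> = (\<integral>y. ?u y * tail h y \<partial>N) - tail_mean h * (\<integral>y. ?u y \<partial>N)"
    by (simp add: tail_centered[OF f])
  also have "\<dots> = (\<integral>y. ?u y * (tail h y - tail_mean h) \<partial>N)"
  proof -
    have "\<bar>?u y * tail h y\<bar> \<le> 2 * (\<integral>s. \<bar>f s\<bar> \<partial>M) * (\<integral>s. \<bar>h s\<bar> \<partial>M)" for y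
      unfolding abs_mult by (intro mult_mono b tail_bound h) auto
    then have "integrable N (\<lambda>y. ?u y * tail h y)"
      by (rule integrable_N_bounded[rotated]) measurable
    then have "(\<integral>y. ?u y * tail h y \<partial>N) - (\<integral>y. tail_mean h * ?u y \<partial>N) = (\<integral>y. ?u y * tail h y - tail_mean h * ?u y \<partial>N)"
      using tail_centered(1)[OF f] by (intro Bochner_Integration.integral_diff[symmetric] integrable_mult_right)
    also have "\<dots> = (\<integral>y. ?u y * (tail h y - tail_mean h) \<partial>N)"
      by (intro Bochner_Integration.integral_cong refl) (simp add: right_diff_distrib mult.commute)
    finally show ?thesis by (simp only: integral_mult_right_zero)
  qed
  finally show ?thesis .
qed

lemma green_symmetric: "f \<in> L2 M \<Longrightarrow> g \<in> L2 M \<Longrightarrow> l2_inner M (green f) g = l2_inner M f (green g)"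
  by (subst l2_inner_commute[of M f]) (simp add: green_inner mult.commute)

lemma green_nonneg: "f \<in> L2 M \<Longrightarrow> 0 \<le> l2_inner M (green f) f"
  by (simp add: green_inner)

lemma green_norm_le:
  assumes g: "g \<in> L2 M"
  shows "l2_norm M (green g) \<le> (2 * W 1 * measure M (space M)) * l2_norm M g"
proof -
  define m where "m = measure M (space M)"
  have "l2_norm M (green g) \<le> W 1 * (2 * (\<integral>s. \<bar>g s\<bar> \<partial>M)) * sqrt m"
    unfolding m_def using W1 by (intro M.l2_norm_le_bound green_measurable[OF g] green_bound[OF g]) auto
  also have "\<dots> \<le> W 1 * (2 * (sqrt m * l2_norm M g)) * sqrt m"
    using M.L2_L1_bound[OF g] W1 unfolding m_def
    by (intro mult_right_mono mult_left_mono) auto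
  also have "\<dots> = 2 * W 1 * (sqrt m * sqrt m) * l2_norm M g" by (simp only: mult_ac)
  also have "sqrt m * sqrt m = m" by (simp add: m_def)
  finally show ?thesis by (simp add: m_def)
qed

section \<open>Strict positivity of the Green operator\<close>

lemma tail_left_continuous:
  assumes g: "g \<in> L2 M" and z: "z \<longlonglongrightarrow> y" "\<And>n. z n \<le> y"
  shows "(\<lambda>n. tail g (z n)) \<longlonglongrightarrow> tail g y"
  unfolding tail_def
proof (rule integral_dominated_convergence[where w = "\<lambda>s. \<bar>g s\<bar>"])
  show "integrable M (\<lambda>s. \<bar>g s\<bar>)" using M.L2_integrable[OF g] by simp
  show "AE s in M. (\<lambda>n. if z n \<le> s then g s else 0) \<longlonglongrightarrow> (if y \<le> s then g s else 0)"
  proof (intro AE_I2)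
    fix s
    show "(\<lambda>n. if z n \<le> s then g s else 0) \<longlonglongrightarrow> (if y \<le> s then g s else 0)"
    proof (cases "y \<le> s")
      case True
      have "z n \<le> s" for n using z(2)[of n] True by linarith
      then show ?thesis using True by simp
    next
      case False
      then have "\<forall>\<^sub>F n in sequentially. s < z n" using order_tendstoD(1)[OF z(1)] by simp
      then have "\<forall>\<^sub>F n in sequentially. (if z n \<le> s then g s else 0) = 0" by eventually_elim simp
      then show ?thesis using False by (simp add: tendsto_eventually)
    qed
  qed
qed (use tail_integrable[OF g] in auto)

text \<open>The positive and negative parts of \<open>f\<close> give finite measures with equal mass
  on all open rays. Rays determine a Borel measure on the line, hence the detour through
  \<open>d\<close>; uniqueness of densities then equates the two parts.\<close>

lemma integral_greaterThan_eq_0_imp_AE: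
  assumes f: "f \<in> L2 M" and zero: "\<And>x. (\<integral>s. (if x < s then f s else 0) \<partial>M) = 0"
  shows "AE s in M. f s = 0"
proof -
  note [measurable] = L2_measurable[OF f]
  define p where "p g = density M (\<lambda>s. ennreal (max 0 (g s)))" for g :: "real \<Rightarrow> real"
  define d where "d g = distr (p g) borel (\<lambda>x. x)" for g
  have em: "emeasure (d g) {x<..} = ennreal (\<integral>s. (if x < s then max 0 (g s) else 0) \<partial>M)"
    and int: "integrable M (\<lambda>s. if x < s then max 0 (g s) else 0)"
    if g: "g \<in> L2 M" for g x
  proof -
    note [measurable] = L2_measurable[OF g]
    show int: "integrable M (\<lambda>s. if x < s then max 0 (g s) else 0)"
      by (rule Bochner_Integration.integrable_bound[OF M.L2_integrable[OF g]]) auto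
    have "emeasure (d g) {x<..} = emeasure (p g) ({x<..} \<inter> {0..<1})"
      unfolding d_def by (subst emeasure_distr) (auto simp: p_def)
    also have "\<dots> = (\<integral>\<^sup>+s. ennreal (max 0 (g s)) * indicator ({x<..} \<inter> {0..<1}) s \<partial>M)"
      unfolding p_def
    proof (rule emeasure_density)
      show "{x<..} \<inter> {0..<1} \<in> sets M" by (simp add: torus_measure_def sets_restrict_space_iff)
    qed measurable
    also have "\<dots> = (\<integral>\<^sup>+s. ennreal (if x < s then max 0 (g s) else 0) \<partial>M)"
      by (intro nn_integral_cong) (auto simp: indicator_def)
    also have "\<dots> = ennreal (\<integral>s. (if x < s then max 0 (g s) else 0) \<partial>M)"
      using int by (intro nn_integral_eq_integral) auto
    finally show "emeasure (d g) {x<..} = ennreal (\<integral>s. (if x < s then max 0 (g s) else 0) \<partial>M)" .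
  qed
  have mf: "(\<lambda>s. - f s) \<in> L2 M" by (rule L2_uminus[OF f])
  have "d f = d (\<lambda>s. - f s)"
  proof (rule measure_eqI_lessThan)
    fix x
    have "(\<integral>s. (if x < s then max 0 (f s) else 0) \<partial>M) - (\<integral>s. (if x < s then max 0 (- f s) else 0) \<partial>M)
      = (\<integral>s. (if x < s then f s else 0) \<partial>M)"
      by (subst Bochner_Integration.integral_diff[symmetric])
        (auto intro!: int[OF f] int[OF mf] Bochner_Integration.integral_cong)
    then show "emeasure (d f) {x<..} = emeasure (d (\<lambda>s. - f s)) {x<..}"
      by (simp add: em[OF f] em[OF mf] zero)
    show "emeasure (d f) {x<..} < \<infinity>" by (simp add: em[OF f])
  qed (auto simp: d_def)
  have "p f = p (\<lambda>s. - f s)"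
  proof (rule measure_eqI)
    fix A assume "A \<in> sets (p f)"
    then have A: "A \<in> sets borel" "A \<subseteq> {0..<1}"
      by (auto simp: p_def torus_measure_def sets_restrict_space_iff)
    have "emeasure (d g) A = emeasure (p g) A" for g
      unfolding d_def using A by (subst emeasure_distr) (auto simp: p_def Int_absorb2)
    then show "emeasure (p f) A = emeasure (p (\<lambda>s. - f s)) A"
      using \<open>d f = d (\<lambda>s. - f s)\<close> by metis
  qed (simp add: p_def)
  then have "AE s in M. ennreal (max 0 (f s)) = ennreal (max 0 (- f s))"
    unfolding p_def by (intro M.density_unique) auto
  then show ?thesis
    by eventually_elim (auto simp: max_def split: if_splits)
qed

text \<open>A vanishing form makes the centered tail zero \<open>dW\<close>-almost everywhere. As
  \<open>W\<close> is strictly increasing, such zeros approach each point of \<open>(0,1]\<close>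
  from the left, and left continuity makes the tail constant there. The tail at 1 is zero, so all
  tails at positive points vanish, and these determine \<open>f\<close>.\<close>

lemma green_strict:
  assumes f: "f \<in> L2 M" and zero: "l2_inner M (green f) f = 0"
  shows "AE x in M. f x = 0"
proof -
  let ?u = "\<lambda>y. tail f y - tail_mean f"
  note [measurable] = tail_measurable[OF f]
  have "AE y in N. ?u y * ?u y = 0"
  proof (rule integral_nonneg_eq_0_iff_AE[THEN iffD1])
    have b: "\<bar>?u y\<bar> \<le> 2 * (\<integral>s. \<bar>f s\<bar> \<partial>M)" for y
      using tail_bound[OF f, of y] tail_mean_bound[OF f] by linarith
    have "\<bar>?u y * ?u y\<bar> \<le> 2 * (\<integral>s. \<bar>f s\<bar> \<partial>M) * (2 * (\<integral>s. \<bar>f s\<bar> \<partial>M))" for y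
      unfolding abs_mult by (intro mult_mono b) auto
    then show "integrable N (\<lambda>y. ?u y * ?u y)"
      by (rule integrable_N_bounded[rotated]) measurable
    show "(\<integral>y. ?u y * ?u y \<partial>N) = 0" using zero f by (simp add: green_inner)
  qed simp
  then have AEu: "AE y in N. ?u y = 0" by simp
  have dense: "\<exists>z. a < z \<and> z \<le> b \<and> ?u z = 0" if ab: "0 \<le> a" "a < b" "b \<le> 1" for a b
  proof (rule ccontr)
    assume no: "\<not> ?thesis"
    have "AE z in N. z \<notin> {a<..b}"
      using AEu no by (auto elim!: eventually_mono)
    moreover have "{z \<in> space N. \<not> z \<notin> {a<..b}} = {a<..b}" "{a<..b} \<in> sets N"
      using ab by (auto simp: sets_restrict_space_iff)
    ultimately have "emeasure N {a<..b} = 0"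
      using AE_iff_measurable[of "{a<..b}" N "\<lambda>z. z \<notin> {a<..b}"] by simp
    moreover have "W a < W b" using ab W_mono by (simp add: strict_monoD)
    ultimately show False using ab by (simp add: emeasure_N ennreal_eq_0_iff)
  qed
  have const: "tail f y = tail_mean f" if y: "0 < y" "y \<le> 1" for y
  proof -
    have "\<exists>z. max 0 (y - 1 / real (Suc n)) < z \<and> z \<le> y \<and> ?u z = 0" for n
      using y by (intro dense) auto
    then obtain z where z: "\<And>n. max 0 (y - 1 / real (Suc n)) < z n" "\<And>n. z n \<le> y" "\<And>n. ?u (z n) = 0"
      by metis
    have "(\<lambda>n. y - 1 / real (Suc n)) \<longlonglongrightarrow> y - 0"
      by (intro tendsto_diff tendsto_const LIMSEQ_inverse_real_of_nat[unfolded inverse_eq_divide])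
    then have "z \<longlonglongrightarrow> y"
      using z(1,2) by (intro tendsto_sandwich[of "\<lambda>n. y - 1 / real (Suc n)" z sequentially "\<lambda>n. y" y])
        (auto intro!: always_eventually less_imp_le)
    from tail_left_continuous[OF f this z(2)] have "(\<lambda>n. tail f (z n)) \<longlonglongrightarrow> tail f y" .
    moreover have "(\<lambda>n. tail f (z n)) = (\<lambda>n. tail_mean f)" using z(3) by auto
    ultimately show ?thesis by (simp add: LIMSEQ_const_iff)
  qed
  have large: "tail f y = 0" if "1 \<le> y" for y
  proof -
    have "tail f y = (\<integral>s. 0 \<partial>M)"
      unfolding tail_def by (rule Bochner_Integration.integral_cong) (use that in auto)
    then show ?thesis by simp
  qed
  \<comment> \<open>The point \<open>y = 1\<close> belongs to both ranges and identifies the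
    constant \<open>tail_mean f\<close> as zero.\<close>
  have tail0: "tail f y = 0" if "0 < y" for y
    using const[of 1] large[of 1] const[of y] large[of y] that by (cases "y \<le> 1") auto
  \<comment> \<open>The closed tails from \<open>x + 1/(n+1)\<close> increase to the open tail from
    \<open>x\<close>, the form in which \<open>f\<close> is recovered.\<close>
  have pos: "(\<integral>s. (if x < s then f s else 0) \<partial>M) = 0" if "0 \<le> x" for x
  proof -
    have "(\<lambda>n. tail f (x + 1 / real (Suc n))) \<longlonglongrightarrow> (\<integral>s. (if x < s then f s else 0) \<partial>M)"
      unfolding tail_def
    proof (rule integral_dominated_convergence[where w = "\<lambda>s. \<bar>f s\<bar>"])
      note [measurable] = L2_measurable[OF f]
      show "(\<lambda>s. if x < s then f s else 0) \<in> borel_measurable M" by measurable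
      show "integrable M (\<lambda>s. \<bar>f s\<bar>)" using M.L2_integrable[OF f] by simp
      show "AE s in M. (\<lambda>n. if x + 1 / real (Suc n) \<le> s then f s else 0) \<longlonglongrightarrow> (if x < s then f s else 0)"
      proof (intro AE_I2)
        fix s
        show "(\<lambda>n. if x + 1 / real (Suc n) \<le> s then f s else 0) \<longlonglongrightarrow> (if x < s then f s else 0)"
        proof (cases "x < s")
          case True
          have "(\<lambda>n. x + 1 / real (Suc n)) \<longlonglongrightarrow> x + 0"
            by (intro tendsto_add tendsto_const LIMSEQ_inverse_real_of_nat[unfolded inverse_eq_divide])
          then have "\<forall>\<^sub>F n in sequentially. x + 1 / real (Suc n) < s"
            using order_tendstoD(2)[of _ "x + 0"] True by simp
          then have "\<forall>\<^sub>F n in sequentially. (if x + 1 / real (Suc n) \<le> s then f s else 0) = f s"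
            by eventually_elim simp
          then show ?thesis using True by (simp add: tendsto_eventually)
        next
          case False
          have "(if x + 1 / real (Suc n) \<le> s then f s else 0) = 0" for n
          proof -
            have "0 < 1 / real (Suc n)" by simp
            then have "\<not> x + 1 / real (Suc n) \<le> s" using False by linarith
            then show ?thesis by simp
          qed
          then show ?thesis using False by simp
        qed
      qed
    qed (use tail_integrable[OF f] in auto)
    moreover have "tail f (x + 1 / real (Suc n)) = 0" for n
      using that by (intro tail0 add_nonneg_pos) auto
    ultimately show ?thesis by (simp add: LIMSEQ_const_iff)
  qed
  have "(\<integral>s. (if x < s then f s else 0) \<partial>M) = 0" for x
  proof (cases "0 \<le> x")
    case False
    note [measurable] = L2_measurable[OF f]
    \<comment> \<open>For negative \<open>x\<close> the ray contains all of \<open>[0,1)\<close>,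
      which differs from the case \<open>x = 0\<close> by the null point 0.\<close>
    have "(\<integral>s. (if x < s then f s else 0) \<partial>M) = (\<integral>s. (if 0 < s then f s else 0) \<partial>M)"
    proof (rule integral_cong_AE)
      show "AE s in M. (if x < s then f s else 0) = (if 0 < s then f s else 0)"
        using AE_M_nonzero AE_space by eventually_elim (use False in auto)
    qed measurable
    then show ?thesis using pos[of 0] by simp
  qed (rule pos)
  then show ?thesis by (rule integral_greaterThan_eq_0_imp_AE[OF f])
qed

section \<open>Kernel formula and compactness\<close>

lemma W_measurable [measurable]: "W \<in> borel_measurable M" "W \<in> borel_measurable N"
proof -
  have W: "W \<in> borel_measurable borel" by (rule borel_measurable_mono) (simp add: monoI W_le)
  show "W \<in> borel_measurable M" using measurable_compose[OF id_M W] by simp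
  show "W \<in> borel_measurable N" using measurable_compose[OF id_N W] by simp
qed

lemma integral_N_step:
  assumes "0 \<le> x" "x \<le> 1" shows "(\<integral>y. (if y \<le> x then c else 0) \<partial>N) = c * W x"
proof -
  have "(\<integral>y. (if y \<le> x then c else 0) \<partial>N) = (\<integral>y. c * indicator {0<..x} y \<partial>N)"
    by (rule Bochner_Integration.integral_cong) (auto simp: indicator_def)
  also have "\<dots> = c * measure N {0<..x}"
  proof -
    have "{0<..x} \<inter> {0<..1} = {0<..x}" using assms by auto
    then show ?thesis by simp
  qed
  also have "measure N {0<..x} = W x"
    using emeasure_N[of 0 x] assms W_le[of 0 x] by (simp add: measure_def W0)
  finally show ?thesis .
qed

lemma green_eq:
  assumes f: "f \<in> L2 M" and x: "0 \<le> x" "x \<le> 1"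
  shows "green f x = (\<integral>y. (if y \<le> x then tail f y else 0) \<partial>N) - tail_mean f * W x"
proof -
  note [measurable] = tail_measurable[OF f]
  have "\<bar>if y \<le> x then tail f y else 0\<bar> \<le> (\<integral>s. \<bar>f s\<bar> \<partial>M)" for y
    using tail_bound[OF f, of y] by auto
  then have 1: "integrable N (\<lambda>y. if y \<le> x then tail f y else 0)"
    by (rule integrable_N_bounded[rotated]) measurable
  have 2: "integrable N (\<lambda>y. if y \<le> x then tail_mean f else 0)"
    by (rule integrable_N_bounded[where B = "\<bar>tail_mean f\<bar>"]) auto
  have "green f x = (\<integral>y. (if y \<le> x then tail f y else 0) - (if y \<le> x then tail_mean f else 0) \<partial>N)"
    unfolding green_def by (rule Bochner_Integration.integral_cong) auto
  then show ?thesis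
    by (simp only: Bochner_Integration.integral_diff[OF 1 2] integral_N_step[OF x])
qed

text \<open>Fubini with the indicator of \<open>y \<le> x\<close> produces the kernel
  \<open>W (min x s)\<close>. Pulling the minimum out of \<open>W\<close> shows that the value
  depends on \<open>x\<close> through \<open>W x\<close> alone, which the compactness argument
  exploits.\<close>

lemma integral_tail:
  assumes f: "f \<in> L2 M" and x: "0 \<le> x" "x \<le> 1"
  shows "(\<integral>y. (if y \<le> x then tail f y else 0) \<partial>N) = (\<integral>s. min (W x) (W s) * f s \<partial>M)"
proof -
  let ?u = "\<lambda>y. if y \<le> x then 1 else 0 :: real"
  have "(\<integral>y. (if y \<le> x then tail f y else 0) \<partial>N) = (\<integral>y. ?u y * tail f y \<partial>N)"
    by (rule Bochner_Integration.integral_cong) auto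
  also have "\<dots> = (\<integral>s. f s * (\<integral>y. (if y \<le> s then ?u y else 0) \<partial>N) \<partial>M)"
    by (rule Fubini_tail[symmetric, OF _ _ f, where B = 1]) auto
  also have "\<dots> = (\<integral>s. min (W x) (W s) * f s \<partial>M)"
  proof (rule Bochner_Integration.integral_cong[OF refl])
    fix s assume "s \<in> space M"
    then have s: "0 \<le> min x s" "min x s \<le> 1" using x by auto
    have "(\<integral>y. (if y \<le> s then ?u y else 0) \<partial>N) = (\<integral>y. (if y \<le> min x s then 1 else 0) \<partial>N)"
      by (rule Bochner_Integration.integral_cong) auto
    also have "\<dots> = W (min x s)" using integral_N_step[OF s, of 1] by simp
    also have "\<dots> = min (W x) (W s)" using W_le[of x s] W_le[of s x] by (auto simp: min_def)
    finally show "f s * (\<integral>y. (if y \<le> s then ?u y else 0) \<partial>N) = min (W x) (W s) * f s" by simp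
  qed
  finally show ?thesis .
qed

lemma min_W_integrable:
  assumes f: "f \<in> L2 M" shows "integrable M (\<lambda>s. min w (W s) * f s)"
proof (rule Bochner_Integration.integrable_bound)
  note [measurable] = L2_measurable[OF f]
  show "integrable M (\<lambda>s. (\<bar>w\<bar> + W 1) * f s)" using M.L2_integrable[OF f] by simp
  show "(\<lambda>s. min w (W s) * f s) \<in> borel_measurable M" by measurable
  have "\<bar>min w (W s)\<bar> \<le> \<bar>\<bar>w\<bar> + W 1\<bar>" if "s \<in> space M" for s
    using that W_le[of 0 s] W_le[of s 1] W0 by auto
  then show "AE s in M. norm (min w (W s) * f s) \<le> norm ((\<bar>w\<bar> + W 1) * f s)"
    by (intro AE_I2) (auto simp: abs_mult intro!: mult_right_mono)
qed

text \<open>The range of \<open>green\<close> consists of functions \<open>\<phi> \<circ> W\<close> with \<open>\<phi>\<close> Lipschitz, so Arzela-Ascoli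
  applies although the functions themselves jump with \<open>W\<close>.\<close>

lemma green_compact:
  assumes F: "\<And>n. F n \<in> L2 M" and F1: "\<And>n. l2_norm M (F n) \<le> 1"
  shows "\<exists>(r::nat \<Rightarrow> nat) g. strict_mono r \<and> g \<in> L2 M \<and> (\<lambda>n. l2_norm M (\<lambda>x. g x - green (F (r n)) x)) \<longlonglongrightarrow> 0"
proof -
  \<comment> \<open>Each of the two terms of \<open>\<phi>\<close> is Lipschitz with the
    \<open>L^1\<close> norm of \<open>F n\<close> as constant, and that norm is at most
    \<open>sqrt (measure M (space M))\<close> because \<open>F n\<close> has norm at most 1.\<close>
  define L where "L = 2 * sqrt (measure M (space M))"
  \<comment> \<open>The variable \<open>w\<close> stands for \<open>W x\<close> but runs through the
    full interval up to \<open>W 1\<close>, including the values that \<open>W\<close> skips by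
    jumping, so that the domain is compact.\<close>
  define \<phi> where "\<phi> n w = (\<integral>s. min w (W s) * F n s \<partial>M) - w * tail_mean (F n)" for n w
  have L1: "2 * (\<integral>s. \<bar>F n s\<bar> \<partial>M) \<le> L" for n
  proof -
    have "(\<integral>s. \<bar>F n s\<bar> \<partial>M) \<le> sqrt (measure M (space M)) * l2_norm M (F n)" by (rule M.L2_L1_bound[OF F])
    also have "\<dots> \<le> sqrt (measure M (space M)) * 1" by (intro mult_left_mono F1) simp
    finally show ?thesis by (simp add: L_def)
  qed
  have L0: "0 \<le> L" by (simp add: L_def)
  have lip: "\<bar>\<phi> n w - \<phi> n w'\<bar> \<le> L * \<bar>w - w'\<bar>" for n w w'
  proof -
    have "\<bar>(\<integral>s. min w (W s) * F n s \<partial>M) - (\<integral>s. min w' (W s) * F n s \<partial>M)\<bar>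
        = \<bar>\<integral>s. min w (W s) * F n s - min w' (W s) * F n s \<partial>M\<bar>"
      by (simp add: min_W_integrable F)
    also have "\<dots> \<le> (\<integral>s. \<bar>w - w'\<bar> * \<bar>F n s\<bar> \<partial>M)"
    proof (rule order_trans[OF integral_abs_bound integral_mono])
      show "\<bar>min w (W s) * F n s - min w' (W s) * F n s\<bar> \<le> \<bar>w - w'\<bar> * \<bar>F n s\<bar>" for s
        unfolding left_diff_distrib[symmetric] abs_mult by (intro mult_right_mono) (auto simp: min_def)
    qed (use min_W_integrable[OF F] M.L2_integrable[OF F] in auto)
    also have "\<dots> = \<bar>w - w'\<bar> * (\<integral>s. \<bar>F n s\<bar> \<partial>M)" by simp
    finally have "\<bar>(\<integral>s. min w (W s) * F n s \<partial>M) - (\<integral>s. min w' (W s) * F n s \<partial>M)\<bar>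
        \<le> \<bar>w - w'\<bar> * (\<integral>s. \<bar>F n s\<bar> \<partial>M)" .
    moreover have "\<bar>(w - w') * tail_mean (F n)\<bar> \<le> \<bar>w - w'\<bar> * (\<integral>s. \<bar>F n s\<bar> \<partial>M)"
      unfolding abs_mult by (intro mult_left_mono tail_mean_bound F) simp
    moreover have "\<phi> n w - \<phi> n w' = ((\<integral>s. min w (W s) * F n s \<partial>M) - (\<integral>s. min w' (W s) * F n s \<partial>M))
        - (w - w') * tail_mean (F n)"
      by (simp add: \<phi>_def left_diff_distrib)
    ultimately have "\<bar>\<phi> n w - \<phi> n w'\<bar> \<le> \<bar>w - w'\<bar> * (2 * (\<integral>s. \<bar>F n s\<bar> \<partial>M))"
      by linarith
    also have "\<dots> \<le> \<bar>w - w'\<bar> * L" by (intro mult_left_mono L1) simp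
    finally show ?thesis by (simp add: mult.commute)
  qed
  have \<phi>0: "\<phi> n 0 = 0" for n
  proof -
    have "(\<integral>s. min 0 (W s) * F n s \<partial>M) = (\<integral>s. 0 \<partial>M)"
      by (rule Bochner_Integration.integral_cong) (use W_le[of 0] W0 in auto)
    then show ?thesis by (simp add: \<phi>_def)
  qed
  have green_\<phi>: "green (F n) x = \<phi> n (W x)" if "x \<in> space M" for n x
    using that by (simp add: green_eq F integral_tail \<phi>_def mult.commute)
  obtain g k where k: "strict_mono (k :: nat \<Rightarrow> nat)"
    and conv: "\<And>e. 0 < e \<Longrightarrow> \<exists>n0. \<forall>n w. n \<ge> n0 \<and> w \<in> {0..W 1} \<longrightarrow> norm (\<phi> (k n) w - g w) < e"
  proof (rule Arzela_Ascoli[of "{0..W 1}" \<phi> "L * W 1"])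
    show "norm (\<phi> n w) \<le> L * W 1" if "w \<in> {0..W 1}" for n w
      using lip[of n w 0] \<phi>0[of n] that mult_left_mono[OF _ L0, of w "W 1"] by auto
    show "\<exists>d. 0 < d \<and> (\<forall>n w'. w' \<in> {0..W 1} \<and> norm (w - w') < d \<longrightarrow> norm (\<phi> n w - \<phi> n w') < e)"
      if "0 < e" for w e
    proof (intro exI[of _ "e / (L + 1)"] conjI allI impI)
      show "0 < e / (L + 1)" using that L0 by simp
      fix n w' assume "w' \<in> {0..W 1} \<and> norm (w - w') < e / (L + 1)"
      then have "\<bar>w - w'\<bar> * (L + 1) < e" using L0 by (simp add: pos_less_divide_eq)
      moreover have "L * \<bar>w - w'\<bar> \<le> \<bar>w - w'\<bar> * (L + 1)" by (simp add: algebra_simps)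
      ultimately show "norm (\<phi> n w - \<phi> n w') < e" using lip[of n w w'] by simp
    qed
  qed (auto intro: that)
  have W_range: "W x \<in> {0..W 1}" if "x \<in> space M" for x
    using that W_le[of 0 x] W_le[of x 1] W0 by auto
  \<comment> \<open>Uniform convergence in \<open>w\<close> becomes uniform convergence on the torus
    after composition with \<open>W\<close>, jumps included.\<close>
  have unif: "\<exists>n0. \<forall>n\<ge>n0. \<forall>x\<in>space M. \<bar>g (W x) - green (F (k n)) x\<bar> < e" if e: "0 < e" for e
  proof -
    obtain n0 where n0: "\<forall>n w. n \<ge> n0 \<and> w \<in> {0..W 1} \<longrightarrow> norm (\<phi> (k n) w - g w) < e"
      using conv[OF e] by blast
    show ?thesis
    proof (intro exI[of _ n0] allI impI ballI)
      fix n x assume "n0 \<le> n" and x: "x \<in> space M"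
      then have "norm (\<phi> (k n) (W x) - g (W x)) < e" using n0 W_range[OF x] by blast
      then show "\<bar>g (W x) - green (F (k n)) x\<bar> < e"
        using green_\<phi>[OF x] by (simp add: abs_minus_commute)
    qed
  qed
  have meas: "(\<lambda>x. g (W x)) \<in> borel_measurable M"
  proof (rule borel_measurable_LIMSEQ_real)
    show "(\<lambda>n. green (F (k n)) x) \<longlonglongrightarrow> g (W x)" if x: "x \<in> space M" for x
      unfolding LIMSEQ_iff
      using unif x by (metis abs_minus_commute real_norm_def)
    show "green (F (k n)) \<in> borel_measurable M" for n by (rule green_measurable[OF F])
  qed
  have diff_meas: "(\<lambda>x. g (W x) - green (F (k n)) x) \<in> borel_measurable M" for n
    using meas green_measurable[OF F] by (rule borel_measurable_diff)
  have gL: "(\<lambda>x. g (W x)) \<in> L2 M"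
  proof -
    obtain n0 where n0: "\<forall>n\<ge>n0. \<forall>x\<in>space M. \<bar>g (W x) - green (F (k n)) x\<bar> < 1"
      using unif[of 1] by auto
    have "(\<lambda>x. g (W x) - green (F (k n0)) x) \<in> L2 M"
      using n0 by (intro M.L2_bounded[OF diff_meas, of _ 1]) (auto intro: less_imp_le)
    from L2_add[OF this green_L2[OF F[of "k n0"]]] show ?thesis by simp
  qed
  have "(\<lambda>n. l2_norm M (\<lambda>x. g (W x) - green (F (k n)) x)) \<longlonglongrightarrow> 0"
  proof (rule LIMSEQ_I)
    fix e :: real assume e: "0 < e"
    define m where "m = sqrt (measure M (space M))"
    have m0: "0 \<le> m" by (simp add: m_def)
    obtain n0 where n0: "\<forall>n\<ge>n0. \<forall>x\<in>space M. \<bar>g (W x) - green (F (k n)) x\<bar> < e / (m + 1)"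
      using unif[of "e / (m + 1)"] e m0 by auto
    have "l2_norm M (\<lambda>x. g (W x) - green (F (k n)) x) < e" if "n \<ge> n0" for n
    proof -
      have "l2_norm M (\<lambda>x. g (W x) - green (F (k n)) x) \<le> e / (m + 1) * m"
        unfolding m_def[symmetric] using n0 that e m0
        by (subst m_def) (intro M.l2_norm_le_bound diff_meas, auto intro: less_imp_le simp: m_def)
      also have "\<dots> < e" using e m0 by (simp add: field_simps)
      finally show ?thesis .
    qed
    then show "\<exists>n0. \<forall>n\<ge>n0. norm (l2_norm M (\<lambda>x. g (W x) - green (F (k n)) x) - 0) < e"
      using l2_norm_nonneg[of M] by (intro exI[of _ n0]) simp
  qed
  then show ?thesis using k gL by blast
qed

section \<open>The Laplacians as inverses of the Green operator\<close>

lemma WV_integral_eq: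
  assumes g: "g \<in> L2 M" and x: "0 \<le> x" "x \<le> 1"
  shows "WV_integral W V g x = (\<integral>s. g s \<partial>M) * W x - green g x - tail_mean g * W x"
proof -
  define t where "t = (\<integral>s. g s \<partial>M)"
  \<comment> \<open>The integral over \<open>[0,y)\<close> is the total minus the tail over
    \<open>[y,1)\<close>; the total contributes only a multiple of \<open>W\<close>.\<close>
  have inner: "(LINT s:{0..<y}|interval_measure_left V. g s) = t - tail g y" if y: "0 < y" "y \<le> 1" for y
  proof -
    have "t - tail g y = (\<integral>s. g s - (if y \<le> s then g s else 0) \<partial>M)"
      unfolding t_def tail_def
      using M.L2_integrable[OF g] tail_integrable[OF g] by (rule Bochner_Integration.integral_diff[symmetric])
    also have "\<dots> = (\<integral>s. indicator {0..<1} s *\<^sub>R (g s - (if y \<le> s then g s else 0)) \<partial>interval_measure_left V)"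
      unfolding torus_measure_def by (rule integral_restrict_space) simp
    also have "\<dots> = (LINT s:{0..<y}|interval_measure_left V. g s)"
      unfolding set_lebesgue_integral_def
      by (rule Bochner_Integration.integral_cong) (use y in \<open>auto simp: indicator_def\<close>)
    finally show ?thesis ..
  qed
  note [measurable] = tail_measurable[OF g]
  have "\<bar>if y \<le> x then tail g y else 0\<bar> \<le> (\<integral>s. \<bar>g s\<bar> \<partial>M)" for y
    using tail_bound[OF g, of y] by auto
  then have 1: "integrable N (\<lambda>y. if y \<le> x then tail g y else 0)"
    by (rule integrable_N_bounded[rotated]) measurable
  have 2: "integrable N (\<lambda>y. if y \<le> x then t else 0)"
    by (rule integrable_N_bounded[where B = "\<bar>t\<bar>"]) auto
  have "WV_integral W V g x
      = (\<integral>y. indicator {0<..1} y *\<^sub>R ((if y \<le> x then t else 0) - (if y \<le> x then tail g y else 0)) \<partial>interval_measure W)"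
    unfolding WV_integral_def set_lebesgue_integral_def[of "interval_measure W"]
    by (rule Bochner_Integration.integral_cong) (use x in \<open>auto simp: indicator_def inner\<close>)
  also have "\<dots> = (\<integral>y. (if y \<le> x then t else 0) - (if y \<le> x then tail g y else 0) \<partial>N)"
    by (rule integral_restrict_space[symmetric]) simp
  also have "\<dots> = t * W x - (\<integral>y. (if y \<le> x then tail g y else 0) \<partial>N)"
    by (simp only: Bochner_Integration.integral_diff[OF 2 1] integral_N_step[OF x])
  finally show ?thesis by (simp add: green_eq[OF g x] t_def)
qed

lemma green_1: "g \<in> L2 M \<Longrightarrow> green g 1 = 0"
proof -
  assume g: "g \<in> L2 M"
  have "green g 1 = (\<integral>y. tail g y - tail_mean g \<partial>N)"
    unfolding green_def by (rule Bochner_Integration.integral_cong) auto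
  then show ?thesis by (simp add: tail_centered[OF g])
qed

text \<open>Since \<open>green g\<close> vanishes at 1, the boundary condition forces all multiples
  of \<open>W\<close> to cancel. The minus sign appears because \<open>green\<close> inverts the
  negative of the Dirichlet Laplacian.\<close>

lemma WV_solution_eq:
  assumes g: "g \<in> L2 M" and b: "b * W 1 + WV_integral W V g 1 = 0" and x: "x \<in> space M"
  shows "b * W x + WV_integral W V g x = - green g x"
proof -
  have "(b + (\<integral>s. g s \<partial>M) - tail_mean g) * W 1 = 0"
    using b by (simp add: WV_integral_eq[OF g] green_1[OF g] algebra_simps)
  then have "b = tail_mean g - (\<integral>s. g s \<partial>M)" using W1 by simp
  then show ?thesis using x by (simp add: WV_integral_eq[OF g] left_diff_distrib)
qed

lemma WV_boundary_exists: "\<exists>b. b * W 1 + WV_integral W V g 1 = 0"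
  using W1 by (intro exI[of _ "- WV_integral W V g 1 / W 1"]) simp

text \<open>A value of \<open>b\<close> meeting the boundary condition always exists, and each such
  value leads to the same function, so the existential over \<open>b\<close> disappears.\<close>

lemma neg_dirichlet_iff:
  "(f, h) \<in> l2_neg (WV_laplacian_dirichlet W V) \<longleftrightarrow> l2_eq M f (green h) \<and> h \<in> L2 M"
proof -
  have "(f, h) \<in> l2_neg (WV_laplacian_dirichlet W V) \<longleftrightarrow> f \<in> L2 M \<and> h \<in> L2 M \<and>
    (\<exists>b. (AE x in M. f x = b * W x + WV_integral W V (\<lambda>x. - h x) x) \<and> b * W 1 + WV_integral W V (\<lambda>x. - h x) 1 = 0)"
    using L2_uminus[of "\<lambda>x. - h x" M] L2_uminus[of h M]
    by (auto simp: l2_neg_def WV_laplacian_dirichlet_def)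
  also have "\<dots> \<longleftrightarrow> f \<in> L2 M \<and> h \<in> L2 M \<and> (AE x in M. f x = green h x)"
  proof (intro conj_cong refl)
    assume "h \<in> L2 M"
    then have h: "(\<lambda>x. - h x) \<in> L2 M" by (rule L2_uminus)
    have eq: "(AE x in M. f x = b * W x + WV_integral W V (\<lambda>x. - h x) x) \<longleftrightarrow> (AE x in M. f x = green h x)"
      if "b * W 1 + WV_integral W V (\<lambda>x. - h x) 1 = 0" for b
      by (intro AE_cong) (simp add: WV_solution_eq[OF h that] green_uminus del: space_M)
    then show "(\<exists>b. (AE x in M. f x = b * W x + WV_integral W V (\<lambda>x. - h x) x) \<and>
        b * W 1 + WV_integral W V (\<lambda>x. - h x) 1 = 0) \<longleftrightarrow> (AE x in M. f x = green h x)"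
      using WV_boundary_exists by blast
  qed
  finally show ?thesis by (auto simp: l2_eq_def green_L2)
qed

text \<open>The surviving constant \<open>a\<close> reflects the kernel of the periodic operator,
  and the zero mean of \<open>h\<close> is orthogonality to that kernel.\<close>

lemma neg_laplacian_iff:
  "(f, h) \<in> l2_neg (WV_laplacian W V) \<longleftrightarrow> f \<in> L2 M \<and> h \<in> L2 M \<and> (\<integral>x. h x \<partial>M) = 0 \<and>
    (\<exists>a. AE x in M. f x = a + green h x)"
proof -
  have "(f, h) \<in> l2_neg (WV_laplacian W V) \<longleftrightarrow> f \<in> L2 M \<and> h \<in> L2 M \<and> (\<integral>x. h x \<partial>M) = 0 \<and>
    (\<exists>a b. (AE x in M. f x = a + b * W x + WV_integral W V (\<lambda>x. - h x) x) \<and> b * W 1 + WV_integral W V (\<lambda>x. - h x) 1 = 0)"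
    using L2_uminus[of "\<lambda>x. - h x" M] L2_uminus[of h M]
    by (auto simp: l2_neg_def WV_laplacian_def L2_zero_mean_def)
  also have "\<dots> \<longleftrightarrow> f \<in> L2 M \<and> h \<in> L2 M \<and> (\<integral>x. h x \<partial>M) = 0 \<and> (\<exists>a. AE x in M. f x = a + green h x)"
  proof (intro conj_cong refl)
    assume "h \<in> L2 M"
    then have h: "(\<lambda>x. - h x) \<in> L2 M" by (rule L2_uminus)
    have eq: "(AE x in M. f x = a + b * W x + WV_integral W V (\<lambda>x. - h x) x) \<longleftrightarrow> (AE x in M. f x = a + green h x)"
      if b: "b * W 1 + WV_integral W V (\<lambda>x. - h x) 1 = 0" for a b
    proof (intro AE_cong)
      fix x assume "x \<in> space M"
      from WV_solution_eq[OF h b this] show "(f x = a + b * W x + WV_integral W V (\<lambda>x. - h x) x) = (f x = a + green h x)"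
        by (simp add: green_uminus add.assoc)
    qed
    then show "(\<exists>a b. (AE x in M. f x = a + b * W x + WV_integral W V (\<lambda>x. - h x) x) \<and>
        b * W 1 + WV_integral W V (\<lambda>x. - h x) 1 = 0) \<longleftrightarrow> (\<exists>a. AE x in M. f x = a + green h x)"
      using WV_boundary_exists by blast
  qed
  finally show ?thesis .
qed

end

section \<open>Eigenvalue comparison\<close>

text \<open>Gaussian elimination by induction on the number of equations, over arbitrary finite
  index sets so that it applies directly to sets of functions.\<close>

lemma underdetermined_nontrivial_solution:
  fixes c :: "'i \<Rightarrow> nat \<Rightarrow> real"
  assumes "finite I" "d < card I"
  shows "\<exists>x. (\<exists>i\<in>I. x i \<noteq> 0) \<and> (\<forall>j<d. (\<Sum>i\<in>I. x i * c i j) = 0)"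
  using assms
proof (induction d arbitrary: I c)
  case 0
  then obtain i where "i \<in> I" by fastforce
  then show ?case by (intro exI[of _ "\<lambda>_. 1"]) auto
next
  case (Suc d)
  show ?case
  proof (cases "\<forall>i\<in>I. c i d = 0")
    case True
    obtain x where x: "\<exists>i\<in>I. x i \<noteq> 0" "\<forall>j<d. (\<Sum>i\<in>I. x i * c i j) = 0"
      using Suc.IH[of I c] Suc.prems by auto
    have "(\<Sum>i\<in>I. x i * c i j) = 0" if "j < Suc d" for j
      using x(2) True that by (cases "j = d") auto
    then show ?thesis using x(1) by blast
  next
    case False
    then obtain p where p: "p \<in> I" "c p d \<noteq> 0" by blast
    \<comment> \<open>Solving equation \<open>d\<close> for the unknown at the pivot
      \<open>p\<close> and substituting into the others gives these coefficients; those of equation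
      \<open>d\<close> become zero.\<close>
    define c' where "c' i j = c i j - c i d / c p d * c p j" for i j
    have "card (I - {p}) = card I - 1" using p Suc.prems(1) by simp
    then have "d < card (I - {p})" using Suc.prems(2) by linarith
    then obtain y where y: "\<exists>i\<in>I - {p}. y i \<noteq> 0" "\<forall>j<d. (\<Sum>i\<in>I - {p}. y i * c' i j) = 0"
      using Suc.IH[of "I - {p}" c'] Suc.prems(1) by auto
    define x where "x i = (if i = p then - (\<Sum>i\<in>I - {p}. y i * (c i d / c p d)) else y i)" for i
    have "(\<Sum>i\<in>I. x i * c i j) = 0" if j: "j < Suc d" for j
    proof -
      have "(\<Sum>i\<in>I. x i * c i j) = x p * c p j + (\<Sum>i\<in>I - {p}. x i * c i j)"
        using Suc.prems(1) p(1) by (rule sum.remove)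
      also have "(\<Sum>i\<in>I - {p}. x i * c i j) = (\<Sum>i\<in>I - {p}. y i * c i j)"
        by (intro sum.cong) (auto simp: x_def)
      also have "x p * c p j = - (\<Sum>i\<in>I - {p}. y i * (c i d / c p d * c p j))"
        by (simp add: x_def sum_distrib_right mult.assoc)
      finally have eq: "(\<Sum>i\<in>I. x i * c i j) = (\<Sum>i\<in>I - {p}. y i * c' i j)"
        by (simp add: c'_def right_diff_distrib sum_subtractf)
      show ?thesis
      proof (cases "j = d")
        case True
        then have "c' i j = 0" for i using p by (simp add: c'_def)
        then show ?thesis by (simp add: eq)
      next
        case False
        then show ?thesis using eq y(2) j by simp
      qed
    qed
    moreover have "\<exists>i\<in>I. x i \<noteq> 0" using y(1) by (auto simp: x_def)
    ultimately show ?thesis by blast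
  qed
qed

context l2_basis
begin

text \<open>More than \<open>d\<close> eigenvectors with \<open>d\<close> coordinates each would
  admit a nontrivial combination whose coordinates all vanish, contrary to orthonormality.\<close>

lemma card_basis_eigenvectors_le:
  assumes dim: "l2_has_dim M (l2_eigenspace M (diag_op \<theta>) \<mu>) d"
    and F: "finite F" "F \<subseteq> {e \<in> S. \<theta> e = \<mu>}"
  shows "card F \<le> d"
proof (rule ccontr)
  assume "\<not> card F \<le> d"
  obtain b where b: "\<forall>f\<in>l2_eigenspace M (diag_op \<theta>) \<mu>. \<exists>!c. c \<in> {..<d} \<rightarrow>\<^sub>E (UNIV :: real set) \<and>
      (AE x in M. f x = (\<Sum>i<d. c i * b i x))"
    using dim unfolding l2_has_dim_def by blast
  have FS: "F \<subseteq> S" using F(2) by blast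
  have "\<exists>c. AE x in M. e x = (\<Sum>i<d. c i * b i x)" if e: "e \<in> F" for e
  proof -
    have "e \<in> l2_eigenspace M (diag_op \<theta>) \<mu>"
      using diag_op_basis[of e \<theta>] basis_L2[of e] e F(2) by (auto simp: l2_eigenspace_def)
    then show ?thesis using b by blast
  qed
  then have "\<forall>e\<in>F. \<exists>c. AE x in M. e x = (\<Sum>i<d. c i * b i x)" by (intro ballI)
  from bchoice[OF this] obtain c
    where c: "\<And>e. e \<in> F \<Longrightarrow> AE x in M. e x = (\<Sum>i<d. c e i * b i x)" by blast
  obtain x where x: "\<exists>e\<in>F. x e \<noteq> 0" "\<forall>j<d. (\<Sum>e\<in>F. x e * c e j) = 0"
    using underdetermined_nontrivial_solution[OF F(1), of d c] \<open>\<not> card F \<le> d\<close> by auto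
  have "AE t in M. \<forall>e\<in>F. e t = (\<Sum>i<d. c e i * b i t)"
    using c F(1) by (intro AE_finite_allI) auto
  then have z: "AE t in M. lincomb x F t = 0"
  proof eventually_elim
    case (elim t)
    have "lincomb x F t = (\<Sum>e\<in>F. \<Sum>i<d. x e * c e i * b i t)"
      unfolding lincomb_def
    proof (intro sum.cong refl)
      fix e assume "e \<in> F"
      with elim have "e t = (\<Sum>i<d. c e i * b i t)" by blast
      then show "x e * e t = (\<Sum>i<d. x e * c e i * b i t)"
        by (simp only: sum_distrib_left mult.assoc)
    qed
    also have "\<dots> = (\<Sum>i<d. (\<Sum>e\<in>F. x e * c e i) * b i t)"
      by (subst sum.swap) (simp add: sum_distrib_right)
    also have "\<dots> = 0" using x(2) by simp
    finally show ?case .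
  qed
  obtain e where e: "e \<in> F" "x e \<noteq> 0" using x(1) by blast
  have "l2_inner M (lincomb x F) e = l2_inner M (\<lambda>_. 0) e"
    using z basis_L2[of e] FS e(1) by (intro l2_inner_cong_AE lincomb_L2 L2_zero) auto
  then have "x e = 0"
    using lincomb_coeff[OF FS F(1), of e x] FS e(1) by (auto simp: l2_inner_zero_left)
  then show False using e(2) by simp
qed

text \<open>For each eigenvalue the basis vectors are at most as many as its indices, and distinct
  eigenvalues use distinct indices, so the injections glue. An injection is enough to dominate sums
  over \<open>S\<close> by series over the list.\<close>

lemma eigenvalue_sequence_injection:
  assumes ev: "l2_eigenvalue_sequence M (diag_op \<theta>) ev"
  obtains j where "inj_on j S" "\<And>e. e \<in> S \<Longrightarrow> ev (j e) = \<theta> e"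
proof -
  have "\<exists>h. inj_on h {e \<in> S. \<theta> e = \<mu>} \<and> h ` {e \<in> S. \<theta> e = \<mu>} \<subseteq> {n. ev n = \<mu>}" for \<mu>
  proof -
    have fin: "finite {n. ev n = \<mu>}"
      and dim: "l2_has_dim M (l2_eigenspace M (diag_op \<theta>) \<mu>) (card {n. ev n = \<mu>})"
      using ev by (auto simp: l2_eigenvalue_sequence_def)
    note le = card_basis_eigenvectors_le[OF dim]
    have finS: "finite {e \<in> S. \<theta> e = \<mu>}"
    proof (rule ccontr)
      assume "infinite {e \<in> S. \<theta> e = \<mu>}"
      then obtain F where "finite F" "card F = Suc (card {n. ev n = \<mu>})" "F \<subseteq> {e \<in> S. \<theta> e = \<mu>}"
        using infinite_arbitrarily_large by blast
      then show False using le[of F] by simp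
    qed
    obtain h where "h ` {e \<in> S. \<theta> e = \<mu>} \<subseteq> {n. ev n = \<mu>}" "inj_on h {e \<in> S. \<theta> e = \<mu>}"
      using card_le_inj[OF finS fin le[OF finS order_refl]] by blast
    then show ?thesis by blast
  qed
  then have "\<exists>h. \<forall>\<mu>. inj_on (h \<mu>) {e \<in> S. \<theta> e = \<mu>} \<and> h \<mu> ` {e \<in> S. \<theta> e = \<mu>} \<subseteq> {n. ev n = \<mu>}"
    by (intro choice allI)
  then obtain h where h: "\<And>\<mu>. inj_on (h \<mu>) {e \<in> S. \<theta> e = \<mu>}"
    "\<And>\<mu>. h \<mu> ` {e \<in> S. \<theta> e = \<mu>} \<subseteq> {n. ev n = \<mu>}" by blast
  define j where "j e = h (\<theta> e) e" for e
  have ev_j: "ev (j e) = \<theta> e" if "e \<in> S" for e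
    using h(2)[of "\<theta> e"] that by (auto simp: j_def)
  have "inj_on j S"
  proof (rule inj_onI)
    fix e e' assume e: "e \<in> S" "e' \<in> S" "j e = j e'"
    then have "\<theta> e = \<theta> e'" using ev_j[of e] ev_j[of e'] by simp
    then show "e = e'" using inj_onD[OF h(1)[of "\<theta> e'"], of e e'] e by (simp add: j_def)
  qed
  then show ?thesis using that ev_j by blast
qed

end

section \<open>Trace comparison by concavity\<close>

lemma summable_on_compose_inj:
  fixes u :: "nat \<Rightarrow> real"
  assumes "summable u" "\<And>n. 0 \<le> u n" "inj_on j A"
  shows "(\<lambda>a. u (j a)) summable_on A"
proof -
  have "u summable_on UNIV" using assms(1,2) by (simp add: summable_on_UNIV_nonneg_real_iff)
  then have "u summable_on (j ` A)" by (rule summable_on_subset_banach) simp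
  then show ?thesis using summable_on_reindex[OF assms(3), of u] by (simp add: o_def)
qed

text \<open>The right-hand side is the tangent at \<open>w\<close> of the concave function
  \<open>x powr t\<close>. The bound is Young's inequality rescaled by
  \<open>w powr (t - 1)\<close>.\<close>

lemma powr_tangent_bound:
  fixes x w t :: real
  assumes "0 < x" "0 < w" "0 \<le> t" "t \<le> 1"
  shows "x powr t \<le> t * w powr (t - 1) * x + (1 - t) * w powr t"
proof -
  have "x powr t * w powr (1 - t) \<le> t * x + (1 - t) * w"
    using assms by (intro Youngs_inequality_0) auto
  then have "w powr (t - 1) * (x powr t * w powr (1 - t)) \<le> w powr (t - 1) * (t * x + (1 - t) * w)"
    by (intro mult_left_mono) auto
  moreover have "w powr (t - 1) * (x powr t * w powr (1 - t)) = x powr t"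
    using assms(2) by (simp add: mult.left_commute powr_add[symmetric])
  moreover have "w powr (t - 1) * w = w powr t"
    using assms(2) powr_add[of w "t - 1" 1] by simp
  then have "w powr (t - 1) * (t * x + (1 - t) * w) = t * w powr (t - 1) * x + (1 - t) * w powr t"
    by (simp add: distrib_left mult_ac)
  ultimately show ?thesis by simp
qed

text \<open>By concavity of \<open>x \<mapsto> x\<^sup>t\<close>, \<open>\<langle>A\<^sup>t e, e\<rangle> \<le> \<langle>A e, e\<rangle>\<^sup>t\<close> for every unit vector \<open>e\<close>; summing over any
  orthonormal basis bounds the trace of \<open>A\<^sup>t\<close>.\<close>

lemma eigenvalue_powr_summable:
  fixes M :: "'a measure"
  assumes "l2_basis M S" and "l2_basis M S'"
    and A: "\<And>f. f \<in> L2 M \<Longrightarrow> A f \<in> L2 M"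
    and eig: "\<And>f g. f \<in> L2 M \<Longrightarrow> g \<in> S' \<Longrightarrow> l2_inner M (A f) g = \<kappa> g * l2_inner M f g"
    and \<kappa>: "\<And>g. g \<in> S' \<Longrightarrow> 0 < \<kappa> g"
    and w: "\<And>e. e \<in> S \<Longrightarrow> 0 < l2_inner M (A e) e"
    and t: "0 \<le> t" "t \<le> 1"
    and sum: "(\<lambda>e. l2_inner M (A e) e powr t) summable_on S"
  shows "(\<lambda>g. \<kappa> g powr t) summable_on S'"
proof -
  interpret S: l2_basis M S by fact
  interpret S': l2_basis M S' by fact
  define w where "w e = l2_inner M (A e) e" for e
  have intw: "integrable (count_space S) (\<lambda>e. w e powr t)"
  proof (rule nonneg_abs_summable_on_bounded)
    fix F assume "finite F" "F \<subseteq> S"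
    then show "(\<Sum>e\<in>F. w e powr t) \<le> infsum (\<lambda>e. w e powr t) S"
      using sum by (intro finite_sum_le_infsum) (auto simp: w_def)
  qed simp
  \<comment> \<open>The tangent is taken at \<open>w e\<close>. The weights \<open><e, g>^2\<close>
    over \<open>F\<close> sum to at most 1, which suffices because the constant term of the tangent
    is nonnegative.\<close>
  have jensen: "(\<Sum>g\<in>F. \<kappa> g powr t * (l2_inner M e g)\<^sup>2) \<le> w e powr t"
    if F: "finite F" "F \<subseteq> S'" and e: "e \<in> S" for F e
  proof -
    have eL: "e \<in> L2 M" by (rule S.basis_L2[OF e])
    have w0: "0 < w e" using assms(6)[OF e] by (simp add: w_def)
    have Ae: "l2_inner M (A e) g * l2_inner M e g = \<kappa> g * (l2_inner M e g)\<^sup>2" if "g \<in> S'" for g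
      using eig[OF eL that] by (simp add: power2_eq_square)
    have int: "integrable (count_space S') (\<lambda>g. \<kappa> g * (l2_inner M e g)\<^sup>2)"
      using S'.coeff_mult_integrable[OF A[OF eL] eL]
      by (subst Bochner_Integration.integrable_cong[OF refl Ae[symmetric]]) auto
    have "(\<Sum>g\<in>F. \<kappa> g * (l2_inner M e g)\<^sup>2) \<le> (\<integral>g. \<kappa> g * (l2_inner M e g)\<^sup>2 \<partial>count_space S')"
      using F by (intro sum_le_count_space_integral int)
        (auto intro!: mult_nonneg_nonneg less_imp_le[OF \<kappa>])
    also have "\<dots> = (\<integral>g. l2_inner M (A e) g * l2_inner M e g \<partial>count_space S')"
      by (rule Bochner_Integration.integral_cong) (auto simp: Ae)
    also have "\<dots> = w e" unfolding w_def by (rule S'.Parseval[OF A[OF eL] eL, symmetric])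
    finally have le_w: "(\<Sum>g\<in>F. \<kappa> g * (l2_inner M e g)\<^sup>2) \<le> w e" .
    have le_1: "(\<Sum>g\<in>F. (l2_inner M e g)\<^sup>2) \<le> 1"
      using S'.Bessel_finite[OF F(2,1) eL] S.basis_self[OF e] by simp
    have "(\<Sum>g\<in>F. \<kappa> g powr t * (l2_inner M e g)\<^sup>2)
        \<le> (\<Sum>g\<in>F. (t * w e powr (t - 1) * \<kappa> g + (1 - t) * w e powr t) * (l2_inner M e g)\<^sup>2)"
      using F(2) \<kappa> w0 t by (intro sum_mono mult_right_mono powr_tangent_bound) auto
    also have "\<dots> = t * w e powr (t - 1) * (\<Sum>g\<in>F. \<kappa> g * (l2_inner M e g)\<^sup>2)
        + (1 - t) * w e powr t * (\<Sum>g\<in>F. (l2_inner M e g)\<^sup>2)"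
      by (simp add: sum_distrib_left sum.distrib distrib_right mult.assoc)
    also have "\<dots> \<le> t * w e powr (t - 1) * w e + (1 - t) * w e powr t * 1"
      using t by (intro add_mono mult_left_mono le_w le_1) auto
    also have "\<dots> = w e powr t"
      using w0 powr_add[of "w e" "t - 1" 1] by (simp add: algebra_simps)
    finally show ?thesis .
  qed
  have "integrable (count_space S') (\<lambda>g. \<kappa> g powr t)"
  proof (rule nonneg_abs_summable_on_bounded)
    fix F assume F: "finite F" "F \<subseteq> S'"
    have sq: "integrable (count_space S) (\<lambda>e. \<kappa> g powr t * (l2_inner M e g)\<^sup>2)" if "g \<in> F" for g
      using S.coeff_square_integrable[OF S'.basis_L2[of g]] that F(2)
      by (subst l2_inner_commute) auto
    \<comment> \<open>Each term is multiplied by 1, written as the square sum of the coefficients of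
      the unit vector \<open>g\<close> over \<open>S\<close>. As \<open>F\<close> is finite, sum and
      integral commute and the bound for each \<open>e\<close> applies.\<close>
    have "(\<Sum>g\<in>F. \<kappa> g powr t) = (\<Sum>g\<in>F. \<integral>e. \<kappa> g powr t * (l2_inner M e g)\<^sup>2 \<partial>count_space S)"
    proof (intro sum.cong refl)
      fix g assume "g \<in> F"
      then have g: "g \<in> S'" using F(2) by blast
      show "\<kappa> g powr t = (\<integral>e. \<kappa> g powr t * (l2_inner M e g)\<^sup>2 \<partial>count_space S)"
      proof -
        have "(\<integral>e. \<kappa> g powr t * (l2_inner M e g)\<^sup>2 \<partial>count_space S)
            = \<kappa> g powr t * (\<integral>e. (l2_inner M g e)\<^sup>2 \<partial>count_space S)"
          by (simp only: l2_inner_commute[of M g] integral_mult_right_zero)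
        also have "\<dots> = \<kappa> g powr t"
          using S.Parseval_self[OF S'.basis_L2[OF g]] S'.basis_self[OF g] by simp
        finally show ?thesis ..
      qed
    qed
    also have "\<dots> = (\<integral>e. (\<Sum>g\<in>F. \<kappa> g powr t * (l2_inner M e g)\<^sup>2) \<partial>count_space S)"
      by (rule Bochner_Integration.integral_sum[symmetric]) (rule sq)
    also have "\<dots> \<le> (\<integral>e. w e powr t \<partial>count_space S)"
      using jensen[OF F] by (intro integral_mono Bochner_Integration.integrable_sum sq intw) auto
    finally show "(\<Sum>g\<in>F. \<kappa> g powr t) \<le> (\<integral>e. w e powr t \<partial>count_space S)" .
  qed simp
  then have "Infinite_Set_Sum.abs_summable_on (\<lambda>g. \<kappa> g powr t) S'"
    by (simp add: Infinite_Set_Sum.abs_summable_on_def)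
  then have "(\<lambda>g. norm (\<kappa> g powr t)) summable_on S'" by (simp only: abs_summable_equivalent)
  then show ?thesis by (rule abs_summable_summable)
qed

section \<open>Eigenbases of the two Laplacians\<close>

context WV_functions
begin

definition green_const :: real where
  "green_const = 2 * W 1 * measure M (space M)"

sublocale green: l2_compact_operator M green green_const
  by unfold_locales
    (use green_L2 green_symmetric green_nonneg green_norm_le green_compact in \<open>auto simp: green_const_def simp del: space_M\<close>)

lemma measure_M: "measure M (space M) = V 1"
  using emeasure_M[of "{0..<1}"] emeasure_V[of 0 1] V_le[of 0 1] V0 by (simp add: measure_def)

lemma V1: "0 < V 1"
  using strict_monoD[OF V_mono, of 0 1] V0 by simp

lemma green_const_pos: "0 < green_const"
  using W1 V1 by (simp add: green_const_def measure_M del: space_M)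

lemma green_inner_pos:
  assumes e: "e \<in> L2 M" "l2_inner M e e = 1" shows "0 < l2_inner M (green e) e"
proof -
  have "l2_inner M (green e) e \<noteq> 0"
  proof
    assume "l2_inner M (green e) e = 0"
    then have "AE x in M. e x = 0" by (rule green_strict[OF e(1)])
    then show False using e by (simp add: l2_inner_self_eq_0[symmetric])
  qed
  then show ?thesis using green_nonneg[OF e(1)] by simp
qed

definition mean :: "(real \<Rightarrow> real) \<Rightarrow> real" where
  "mean f = (\<integral>x. f x \<partial>M) / V 1"

definition proj :: "(real \<Rightarrow> real) \<Rightarrow> real \<Rightarrow> real" where
  "proj f x = f x - mean f"

definition green0 :: "(real \<Rightarrow> real) \<Rightarrow> real \<Rightarrow> real" where
  "green0 f = proj (green (proj f))"

lemma proj_L2: "f \<in> L2 M \<Longrightarrow> proj f \<in> L2 M"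
  unfolding proj_def[abs_def] by (intro L2_diff M.L2_const)

lemma integral_proj: "f \<in> L2 M \<Longrightarrow> (\<integral>x. proj f x \<partial>M) = 0"
  using V1 M.L2_integrable[of f] measure_M unfolding proj_def by (simp add: mean_def)

lemma inner_const: "l2_inner M (\<lambda>_. c) f = c * (\<integral>x. f x \<partial>M)"
  by (simp add: l2_inner_def)

lemma inner_proj_left:
  "f \<in> L2 M \<Longrightarrow> g \<in> L2 M \<Longrightarrow> l2_inner M (proj f) g = l2_inner M f g - mean f * (\<integral>x. g x \<partial>M)"
  unfolding proj_def[abs_def] by (simp add: l2_inner_diff_left M.L2_const inner_const)

lemma proj_symmetric: "f \<in> L2 M \<Longrightarrow> g \<in> L2 M \<Longrightarrow> l2_inner M (proj f) g = l2_inner M f (proj g)"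
  using inner_proj_left[of f g] inner_proj_left[of g f]
  by (simp add: l2_inner_commute[of M f "proj g"] l2_inner_commute[of M f g] mean_def)

lemma proj_norm_le: "f \<in> L2 M \<Longrightarrow> l2_norm M (proj f) \<le> l2_norm M f"
proof -
  assume f: "f \<in> L2 M"
  have "l2_inner M (proj f) (proj f) = l2_inner M f (proj f)"
    by (simp add: inner_proj_left f proj_L2 integral_proj)
  also have "\<dots> = l2_inner M f f - V 1 * (mean f)\<^sup>2"
    using V1 by (subst l2_inner_commute) (simp add: inner_proj_left f mean_def power2_eq_square)
  also have "\<dots> \<le> l2_inner M f f" using V1 by simp
  finally show ?thesis by (simp add: l2_norm_def)
qed

lemma proj_diff: "f \<in> L2 M \<Longrightarrow> g \<in> L2 M \<Longrightarrow> proj (\<lambda>x. f x - g x) = (\<lambda>x. proj f x - proj g x)"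
  unfolding proj_def[abs_def] mean_def by (simp add: M.L2_integrable diff_divide_distrib fun_eq_iff)

lemma proj_id: "(\<integral>x. f x \<partial>M) = 0 \<Longrightarrow> proj f = f"
  by (simp add: proj_def[abs_def] mean_def)

lemma green0_L2: "f \<in> L2 M \<Longrightarrow> green0 f \<in> L2 M"
  unfolding green0_def by (intro proj_L2 green_L2)

lemma green0_inner:
  "f \<in> L2 M \<Longrightarrow> g \<in> L2 M \<Longrightarrow> l2_inner M (green0 f) g = l2_inner M (green (proj f)) (proj g)"
  unfolding green0_def by (intro proj_symmetric green_L2 proj_L2)

lemma green0_norm_le:
  assumes f: "f \<in> L2 M" shows "l2_norm M (green0 f) \<le> green_const * l2_norm M f"
proof -
  have "l2_norm M (green0 f) \<le> l2_norm M (green (proj f))"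
    unfolding green0_def by (intro proj_norm_le green_L2 proj_L2 f)
  also have "\<dots> \<le> green_const * l2_norm M (proj f)" by (intro green.T_norm_le proj_L2 f)
  also have "\<dots> \<le> green_const * l2_norm M f"
    using green_const_pos by (intro mult_left_mono proj_norm_le f) simp
  finally show ?thesis .
qed

text \<open>Projecting the sequence keeps it in the unit ball, and projecting the limit does not
  increase distances.\<close>

lemma green0_compact:
  assumes F: "\<And>n. F n \<in> L2 M" and F1: "\<And>n. l2_norm M (F n) \<le> 1"
  shows "\<exists>(r::nat \<Rightarrow> nat) g. strict_mono r \<and> g \<in> L2 M \<and> (\<lambda>n. l2_norm M (\<lambda>x. g x - green0 (F (r n)) x)) \<longlonglongrightarrow> 0"
proof -
  have "l2_norm M (proj (F n)) \<le> 1" for n using order_trans[OF proj_norm_le[OF F] F1] .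
  then obtain r :: "nat \<Rightarrow> nat" and g where r: "strict_mono r" and g: "g \<in> L2 M"
    and lim: "(\<lambda>n. l2_norm M (\<lambda>x. g x - green (proj (F (r n))) x)) \<longlonglongrightarrow> 0"
    using green_compact[of "\<lambda>n. proj (F n)"] proj_L2[OF F] by blast
  have "(\<lambda>n. l2_norm M (\<lambda>x. proj g x - green0 (F (r n)) x)) \<longlonglongrightarrow> 0"
  proof (rule nonneg_tendsto_0[OF l2_norm_nonneg _ lim])
    fix n
    have gr: "green (proj (F (r n))) \<in> L2 M" by (intro green_L2 proj_L2 F)
    show "l2_norm M (\<lambda>x. proj g x - green0 (F (r n)) x) \<le> l2_norm M (\<lambda>x. g x - green (proj (F (r n))) x)"
      using proj_norm_le[OF L2_diff[OF g gr]] by (simp add: proj_diff[OF g gr] green0_def)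
  qed
  then show ?thesis using r proj_L2[OF g] by blast
qed

sublocale green0: l2_compact_operator M green0 green_const
proof
  show "l2_inner M (green0 f) g = l2_inner M f (green0 g)" if "f \<in> L2 M" "g \<in> L2 M" for f g
    using green0_inner[OF that] green0_inner[OF that(2,1)] green_symmetric[OF that[THEN proj_L2]]
      l2_inner_commute[of M "proj f" "green (proj g)"] l2_inner_commute[of M f "green0 g"] by simp
  show "0 \<le> l2_inner M (green0 f) f" if "f \<in> L2 M" for f
    using that by (simp add: green0_inner green_nonneg proj_L2)
qed (use green0_L2 green0_norm_le green0_compact in auto)

lemma l2_eq_inner_scale:
  assumes "l2_eq M f (\<lambda>x. c * e x)" "e \<in> L2 M" "h \<in> L2 M"
  shows "l2_inner M h f = c * l2_inner M h e"
proof -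
  have "l2_inner M h f = l2_inner M h (\<lambda>x. c * e x)"
    using assms by (intro l2_inner_cong_AE) (auto simp: l2_eq_def)
  then show ?thesis by (simp add: l2_inner_scale_right)
qed

text \<open>Strict positivity makes every eigenvalue \<kappa> of \<open>green\<close> nonzero, so
  \<open>f = green h\<close> and \<open>h = f / \<kappa>\<close> are the same relation coefficient
  by coefficient, domains included.\<close>

lemma dirichlet_eigenbasis:
  obtains S where "l2_basis M S"
    "\<And>f e. f \<in> L2 M \<Longrightarrow> e \<in> S \<Longrightarrow> l2_inner M (green f) e = l2_inner M (green e) e * l2_inner M f e"
    "l2_neg (WV_laplacian_dirichlet W V) = l2_basis.diag_op M S (\<lambda>e. 1 / l2_inner M (green e) e)"
proof -
  obtain S where S: "l2_orthonormal_basis M S"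
    and eig: "\<And>e. e \<in> S \<Longrightarrow> l2_eq M (green e) (\<lambda>x. l2_inner M (green e) e * e x)"
    using green.eigenbasis_exists by blast
  interpret S: l2_basis M S by unfold_locales (rule S)
  define \<kappa> where "\<kappa> e = l2_inner M (green e) e" for e
  have coeff: "l2_inner M (green f) e = \<kappa> e * l2_inner M f e" if "f \<in> L2 M" "e \<in> S" for f e
    using l2_eq_inner_scale[OF eig[OF that(2)] S.basis_L2[OF that(2)] that(1)]
    by (simp add: green_symmetric that S.basis_L2 \<kappa>_def)
  have \<kappa>0: "\<kappa> e \<noteq> 0" if "e \<in> S" for e
    using green_inner_pos[OF S.basis_L2[OF that] S.basis_self[OF that]] by (simp add: \<kappa>_def)
  have "(f, h) \<in> l2_neg (WV_laplacian_dirichlet W V) \<longleftrightarrow> (f, h) \<in> S.diag_op (\<lambda>e. 1 / \<kappa> e)" for f h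
  proof -
    have "l2_eq M f (green h) \<longleftrightarrow> f \<in> L2 M \<and> (\<forall>e\<in>S. l2_inner M f e = l2_inner M (green h) e)"
      if h: "h \<in> L2 M"
    proof
      assume "l2_eq M f (green h)"
      then show "f \<in> L2 M \<and> (\<forall>e\<in>S. l2_inner M f e = l2_inner M (green h) e)"
        using l2_eq_inner[of M f "green h"] S.basis_L2 by (simp add: l2_eq_def)
    next
      assume "f \<in> L2 M \<and> (\<forall>e\<in>S. l2_inner M f e = l2_inner M (green h) e)"
      then show "l2_eq M f (green h)"
        using S.coeff_eq_imp_AE_eq[of f "green h"] green_L2[OF h] by (simp add: l2_eq_def)
    qed
    moreover have "l2_inner M f e = l2_inner M (green h) e \<longleftrightarrow> l2_inner M h e = 1 / \<kappa> e * l2_inner M f e"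
      if "h \<in> L2 M" "e \<in> S" for e
      using coeff[OF that] \<kappa>0[OF that(2)] by (auto simp: field_simps)
    ultimately show ?thesis unfolding neg_dirichlet_iff S.diag_op_def by auto
  qed
  then have "l2_neg (WV_laplacian_dirichlet W V) = S.diag_op (\<lambda>e. 1 / \<kappa> e)" by auto
  then show ?thesis using that[OF S.l2_basis_axioms] coeff by (simp add: \<kappa>_def)
qed

text \<open>On constants \<open>green0\<close> vanishes, and \<open>1 / 0 = 0\<close> is then the eigenvalue of \<open>-\<Delta>\<close>.\<close>

lemma periodic_eigenbasis:
  obtains S \<nu> where "l2_basis M S"
    "\<And>e. e \<in> S \<Longrightarrow> 0 \<le> \<nu> e"
    "\<And>e. e \<in> S \<Longrightarrow> \<nu> e \<noteq> 0 \<Longrightarrow> l2_inner M (green e) e = \<nu> e"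
    "l2_neg (WV_laplacian W V) = l2_basis.diag_op M S (\<lambda>e. 1 / \<nu> e)"
proof -
  obtain S where S: "l2_orthonormal_basis M S"
    and eig: "\<And>e. e \<in> S \<Longrightarrow> l2_eq M (green0 e) (\<lambda>x. l2_inner M (green0 e) e * e x)"
    using green0.eigenbasis_exists by blast
  interpret S: l2_basis M S by unfold_locales (rule S)
  note eL = S.basis_L2
  define \<nu> where "\<nu> e = l2_inner M (green0 e) e" for e
  have coeff: "l2_inner M (green0 f) e = \<nu> e * l2_inner M f e" if "f \<in> L2 M" "e \<in> S" for f e
    using l2_eq_inner_scale[OF eig[OF that(2)] eL[OF that(2)] that(1)]
    by (simp add: green0.T_symmetric that eL \<nu>_def)
  have \<nu>_nonneg: "0 \<le> \<nu> e" if "e \<in> S" for e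
    unfolding \<nu>_def by (rule green0.T_nonneg[OF eL[OF that]])
  \<comment> \<open>Constants project to zero, so \<open>green0\<close> annihilates 1; the
    coefficient formula then forces mean zero whenever \<open>\<nu> e\<close> is nonzero.\<close>
  have mean0: "(\<integral>x. e x \<partial>M) = 0" if e: "e \<in> S" "\<nu> e \<noteq> 0" for e
  proof -
    have "l2_inner M (green0 (\<lambda>_. 1)) e = \<nu> e * l2_inner M (\<lambda>_. 1) e"
      by (rule coeff[OF M.L2_const e(1)])
    moreover have "proj (\<lambda>_. 1) = (\<lambda>_. 0)"
      using V1 measure_M by (simp add: proj_def[abs_def] mean_def)
    then have "l2_inner M (green0 (\<lambda>_. 1)) e = 0"
      by (simp only: green0_inner[OF M.L2_const eL[OF e(1)]] green_symmetric[OF L2_zero proj_L2[OF eL[OF e(1)]]]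
          l2_inner_zero_left)
    ultimately show ?thesis using e(2) by (simp add: inner_const)
  qed
  \<comment> \<open>Strict positivity of \<open>green\<close>, applied to the projected vector: only
    constants can have \<open>\<nu> e = 0\<close>.\<close>
  have proj_zero: "AE x in M. proj e x = 0" if e: "e \<in> S" "\<nu> e = 0" for e
    using e green0_inner[OF eL eL, OF e(1) e(1)] by (intro green_strict proj_L2 eL) (simp_all add: \<nu>_def)
  have inner_proj_zero: "l2_inner M f (proj e) = 0" if e: "e \<in> S" "\<nu> e = 0" and f: "f \<in> L2 M" for e f
  proof -
    have "l2_inner M f (proj e) = l2_inner M f (\<lambda>_. 0)"
      using proj_zero[OF e] by (intro l2_inner_cong_AE f proj_L2 eL e L2_zero) auto
    then show ?thesis by (simp add: l2_inner_zero_right)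
  qed
  have green_\<nu>: "l2_inner M (green e) e = \<nu> e" if "e \<in> S" "\<nu> e \<noteq> 0" for e
    using green0_inner[OF eL eL, OF that(1) that(1)] proj_id[OF mean0[OF that]] by (simp add: \<nu>_def)
  have green_coeff: "l2_inner M (green h) e = \<nu> e * l2_inner M h e"
    if h: "h \<in> L2 M" "(\<integral>x. h x \<partial>M) = 0" and e: "e \<in> S" "\<nu> e \<noteq> 0" for h e
    using coeff[OF h(1) e(1)] green0_inner[OF h(1) eL[OF e(1)]]
    by (simp add: proj_id[OF h(2)] proj_id[OF mean0[OF e]])
  have "(f, h) \<in> l2_neg (WV_laplacian W V) \<longleftrightarrow> (f, h) \<in> S.diag_op (\<lambda>e. 1 / \<nu> e)" for f h
  proof
    assume "(f, h) \<in> l2_neg (WV_laplacian W V)"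
    then obtain a where f: "f \<in> L2 M" and h: "h \<in> L2 M" "(\<integral>x. h x \<partial>M) = 0"
      and fa: "AE x in M. f x = a + green h x"
      unfolding neg_laplacian_iff by blast
    have "l2_inner M h e = 1 / \<nu> e * l2_inner M f e" if e: "e \<in> S" for e
    proof (cases "\<nu> e = 0")
      case True
      have "l2_inner M h e = l2_inner M (proj h) e" by (simp add: proj_id[OF h(2)])
      also have "\<dots> = 0" using inner_proj_zero[OF e True h(1)] by (simp add: proj_symmetric h eL e)
      finally show ?thesis using True by simp
    next
      case False
      have "l2_inner M f e = l2_inner M (\<lambda>x. a + green h x) e"
        using fa by (intro l2_inner_cong_AE f L2_add M.L2_const green_L2 h eL e) auto
      also have "\<dots> = \<nu> e * l2_inner M h e"
        by (simp add: l2_inner_add_left M.L2_const green_L2 h eL e inner_const mean0 False green_coeff)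
      finally show ?thesis using False by simp
    qed
    then show "(f, h) \<in> S.diag_op (\<lambda>e. 1 / \<nu> e)" using f h by (simp add: S.diag_op_def)
  next
    assume fh: "(f, h) \<in> S.diag_op (\<lambda>e. 1 / \<nu> e)"
    have f: "f \<in> L2 M" and h: "h \<in> L2 M" using S.diag_op_L2[OF fh] by auto
    have hc: "l2_inner M h e = 1 / \<nu> e * l2_inner M f e" if "e \<in> S" for e
      by (rule S.diag_op_coeff[OF fh that])
    have "(\<integral>x. h x \<partial>M) = l2_inner M h (\<lambda>_. 1)" by (simp add: l2_inner_def)
    also have "\<dots> = (\<integral>e. l2_inner M h e * l2_inner M (\<lambda>_. 1) e \<partial>count_space S)"
      by (rule S.Parseval[OF h M.L2_const])
    \<comment> \<open>One factor of each product is zero: for \<open>\<nu> e = 0\<close> the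
      coefficient of \<open>h\<close>, because \<open>1 / 0 = 0\<close>, and otherwise the mean of
      \<open>e\<close>.\<close>
    also have "\<dots> = (\<integral>e. 0 \<partial>count_space S)"
    proof (rule Bochner_Integration.integral_cong[OF refl])
      fix e assume "e \<in> space (count_space S)"
      then have "e \<in> S" by simp
      then show "l2_inner M h e * l2_inner M (\<lambda>_. 1) e = 0"
        using hc[of e] mean0[of e] by (cases "\<nu> e = 0") (auto simp: inner_const)
    qed
    finally have h0: "(\<integral>x. h x \<partial>M) = 0" by simp
    \<comment> \<open>The domain condition asks this difference to be constant, that is, its
      projection to have only zero coefficients; the constant is then \<open>mean d\<close>.\<close>
    define d where "d x = f x - green h x" for x
    have d: "d \<in> L2 M" unfolding d_def[abs_def] by (intro L2_diff f green_L2 h)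
    have "l2_inner M (proj d) e = 0" if e: "e \<in> S" for e
    proof (cases "\<nu> e = 0")
      case True
      then show ?thesis using inner_proj_zero[OF e True d] by (simp add: proj_symmetric d eL e)
    next
      case False
      have "l2_inner M (proj d) e = l2_inner M d e"
        by (simp add: inner_proj_left d eL e mean0 False)
      also have "\<dots> = l2_inner M f e - \<nu> e * l2_inner M h e"
        unfolding d_def[abs_def]
        by (simp add: l2_inner_diff_left f green_L2 h eL e green_coeff h0 False)
      also have "\<dots> = 0" using hc[OF e] False by simp
      finally show ?thesis .
    qed
    then have "AE x in M. proj d x = 0" by (intro S.basis_complete proj_L2 d)
    then have "AE x in M. f x = mean d + green h x"
      by eventually_elim (simp add: proj_def d_def)
    then show "(f, h) \<in> l2_neg (WV_laplacian W V)"
      unfolding neg_laplacian_iff using f h h0 by blast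
  qed
  then have "l2_neg (WV_laplacian W V) = S.diag_op (\<lambda>e. 1 / \<nu> e)" by auto
  then show ?thesis using that[OF S.l2_basis_axioms \<nu>_nonneg green_\<nu>] by blast
qed

end

section \<open>From diagonal forms to trace class\<close>

lemma (in l2_basis) l2_id_minus_diag:
  assumes "l2_neg T = diag_op \<theta>"
  shows "l2_id_minus T = diag_op (\<lambda>e. 1 + \<theta> e)"
proof -
  have "(f, g) \<in> l2_id_minus T \<longleftrightarrow> (f, g) \<in> diag_op (\<lambda>e. 1 + \<theta> e)" for f g
  proof -
    \<comment> \<open>Behind the two graphs: \<open>g = f - T f\<close> means
      \<open>g - f = - T f\<close>.\<close>
    have "(f, g) \<in> l2_id_minus T \<longleftrightarrow> (f, \<lambda>x. g x - f x) \<in> diag_op \<theta>"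
      unfolding assms[symmetric] by (simp add: l2_id_minus_def l2_neg_def)
    also have "\<dots> \<longleftrightarrow> (f, g) \<in> diag_op (\<lambda>e. 1 + \<theta> e)"
    proof (cases "f \<in> L2 M")
      case f: True
      have L: "(\<lambda>x. g x - f x) \<in> L2 M \<longleftrightarrow> g \<in> L2 M"
        using L2_add[OF _ f, of "\<lambda>x. g x - f x"] L2_diff[OF _ f, of g] by auto
      have "l2_inner M (\<lambda>x. g x - f x) e = \<theta> e * l2_inner M f e
          \<longleftrightarrow> l2_inner M g e = (1 + \<theta> e) * l2_inner M f e" if "g \<in> L2 M" "e \<in> S" for e
        using f that by (auto simp: l2_inner_diff_left basis_L2 algebra_simps)
      then show ?thesis using f L unfolding diag_op_def by auto
    next
      case False
      then show ?thesis by (simp add: diag_op_def)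
    qed
    finally show ?thesis .
  qed
  then show ?thesis by auto
qed

theorem proposition29:
  fixes W V :: "real \<Rightarrow> real" and ev :: "nat \<Rightarrow> real" and \<rho> s :: real
  assumes "strict_mono W" and "strict_mono V"
    and "cadlag W" and "caglad V"
    and "\<And>x. W (x + 1) - W x = W 1 - W 0" and "\<And>x. V (x + 1) - V x = V 1 - V 0"
    and "isCont W 0" and "isCont V 0"
    and "W 0 = 0" and "V 0 = 0"
    and "l2_eigenvalue_sequence (torus_measure V) (l2_neg (WV_laplacian W V)) ev"
    and "0 < \<rho>" and "\<rho> \<le> 1 / 2"
    and "\<exists>C>0. \<forall>n\<ge>1. C * real n powr (1 / \<rho>) \<le> ev n"
    and "\<forall>r>\<rho>. summable (\<lambda>i. ev (Suc i) powr (- r))"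
    and "s > \<rho>"
  shows "trace_class (torus_measure V)
           (l2_powr (torus_measure V) (l2_id_minus (WV_laplacian W V)) (- s))
       \<and> trace_class (torus_measure V)
           (l2_powr (torus_measure V) (l2_neg (WV_laplacian_dirichlet W V)) (- s))"
proof -
  interpret WV_functions W V
    using assms(1-4,8-10) by unfold_locales (auto simp: cadlag_def caglad_def)
  obtain S \<nu> where "l2_basis M S" and \<nu>0: "\<And>e. e \<in> S \<Longrightarrow> 0 \<le> \<nu> e"
    and green_\<nu>: "\<And>e. e \<in> S \<Longrightarrow> \<nu> e \<noteq> 0 \<Longrightarrow> l2_inner M (green e) e = \<nu> e"
    and per: "l2_neg (WV_laplacian W V) = l2_basis.diag_op M S (\<lambda>e. 1 / \<nu> e)"
    by (rule periodic_eigenbasis) blast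
  interpret S: l2_basis M S by fact
  obtain j where inj: "inj_on j S" and ev_j: "\<And>e. e \<in> S \<Longrightarrow> ev (j e) = 1 / \<nu> e"
    using S.eigenvalue_sequence_injection[OF assms(11)[unfolded per]] by metis
  \<comment> \<open>The growth bound yields positivity, which rules out \<open>\<nu> e = 0\<close>
    at positive indices.\<close>
  have ev_pos: "0 < ev n" if "n \<noteq> 0" for n
  proof -
    obtain C where C: "C > 0" "\<And>n. n \<ge> 1 \<Longrightarrow> C * real n powr (1 / \<rho>) \<le> ev n" using assms(14) by blast
    have "0 < C * real n powr (1 / \<rho>)" using C(1) that by simp
    also have "\<dots> \<le> ev n" using C(2) that by simp
    finally show ?thesis .
  qed
  \<comment> \<open>The summability hypothesis starts at index 1. The injection meets index 0 at
    most once, so a nonnegative placeholder \<open>c\<close> can stand for that term.\<close>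
  have sum_j: "(\<lambda>e. if j e = 0 then c else ev (j e) powr (- r)) summable_on S"
    if "r > \<rho>" "0 \<le> c" for r c
  proof (rule summable_on_compose_inj[OF _ _ inj])
    show "summable (\<lambda>n. if n = 0 then c else ev n powr (- r))"
      using assms(15) that by (subst summable_Suc_iff[symmetric]) simp
  qed (use that in simp)
  have s0: "0 < s" using assms(12,16) by simp

  have "trace_class M (S.diag_op (\<lambda>e. (1 + 1 / \<nu> e) powr (- s)))"
  proof (rule S.diag_op_trace_class)
    show "(\<lambda>e. (1 + 1 / \<nu> e) powr (- s)) summable_on S"
    proof (rule summable_on_comparison_test[OF sum_j[OF assms(16), of 1]])
      fix e assume e: "e \<in> S"
      \<comment> \<open>At index 0 the base is at least 1, hence the placeholder 1; elsewhere
        dropping the summand 1 only increases the negative power.\<close>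
      show "(1 + 1 / \<nu> e) powr (- s) \<le> (if j e = 0 then 1 else ev (j e) powr (- s))"
      proof (cases "j e = 0")
        case True
        have "(1 + 1 / \<nu> e) powr (- s) \<le> 1 powr (- s)"
          using \<nu>0[OF e] s0 by (intro powr_mono2') auto
        then show ?thesis using True by simp
      next
        case False
        then show ?thesis
          using ev_pos[OF False] ev_j[OF e] s0 powr_mono2'[of "- s" "1 / \<nu> e" "1 + 1 / \<nu> e"] by simp
      qed
    qed simp_all
  qed simp
  then have 1: "trace_class M (l2_powr M (l2_id_minus (WV_laplacian W V)) (- s))"
    by (simp only: S.l2_id_minus_diag[OF per] S.l2_powr_diag)

  obtain S' where "l2_basis M S'"
    and eig: "\<And>f e. f \<in> L2 M \<Longrightarrow> e \<in> S' \<Longrightarrow> l2_inner M (green f) e = l2_inner M (green e) e * l2_inner M f e"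
    and dir: "l2_neg (WV_laplacian_dirichlet W V) = l2_basis.diag_op M S' (\<lambda>e. 1 / l2_inner M (green e) e)"
    by (rule dirichlet_eigenbasis) blast
  interpret S': l2_basis M S' by fact
  define \<kappa> where "\<kappa> e = l2_inner M (green e) e" for e
  have \<kappa>_pos: "0 < \<kappa> e" and \<kappa>_le: "\<kappa> e \<le> green_const" if "e \<in> L2 M" "l2_inner M e e = 1" for e
    using green_inner_pos[OF that] green.T_form_le[OF that(1)] that(2) by (simp_all add: \<kappa>_def)
  note S_unit = S.basis_L2 S.basis_self and S'_unit = S'.basis_L2 S'.basis_self
  \<comment> \<open>Jensen asks for an exponent at most 1. Since \<rho> < 1, this \<open>t\<close>
    still exceeds \<rho>, and the surplus \<open>s - t\<close> is absorbed later by the bound on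
    \<open>green\<close>.\<close>
  define t where "t = min s 1"
  have t: "\<rho> < t" "0 \<le> t" "t \<le> 1" "t \<le> s" using assms(12,13,16) by (auto simp: t_def)
  have sum_S: "(\<lambda>e. \<kappa> e powr t) summable_on S"
  \<comment> \<open>The placeholder bounds the \<open>t\<close>-th power of the form of
    \<open>green\<close> on unit vectors, whichever basis vector sits at index 0.\<close>
  proof (rule summable_on_comparison_test[OF sum_j[OF t(1), of "green_const powr t"]])
    fix e assume e: "e \<in> S"
    note pos = \<kappa>_pos[OF S_unit[OF e]] and le = \<kappa>_le[OF S_unit[OF e]]
    show "\<kappa> e powr t \<le> (if j e = 0 then green_const powr t else ev (j e) powr (- t))"
    proof (cases "j e = 0")
      case True
      then show ?thesis using pos le t(2) by (simp add: powr_mono2)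
    next
      case False
      \<comment> \<open>A positive listed eigenvalue excludes the default \<open>1 / 0 = 0\<close>,
        so the form of \<open>green\<close> at \<open>e\<close> is \<open>\<nu> e\<close>.\<close>
      then have "0 < 1 / \<nu> e" using ev_pos[OF False] ev_j[OF e] by simp
      then have "\<nu> e > 0" by simp
      then have "\<kappa> e = \<nu> e" using green_\<nu>[OF e] by (simp add: \<kappa>_def)
      then show ?thesis using False ev_j[OF e] \<open>\<nu> e > 0\<close> by (simp add: powr_divide powr_minus_divide)
    qed
  qed simp_all
  have sum_t: "(\<lambda>e. \<kappa> e powr t) summable_on S'"
  proof (rule eigenvalue_powr_summable[OF S.l2_basis_axioms S'.l2_basis_axioms, where A = green])
    show "(\<lambda>e. l2_inner M (green e) e powr t) summable_on S" using sum_S by (simp only: \<kappa>_def)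
    show "l2_inner M (green f) g = \<kappa> g * l2_inner M f g" if "f \<in> L2 M" "g \<in> S'" for f g
      unfolding \<kappa>_def by (rule eig[OF that])
    show "0 < l2_inner M (green e) e" if "e \<in> S" for e
      using \<kappa>_pos[OF S_unit[OF that]] by (simp only: \<kappa>_def)
    show "0 < \<kappa> g" if "g \<in> S'" for g by (rule \<kappa>_pos[OF S'_unit[OF that]])
  qed (use green_L2 t in simp_all)
  have "trace_class M (S'.diag_op (\<lambda>e. (1 / \<kappa> e) powr (- s)))"
  proof (rule S'.diag_op_trace_class)
    show "(\<lambda>e. (1 / \<kappa> e) powr (- s)) summable_on S'"
    proof (rule summable_on_comparison_test)
      \<comment> \<open>Every \<kappa> is at most the norm bound of \<open>green\<close>, so the
        surplus power is bounded by a constant and the sum for exponent \<open>t\<close>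
        remains.\<close>
      show "(\<lambda>e. green_const powr (s - t) * \<kappa> e powr t) summable_on S'"
        by (intro summable_on_cmult_right sum_t)
      fix e assume e: "e \<in> S'"
      note pos = \<kappa>_pos[OF S'_unit[OF e]] and le = \<kappa>_le[OF S'_unit[OF e]]
      have "(1 / \<kappa> e) powr (- s) = \<kappa> e powr (s - t) * \<kappa> e powr t"
        using pos by (simp add: powr_divide powr_minus_divide flip: powr_add)
      also have "\<dots> \<le> green_const powr (s - t) * \<kappa> e powr t"
        using pos le t(4) by (intro mult_right_mono powr_mono2) auto
      finally show "(1 / \<kappa> e) powr (- s) \<le> green_const powr (s - t) * \<kappa> e powr t" .
    qed simp
  qed simp
  then have "trace_class M (l2_powr M (l2_neg (WV_laplacian_dirichlet W V)) (- s))"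
    by (simp only: dir S'.l2_powr_diag \<kappa>_def)
  with 1 show ?thesis by blast
qed

end
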